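(* Let $n\ge 2$, let $G$ be the affine Kac--Moody group of type $\widetilde A_{n-1}$, with Iwahori subgroup $B$, flag ind-variety $\mathcal F=G/B$, base point $p=eB$ and Weyl group $\widetilde S_n$. Let $w_1,w_2\in\widetilde S_n$ be distinct involutions, i.e. $w_1^2=w_2^2=\mathrm{id}$ and $w_1\neq w_2$. Then the tangent cones $C_{w_1}$ and $C_{w_2}$ at $p$ to the Schubert varieties $X_{w_1}$ and $X_{w_2}$ do not coincide as subvarieties of the tangent space $T_p\mathcal F$.
   Context: **Group and Iwahori subgroup.** $G$ is the group of invertible $n\times n$ matrices with entries in $\mathbb C(z)$. Let $\Lambda=\mathbb C(z)\cap\mathbb C[[z]]$ be the ring of rational functions regular at $z=0$. $B$ is the subgroup of all $g\in G$ with entries in $\Lambda$ such that $g|_{z=0}$ is an invertible upper triangular matrix. The Lie algebras are $\mathfrak g=\mathrm{Mat}_n(\mathbb C(z))$ and $\mathfrak b=\{x\in\mathrm{Mat}_n(\Lambda): x|_{z=0}\text{ is upper triangular}\}$. **Weyl group.** $\widetilde S_n$ is the group of all bijections $w:\mathbb Z\to\mathbb Z$ with $w(i+n)=w(i)+n$ for all $i$ and $\sum_{i=1}^n w(i)=\binom{n+1}{2}$. It is the Weyl group of $G$. An element $w$ with $w(i)=a_i+nb_i$, $1\le a_i\le n$, $1\le i\le n$, is represented in $G$ by the matrix $\dot w$ whose entry in position $(a_i,i)$ is $z^{-b_i}$ for $1\le i\le n$, all other entries being $0$. Thus for $1\le i\le n-1$ the simple reflection $s_i$ (interchanging $i$ and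 $i+1$ modulo $n$) is the usual permutation matrix, and $s_0$ (interchanging $n$ and $n+1$) corresponds to $z e_{n,1}+z^{-1}e_{1,n}+\sum_{1<j<n}e_{j,j}$. **Flag ind-variety and Schubert varieties.** $\mathcal F=G/B$ carries its standard ind-variety structure. Concretely, $gB\mapsto (gL_0\subset gL_1\subset\dots\subset gL_n)$, where $L_i=\Lambda e_1+\dots+\Lambda e_i+z\Lambda^n$, identifies $\mathcal F$ with the set of chains of full-rank $\Lambda$-lattices $M_0\subset M_1\subset\dots\subset M_n$ in $\mathbb C(z)^n$ with $M_0=zM_n$ and $\dim_{\mathbb C} M_i/M_{i-1}=1$. The chains with $z^N\Lambda^n\subseteq M_i\subseteq z^{-N}\Lambda^n$ for all $i$ form a projective variety (a closed subvariety of a product of Grassmannians of the finite-dimensional space $z^{-N}\Lambda^n/z^N\Lambda^n$), and $\mathcal F$ is the increasing union of these. For $w\in\widetilde S_n$ the Schubert variety $X_w$ is the Zariski closure of $B\dot wB/B$ in $\mathcal F$, a finite-dimensional projective variety containing $p=eB$. The tangent space $T_p\mathcal F$ is identified with $\mathfrak g/\mathfrak b$ and contains every $T_pX_w$ as a finite-dimensional subspace. **Tangent cone.** Let $\mathcal O=\mathcal O_{p,X_w}$ be the local ring of $X_w$ at $p$, $\mathfrak m$ its maximal ideal, and $R=\mathrm{gr}\,\mathcal O=\bigoplus_{i\ge0}\mathfrak m^i/\mathfrak m^{i+1}$. The tangent cone is $C_w=\mathrm{Spec}\,R$. Since $R$ is generated as a $\mathbb C$-algebra by $\mathfrak m/\mathfrak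 m^2$, it is a quotient of $\mathrm{Sym}(\mathfrak m/\mathfrak m^2)$, the algebra of regular functions on $T_pX_w$. So $C_w$ is a closed subscheme of $T_pX_w\subseteq T_p\mathcal F$, and "coincide as subvarieties of $T_p\mathcal F$" means equality of these closed subschemes (inside any finite-dimensional subspace of $T_p\mathcal F$ containing both $T_pX_{w_1}$ and $T_pX_{w_2}$). *)

theory Defs
  imports
    "HOL-Computational_Algebra.Formal_Laurent_Series"
    "HOL-Computational_Algebra.Fraction_Field"
    "HOL-Algebra.QuotRing"
    "HOL-Algebra.Ideal_Product"
    "Jordan_Normal_Form.Matrix"
begin

unbundle no fps_syntax

section \<open>Rational functions and their expansions at 0\<close>

type_synonym ratfun = "complex poly fract"

definition const :: "complex \<Rightarrow> ratfun" where
  "const c = Fract [:c:] 1"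

definition zvar :: ratfun where
  "zvar = Fract [:0, 1:] 1"

lift_definition laurent :: "ratfun \<Rightarrow> complex fls" is
  "\<lambda>(a, b). fps_to_fls (fps_of_poly a) / fps_to_fls (fps_of_poly b)"
proof -
  fix p q :: "complex poly \<times> complex poly"
  assume "fractrel p q"
  then have nz: "snd p \<noteq> 0" "snd q \<noteq> 0" and eq: "fst p * snd q = fst q * snd p"
    by (simp_all add: fractrel_def)
  let ?L = "\<lambda>a :: complex poly. fps_to_fls (fps_of_poly a)"
  have "?L (fst p) * ?L (snd q) = ?L (fst q) * ?L (snd p)"
    using eq by (metis fls_times_fps_to_fls fps_of_poly_mult)
  moreover have "?L (snd p) \<noteq> 0" "?L (snd q) \<noteq> 0"
    using nz by simp_all
  ultimately show "(case p of (a, b) \<Rightarrow> ?L a / ?L b) = (case q of (a, b) \<Rightarrow> ?L a / ?L b)"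
    by (simp add: split_beta frac_eq_eq)
qed

text \<open>The ring \<open>\<Lambda>\<close>, the intersection of \<open>\<complex>(z)\<close> and \<open>\<complex>[[z]]\<close>.\<close>

definition regular_ratfun :: "ratfun set" where
  "regular_ratfun = {f. laurent f \<in> range fps_to_fls}"

definition at_zero :: "ratfun \<Rightarrow> complex" where
  "at_zero f = fls_nth (laurent f) 0"


section \<open>The group, the Iwahori subgroup and the affine Weyl group\<close>

text \<open>
  Rows and columns of matrices are numbered from 0, so position \<open>(a, b)\<close> of the usual
  numbering is position \<open>(a - 1, b - 1)\<close> here.
\<close>

definition loop_group :: "nat \<Rightarrow> ratfun mat set" where
  "loop_group n = {g \<in> carrier_mat n n. invertible_mat g}"

definition iwahori :: "nat \<Rightarrow> ratfun mat set" where
  "iwahori n = {g \<in> loop_group n. elements_mat g \<subseteq> regular_ratfun \<and>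
      invertible_mat (map_mat at_zero g) \<and> upper_triangular (map_mat at_zero g)}"

definition iwahori_lie :: "nat \<Rightarrow> ratfun mat set" where
  "iwahori_lie n = {x \<in> carrier_mat n n. elements_mat x \<subseteq> regular_ratfun \<and>
      upper_triangular (map_mat at_zero x)}"

definition affine_sym :: "nat \<Rightarrow> (int \<Rightarrow> int) set" where
  "affine_sym n = {w. bij w \<and> (\<forall>i. w (i + int n) = w i + int n) \<and>
      (\<Sum>i = 1..int n. w i) = int ((n + 1) choose 2)}"

definition weyl_mat :: "nat \<Rightarrow> (int \<Rightarrow> int) \<Rightarrow> ratfun mat" where
  "weyl_mat n w = mat n n (\<lambda>(r, c).
      if int r = (w (int c + 1) - 1) mod int n
      then zvar powi (- ((w (int c + 1) - 1) div int n)) else 0)"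


section \<open>The flag ind-variety\<close>

text \<open>The lattice \<open>z^m \<Lambda>^n\<close>.\<close>

definition lattice :: "nat \<Rightarrow> int \<Rightarrow> ratfun vec set" where
  "lattice n m = {v \<in> carrier_vec n. \<forall>j<n. v $ j \<in> (*) (zvar powi m) ` regular_ratfun}"

text \<open>The lattice \<open>L_i = \<Lambda> e_1 + \<dots> + \<Lambda> e_i + z \<Lambda>^n\<close>, described coordinatewise.\<close>

definition std_lattice :: "nat \<Rightarrow> nat \<Rightarrow> ratfun vec set" where
  "std_lattice n i = {v \<in> carrier_vec n. \<forall>j<n.
      v $ j \<in> (if j < i then regular_ratfun else (*) zvar ` regular_ratfun)}"

type_synonym flag = "nat \<Rightarrow> ratfun vec set"

text \<open>The coset \<open>gB\<close>, as the lattice chain \<open>g L_0 \<subset> \<dots> \<subset> g L_n\<close>.\<close>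

definition flag_of :: "nat \<Rightarrow> ratfun mat \<Rightarrow> flag" where
  "flag_of n g = (\<lambda>i\<in>{..n}. (*\<^sub>v) g ` std_lattice n i)"

definition flags :: "nat \<Rightarrow> flag set" where
  "flags n = flag_of n ` loop_group n"

definition base_pt :: "nat \<Rightarrow> flag" where
  "base_pt n = flag_of n (1\<^sub>m n)"

text \<open>
  For a chain \<open>M\<close> between \<open>z^N \<Lambda>^n\<close> and \<open>z^-N \<Lambda>^n\<close>, a frame consists of a basis
  of the subspace \<open>M_i / z^N \<Lambda>^n\<close> of \<open>z^-N \<Lambda>^n / z^N \<Lambda>^n\<close>, given by representatives
  \<open>fr i 0, fr i 1, \<dots>\<close>, for each \<open>i \<le> n\<close>. Here \<open>d\<close> is the dimension for \<open>i = 0\<close>;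
  the dimension for \<open>i\<close> is then \<open>d + i\<close>.
\<close>

type_synonym frame = "nat \<Rightarrow> nat \<Rightarrow> ratfun vec"

definition is_frame :: "nat \<Rightarrow> nat \<Rightarrow> nat \<Rightarrow> flag \<Rightarrow> frame \<Rightarrow> bool" where
  "is_frame n N d M fr \<longleftrightarrow> (\<forall>i\<le>n. (\<forall>k<d + i. fr i k \<in> M i) \<and>
      (\<forall>v\<in>M i. \<exists>!c. c \<in> {..<d + i} \<rightarrow>\<^sub>E UNIV \<and>
         v - vec n (\<lambda>j. \<Sum>k<d + i. const (c k) * fr i k $ j) \<in> lattice n (int N)))"

text \<open>
  The part of the flag variety that lies in the product over \<open>i \<le> n\<close> of the Grassmannians of
  \<open>(d + i)\<close>-dimensional subspaces of \<open>z^-N \<Lambda>^n / z^N \<Lambda>^n\<close>. For fixed \<open>N\<close> the flags between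
  \<open>z^N \<Lambda>^n\<close> and \<open>z^-N \<Lambda>^n\<close> are the disjoint union of finitely many of these open and
  closed parts.
\<close>

definition flags_lvl :: "nat \<Rightarrow> nat \<Rightarrow> nat \<Rightarrow> flag set" where
  "flags_lvl n N d = {M \<in> flags n.
      (\<forall>i\<le>n. lattice n (int N) \<subseteq> M i \<and> M i \<subseteq> lattice n (- int N)) \<and>
      (\<exists>fr. is_frame n N d M fr)}"

text \<open>The algebra of functions generated by the functions in \<open>S\<close> and the constants.\<close>

inductive_set fun_algebra :: "('a \<Rightarrow> complex) set \<Rightarrow> ('a \<Rightarrow> complex) set"
  for S :: "('a \<Rightarrow> complex) set" where
  const: "(\<lambda>_. c) \<in> fun_algebra S"
| gen: "f \<in> S \<Longrightarrow> f \<in> fun_algebra S"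
| add: "f \<in> fun_algebra S \<Longrightarrow> g \<in> fun_algebra S \<Longrightarrow> (\<lambda>x. f x + g x) \<in> fun_algebra S"
| mult: "f \<in> fun_algebra S \<Longrightarrow> g \<in> fun_algebra S \<Longrightarrow> (\<lambda>x. f x * g x) \<in> fun_algebra S"

text \<open>
  Polynomials in the coordinates of the frame vectors with respect to the basis \<open>z^m e_j\<close>,
  \<open>-N \<le> m < N\<close>, of \<open>z^-N \<Lambda>^n / z^N \<Lambda>^n\<close>.
\<close>

definition frame_poly :: "nat \<Rightarrow> nat \<Rightarrow> nat \<Rightarrow> (frame \<Rightarrow> complex) set" where
  "frame_poly n N d = fun_algebra
     {\<lambda>fr. fls_nth (laurent (fr i k $ j)) m | i k j m.
        i \<le> n \<and> k < d + i \<and> j < n \<and> - int N \<le> m \<and> m < int N}"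

text \<open>
  The variety structure on a Grassmannian is that of the quotient of the variety of frames by
  the general linear group: a set of subspaces is closed iff the frames of its members are cut
  out by polynomials within all frames, and a function is regular iff it is regular as a function
  of frames. A subset of the ind-variety is closed iff its intersection with each finite-dimensional
  piece is closed.
\<close>

definition zclosed :: "nat \<Rightarrow> flag set \<Rightarrow> bool" where
  "zclosed n Z \<longleftrightarrow> Z \<subseteq> flags n \<and> (\<forall>N d. \<exists>P \<subseteq> frame_poly n N d. \<forall>M \<in> flags_lvl n N d.
      M \<in> Z \<longleftrightarrow> (\<forall>f\<in>P. \<forall>fr. is_frame n N d M fr \<longrightarrow> f fr = 0))"

definition zclosure :: "nat \<Rightarrow> flag set \<Rightarrow> flag set" where
  "zclosure n Y = \<Inter> {Z. zclosed n Z \<and> Y \<subseteq> Z}"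

definition schubert :: "nat \<Rightarrow> (int \<Rightarrow> int) \<Rightarrow> flag set" where
  "schubert n w =
     zclosure n {flag_of n (b * weyl_mat n w * b') | b b'. b \<in> iwahori n \<and> b' \<in> iwahori n}"


section \<open>The local ring at the base point\<close>

text \<open>
  On the open neighbourhood \<open>X - Z\<close> of the base point in \<open>X\<close>, the function \<open>h\<close> is the
  quotient \<open>f / g\<close> of polynomials in frame coordinates.
\<close>

definition local_quotient ::
  "nat \<Rightarrow> flag set \<Rightarrow> nat \<Rightarrow> nat \<Rightarrow> flag set \<Rightarrow> (frame \<Rightarrow> complex) \<Rightarrow> (frame \<Rightarrow> complex)
     \<Rightarrow> (flag \<Rightarrow> complex) \<Rightarrow> bool" where
  "local_quotient n X N d Z f g h \<longleftrightarrow>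
     zclosed n Z \<and> base_pt n \<notin> Z \<and> X - Z \<subseteq> flags_lvl n N d \<and>
     f \<in> frame_poly n N d \<and> g \<in> frame_poly n N d \<and>
     (\<forall>M\<in>X - Z. \<forall>fr. is_frame n N d M fr \<longrightarrow> g fr \<noteq> 0 \<and> h M = f fr / g fr)"

text \<open>
  Functions that are regular in some neighbourhood of the base point in \<open>X\<close>; their values
  elsewhere are arbitrary and disappear on passing to germs.
\<close>

definition regular_funs :: "nat \<Rightarrow> flag set \<Rightarrow> (flag \<Rightarrow> complex) ring" where
  "regular_funs n X =
     \<lparr>carrier = {h. \<exists>N d Z f g. local_quotient n X N d Z f g h},
      mult = (\<lambda>h k M. h M * k M), one = (\<lambda>_. 1),
      zero = (\<lambda>_. 0), add = (\<lambda>h k M. h M + k M)\<rparr>"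

definition null_funs :: "nat \<Rightarrow> flag set \<Rightarrow> (flag \<Rightarrow> complex) set" where
  "null_funs n X = {h \<in> carrier (regular_funs n X).
      \<exists>Z. zclosed n Z \<and> base_pt n \<notin> Z \<and> (\<forall>M\<in>X - Z. h M = 0)}"

definition germ :: "nat \<Rightarrow> flag set \<Rightarrow> (flag \<Rightarrow> complex) \<Rightarrow> (flag \<Rightarrow> complex) set" where
  "germ n X h = null_funs n X +>\<^bsub>regular_funs n X\<^esub> h"

definition local_ring :: "nat \<Rightarrow> flag set \<Rightarrow> (flag \<Rightarrow> complex) set ring" where
  "local_ring n X = regular_funs n X Quot null_funs n X"

definition max_ideal :: "nat \<Rightarrow> flag set \<Rightarrow> (flag \<Rightarrow> complex) set set" where
  "max_ideal n X = {germ n X h | h. h \<in> carrier (regular_funs n X) \<and> h (base_pt n) = 0}"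

primrec max_ideal_pow :: "nat \<Rightarrow> flag set \<Rightarrow> nat \<Rightarrow> (flag \<Rightarrow> complex) set set" where
  "max_ideal_pow n X 0 = carrier (local_ring n X)"
| "max_ideal_pow n X (Suc k) = ideal_prod (local_ring n X) (max_ideal n X) (max_ideal_pow n X k)"


section \<open>The associated graded ring\<close>

text \<open>
  An element is the sequence of its homogeneous components, the \<open>k\<close>-th one being a coset of
  the \<open>(k + 1)\<close>-st power of the maximal ideal in the \<open>k\<close>-th power.
\<close>

definition gr_coset :: "nat \<Rightarrow> flag set \<Rightarrow> nat \<Rightarrow> (flag \<Rightarrow> complex) set \<Rightarrow> (flag \<Rightarrow> complex) set set" where
  "gr_coset n X k a = max_ideal_pow n X (Suc k) +>\<^bsub>local_ring n X\<^esub> a"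

definition gr_homog ::
  "nat \<Rightarrow> flag set \<Rightarrow> nat \<Rightarrow> (flag \<Rightarrow> complex) set \<Rightarrow> nat \<Rightarrow> (flag \<Rightarrow> complex) set set" where
  "gr_homog n X k a = (\<lambda>i. if i = k then gr_coset n X k a else max_ideal_pow n X (Suc i))"

definition gr_ring :: "nat \<Rightarrow> flag set \<Rightarrow> (nat \<Rightarrow> (flag \<Rightarrow> complex) set set) ring" where
  "gr_ring n X =
     \<lparr>carrier = {s. (\<forall>k. s k \<in> gr_coset n X k ` max_ideal_pow n X k) \<and>
                    finite {k. s k \<noteq> max_ideal_pow n X (Suc k)}},
      mult = (\<lambda>s t k. gr_coset n X k
        (\<Oplus>\<^bsub>local_ring n X\<^esub>i\<in>{..k}.
           (SOME a. a \<in> s i) \<otimes>\<^bsub>local_ring n X\<^esub> (SOME b. b \<in> t (k - i)))),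
      one = gr_homog n X 0 \<one>\<^bsub>local_ring n X\<^esub>,
      zero = (\<lambda>k. max_ideal_pow n X (Suc k)),
      add = (\<lambda>s t k. s k <+>\<^bsub>local_ring n X\<^esub> t k)\<rparr>"


section \<open>Tangent spaces\<close>

text \<open>
  A matrix \<open>x\<close> stands for the tangent vector \<open>(1 + \<epsilon>x) p\<close> (with \<open>\<epsilon>\<^sup>2 = 0\<close>) of the flag variety,
  and for its class in \<open>\<gg>/\<bb>\<close>; subspaces of \<open>\<gg>/\<bb>\<close> are represented by their preimages in
  \<open>\<gg>\<close>. If the entries of \<open>z^(N-1) x\<close> lie in \<open>\<Lambda>\<close>, then \<open>(1 + \<epsilon>x) L_i\<close> contains
  \<open>z^N \<Lambda>^n[\<epsilon>]\<close> and is contained in \<open>z^-N \<Lambda>^n[\<epsilon>]\<close>, so that the tangent vector is visible in the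
  Grassmannians of \<open>z^-N \<Lambda>^n / z^N \<Lambda>^n\<close>: it moves a frame \<open>fr\<close> of \<open>p\<close> in the direction
  \<open>x fr\<close>. The curve \<open>t \<mapsto> fr + t x fr\<close> below serves to take this directional derivative of a
  rational function of frames; \<open>fr + t x fr\<close> need not be a frame of a flag.
\<close>

definition move_frame :: "ratfun mat \<Rightarrow> frame \<Rightarrow> complex \<Rightarrow> frame" where
  "move_frame x fr t = (\<lambda>i k. fr i k + const t \<cdot>\<^sub>v (x *\<^sub>v fr i k))"

definition has_differential ::
  "nat \<Rightarrow> flag set \<Rightarrow> (flag \<Rightarrow> complex) \<Rightarrow> ratfun mat \<Rightarrow> complex \<Rightarrow> bool" where
  "has_differential n X h x c \<longleftrightarrow> (\<exists>N d Z f g fr.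
      local_quotient n X N d Z f g h \<and>
      elements_mat (zvar powi (int N - 1) \<cdot>\<^sub>m x) \<subseteq> regular_ratfun \<and>
      is_frame n N d (base_pt n) fr \<and>
      ((\<lambda>t. f (move_frame x fr t) / g (move_frame x fr t)) has_field_derivative c) (at 0))"

text \<open>
  The Zariski tangent space of \<open>X\<close> at the base point: those tangent vectors of the flag variety
  whose derivation factors through the local ring of \<open>X\<close>.
\<close>

definition tangent_space :: "nat \<Rightarrow> flag set \<Rightarrow> ratfun mat set" where
  "tangent_space n X = {x \<in> carrier_mat n n.
      \<exists>\<delta>. \<forall>h c. has_differential n X h x c \<longrightarrow> c = \<delta> (germ n X h)}"

definition differential ::
  "nat \<Rightarrow> flag set \<Rightarrow> (flag \<Rightarrow> complex) set \<Rightarrow> ratfun mat \<Rightarrow> complex" where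
  "differential n X a =
     (\<lambda>x\<in>tangent_space n X. THE c. \<exists>h\<in>a. has_differential n X h x c)"

text \<open>Subspaces of \<open>\<gg>/\<bb>\<close>, and the polynomial functions on them.\<close>

definition is_tangent_subspace :: "nat \<Rightarrow> ratfun mat set \<Rightarrow> bool" where
  "is_tangent_subspace n E \<longleftrightarrow> iwahori_lie n \<subseteq> E \<and> E \<subseteq> carrier_mat n n \<and>
     (\<forall>x\<in>E. \<forall>y\<in>E. x + y \<in> E) \<and> (\<forall>c. \<forall>x\<in>E. const c \<cdot>\<^sub>m x \<in> E)"

definition linear_forms :: "nat \<Rightarrow> ratfun mat set \<Rightarrow> (ratfun mat \<Rightarrow> complex) set" where
  "linear_forms n E = {l. (\<forall>x\<in>E. \<forall>y\<in>E. l (x + y) = l x + l y) \<and>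
     (\<forall>c. \<forall>x\<in>E. l (const c \<cdot>\<^sub>m x) = c * l x) \<and> (\<forall>x\<in>iwahori_lie n. l x = 0)}"

definition poly_funs :: "nat \<Rightarrow> ratfun mat set \<Rightarrow> (ratfun mat \<Rightarrow> complex) set" where
  "poly_funs n E = (\<lambda>q. restrict q E) ` fun_algebra (linear_forms n E)"


section \<open>The tangent cone\<close>

text \<open>
  The graph of the surjection from the symmetric algebra of \<open>\<mm>/\<mm>\<^sup>2\<close>, that is, from the polynomial
  functions on the tangent space, onto the associated graded ring: the algebra
  homomorphism that sends the differential of \<open>a \<in> \<mm>\<close> to the class of \<open>a\<close> in degree 1.
\<close>

inductive_set sym_to_gr ::
  "nat \<Rightarrow> flag set \<Rightarrow> ((ratfun mat \<Rightarrow> complex) \<times> (nat \<Rightarrow> (flag \<Rightarrow> complex) set set)) set"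
  for n :: nat and X :: "flag set" where
  const: "(\<lambda>x\<in>tangent_space n X. c, gr_homog n X 0 (germ n X (\<lambda>_. c))) \<in> sym_to_gr n X"
| lin: "a \<in> max_ideal n X \<Longrightarrow> (differential n X a, gr_homog n X 1 a) \<in> sym_to_gr n X"
| add: "(q, s) \<in> sym_to_gr n X \<Longrightarrow> (q', s') \<in> sym_to_gr n X \<Longrightarrow>
    (\<lambda>x\<in>tangent_space n X. q x + q' x, s \<oplus>\<^bsub>gr_ring n X\<^esub> s') \<in> sym_to_gr n X"
| mult: "(q, s) \<in> sym_to_gr n X \<Longrightarrow> (q', s') \<in> sym_to_gr n X \<Longrightarrow>
    (\<lambda>x\<in>tangent_space n X. q x * q' x, s \<otimes>\<^bsub>gr_ring n X\<^esub> s') \<in> sym_to_gr n X"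

text \<open>
  The tangent cone to \<open>X\<close> as a closed subscheme of a subspace \<open>E\<close> of \<open>\<gg>/\<bb>\<close> containing the
  tangent space of \<open>X\<close>, given by its ideal in the algebra of polynomial functions on \<open>E\<close>.
\<close>

definition tangent_cone ::
  "nat \<Rightarrow> flag set \<Rightarrow> ratfun mat set \<Rightarrow> (ratfun mat \<Rightarrow> complex) set" where
  "tangent_cone n X E = {q \<in> poly_funs n E.
      (restrict q (tangent_space n X), \<zero>\<^bsub>gr_ring n X\<^esub>) \<in> sym_to_gr n X}"

end

theory Submission
  imports Defs "Jordan_Normal_Form.Determinant"
begin

text \<open>
  Give \<open>z^m e_j\<close> the index \<open>j - n m\<close>. Then matrices over \<open>\<complex>(z)\<close> become matrices with rows and
  columns in \<open>\<int>\<close>, periodic under a simultaneous shift by \<open>n\<close>; the lattice \<open>L_i\<close> consists of the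
  vectors whose coefficients at all indices above \<open>i\<close> vanish; and \<open>w\<close> permutes the basis vectors by
  permuting the indices. The proof compares the rank functions
  \<open>r_w(i, j) = card {k. k \<le> j \<and> w(k) \<ge> i}\<close> for \<open>i > j\<close>, which determine an involution
  (\<open>rk_determines_involution\<close>).

  The cone is not too large. If \<open>M = b w b' p\<close> with \<open>b, b'\<close> in the Iwahori subgroup, then \<open>M_j\<close>
  has dimension \<open>r_w(i, j)\<close> modulo \<open>L_{i-1}\<close>. So for vectors of \<open>M_j\<close> the minors of larger size in
  rows \<open>\<ge> i\<close> vanish, and this persists on the closure (\<open>schubert_minor\<close>). Near \<open>p\<close> the lattice
  \<open>M_j\<close> is the graph of a map from \<open>L_j\<close> to the span of the basis vectors of index above \<open>j\<close>.
  The entries of this map are coordinates that vanish at \<open>p\<close>, and their differentials at \<open>p\<close> are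
  the corresponding entries of \<open>x\<close>. For \<open>i > j\<close> the minors are therefore homogeneous in the
  coordinates, and the same minors of \<open>x\<close> lie in the ideal of the tangent cone
  (\<open>det_in_tangent_cone\<close>).

  The cone is not too small. Let \<open>x_w\<close> be the strictly lower triangular part of the matrix of the
  involution \<open>w\<close>. The transpositions that make up \<open>w\<close> live in commuting copies of \<open>SL_2\<close>, and there
  the identity
  \<open>(1, 0; t, 1) = (1, 1/t; 0, 1) (0, 1; 1, 0) (t, 0; 0, -1/t) (1, 1/t; 0, 1)\<close>
  shows that \<open>1 + t x_w\<close> lies in \<open>B w B\<close> for \<open>t \<noteq> 0\<close> (\<open>one_plus_low_factor\<close>). Hence
  \<open>t \<mapsto> (1 + t x_w) p\<close> is a curve in \<open>X_w\<close>. The coefficient of \<open>t^k\<close> of a function in the \<open>k\<close>-th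
  power of the maximal ideal depends only on its class in degree \<open>k\<close>, and these coefficients
  are additive and multiplicative; so every element of the ideal of the cone vanishes at \<open>x_w\<close>
  (\<open>tangent_cone_low_mat\<close>).

  If the cones of \<open>w1\<close> and \<open>w2\<close> coincide and \<open>i > j\<close>, then \<open>r_{w1}(i, j) \<le> r_{w2}(i, j)\<close>, because
  \<open>x_{w1}\<close> has a nonzero minor of size \<open>r_{w1}(i, j)\<close> in rows \<open>\<ge> i\<close> and columns \<open>\<le> j\<close>
  (\<open>tangent_cone_neq_if_rk_less\<close>). By symmetry the rank functions agree, and \<open>w1 = w2\<close>.

  Most of the text relates the definition by frames of varying level \<open>N\<close> to one fixed set of
  functions. The graph coordinates above do not depend on \<open>N\<close>. On the open cell where they are
  defined, a polynomial in them is a quotient of frame polynomials at each level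
  (\<open>coord_algebra_level\<close>), the part at level \<open>N\<close> of a closed set that does not contain a given point
  lies in the zero set of a polynomial in them that is nonzero at the point (\<open>zclosed_separate\<close>),
  and every germ at \<open>p\<close> is a quotient of two such polynomials (\<open>regular_iff\<close>). Along the curve these
  are polynomials in \<open>t\<close>.
\<close>

unbundle no fps_syntax

section \<open>Expansions of rational functions at 0\<close>

lemma laurent_Fract:
  assumes "b \<noteq> 0"
  shows "laurent (Fract a b) = fps_to_fls (fps_of_poly a) / fps_to_fls (fps_of_poly b)"
  using assms by transfer simp

lemma laurent_const [simp]: "laurent (const c) = fls_const c"
  by (simp add: const_def laurent_Fract fps_of_poly_const)

lemma laurent_zvar: "laurent zvar = fls_X"
  by (simp add: zvar_def laurent_Fract fps_of_poly_pCons)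

lemma laurent_0 [simp]: "laurent 0 = 0"
  by (simp add: Zero_fract_def laurent_Fract)

lemma laurent_1 [simp]: "laurent 1 = 1"
  by (simp add: One_fract_def laurent_Fract)

lemma laurent_add [simp]: "laurent (f + g) = laurent f + laurent g"
  by (cases f; cases g)
    (simp add: laurent_Fract fps_of_poly_mult fps_of_poly_add fls_times_fps_to_fls field_simps)

lemma laurent_mult [simp]: "laurent (f * g) = laurent f * laurent g"
  by (cases f; cases g)
    (simp add: laurent_Fract fps_of_poly_mult fls_times_fps_to_fls)

lemma laurent_eq_0_iff [simp]: "laurent f = 0 \<longleftrightarrow> f = 0"
  by (cases f) (auto simp: laurent_Fract eq_fract Zero_fract_def)

lemma laurent_uminus [simp]: "laurent (- f) = - laurent f"
  using laurent_add[of f "- f"] by (simp add: eq_neg_iff_add_eq_0 add.commute)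

lemma laurent_diff [simp]: "laurent (f - g) = laurent f - laurent g"
  using laurent_add[of f "- g"] by simp

lemma laurent_inject: "laurent f = laurent g \<longleftrightarrow> f = g"
  by (metis laurent_diff laurent_eq_0_iff right_minus_eq)

lemma laurent_sum: "laurent (sum f A) = (\<Sum>a\<in>A. laurent (f a))"
  by (induction A rule: infinite_finite_induct) auto

lemma nth_fls_sum: "fls_nth (sum f A) k = (\<Sum>a\<in>A. fls_nth (f a) k)"
  by (induction A rule: infinite_finite_induct) auto

lemma laurent_inverse: "laurent (inverse f) = inverse (laurent f)"
proof (cases "f = 0")
  case False
  then have "laurent f * laurent (inverse f) = 1"
    by (simp flip: laurent_mult)
  then show ?thesis by (simp add: inverse_unique)
qed simp

lemma laurent_power: "laurent (f ^ k) = laurent f ^ k"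
  by (induction k) auto

lemma zvar_nonzero [simp]: "zvar \<noteq> 0"
  using laurent_zvar by (metis fls_X_nonzero laurent_0)

lemma laurent_zvar_powi: "laurent (zvar powi m) = fls_X_intpow m"
  by (cases "m \<ge> 0")
     (auto simp: power_int_def laurent_power laurent_inverse laurent_zvar fls_X_power_conv_shift_1
        fls_inverse_X fls_X_inv_power_conv_shift_1)

lemma nth_laurent_zvar_mult: "fls_nth (laurent (zvar powi m * f)) k = fls_nth (laurent f) (k - m)"
  by (simp add: laurent_zvar_powi fls_X_intpow_times_conv_shift)

lemma const_0 [simp]: "const 0 = 0" and const_1 [simp]: "const 1 = 1"
  by (simp_all add: const_def Zero_fract_def One_fract_def pCons_one)

lemma const_mult: "const (a * b) = const a * const b"
  by (simp flip: laurent_inject add: fls_const_mult_const)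

lemma regular_ratfun_iff: "f \<in> regular_ratfun \<longleftrightarrow> (\<forall>k<0. fls_nth (laurent f) k = 0)"
proof
  assume "\<forall>k<0. fls_nth (laurent f) k = 0"
  then have "fls_subdegree (laurent f) \<ge> 0"
    by (metis fls_subdegree_geI fls_zero_subdegree order_refl)
  then show "f \<in> regular_ratfun"
    unfolding regular_ratfun_def by (metis (mono_tags, lifting) fls_regpart_to_fls_trivial mem_Collect_eq rangeI)
qed (auto simp: regular_ratfun_def)

lemma zvar_powi_regular_iff:
  "f \<in> (*) (zvar powi m) ` regular_ratfun \<longleftrightarrow> (\<forall>k<m. fls_nth (laurent f) k = 0)"
proof
  assume "\<forall>k<m. fls_nth (laurent f) k = 0"
  then have "zvar powi (- m) * f \<in> regular_ratfun"
    unfolding regular_ratfun_iff nth_laurent_zvar_mult by auto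
  moreover have "f = zvar powi m * (zvar powi (- m) * f)"
    by (simp add: power_int_minus)
  ultimately show "f \<in> (*) (zvar powi m) ` regular_ratfun" by blast
qed (auto simp: regular_ratfun_iff nth_laurent_zvar_mult simp del: laurent_mult)

lemma nth_laurent_mult_eq_0:
  assumes "\<And>i. i < a \<Longrightarrow> fls_nth (laurent f) i = 0" "\<And>i. i < b \<Longrightarrow> fls_nth (laurent g) i = 0"
    and "k < a + b"
  shows "fls_nth (laurent (f * g)) k = 0"
proof -
  obtain f' g' where f: "f = zvar powi a * f'" "f' \<in> regular_ratfun"
    and g: "g = zvar powi b * g'" "g' \<in> regular_ratfun"
    using assms(1,2) zvar_powi_regular_iff[of f a] zvar_powi_regular_iff[of g b] by blast
  have "f' * g' \<in> regular_ratfun"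
    using f(2) g(2) by (auto simp: regular_ratfun_def simp flip: fls_times_fps_to_fls)
  moreover have "f * g = zvar powi (a + b) * (f' * g')"
    by (simp add: f g power_int_add)
  ultimately show ?thesis
    using zvar_powi_regular_iff[of "f * g" "a + b"] assms(3) by blast
qed

section \<open>Vectors of rational functions indexed by the integers\<close>

locale loop_dim =
  fixes n :: nat
  assumes n_pos: "n > 0"
begin

text \<open>
  The integer \<open>l\<close> is the index of \<open>z^(zord l) e_(idx l + 1)\<close>, where \<open>l = (idx l + 1) - n zord l\<close>.
  Multiplication by \<open>z\<close> lowers the index by \<open>n\<close>.
\<close>

definition idx :: "int \<Rightarrow> nat" where
  "idx l = nat ((l - 1) mod int n)"

definition zord :: "int \<Rightarrow> int" where
  "zord l = - ((l - 1) div int n)"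

definition cf :: "int \<Rightarrow> ratfun vec \<Rightarrow> complex" where
  "cf l v = fls_nth (laurent (v $ idx l)) (zord l)"

definition E :: "int \<Rightarrow> ratfun vec" where
  "E l = zvar powi (zord l) \<cdot>\<^sub>v unit_vec n (idx l)"

definition Lam :: "int \<Rightarrow> ratfun vec set" where
  "Lam i = {v \<in> carrier_vec n. \<forall>l>i. cf l v = 0}"

text \<open>
  Written out by entries, as in the definition of a frame.
\<close>

definition vsum :: "'k set \<Rightarrow> ('k \<Rightarrow> complex) \<Rightarrow> ('k \<Rightarrow> ratfun vec) \<Rightarrow> ratfun vec" where
  "vsum S c u = vec n (\<lambda>j. \<Sum>k\<in>S. const (c k) * u k $ j)"

lemma idx_less [simp]: "idx l < n"
  using n_pos unfolding idx_def by (simp add: nat_less_iff)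

lemma idx_zord: "int (idx l) + 1 - int n * zord l = l"
  using n_pos unfolding idx_def zord_def
  by (simp add: algebra_simps)

lemma idx_eq: "j < n \<Longrightarrow> idx (int j + 1 - int n * m) = j"
proof -
  assume "j < n"
  moreover have "int j + 1 - int n * m - 1 = int j + int n * (- m)" by simp
  ultimately show ?thesis by (simp only: idx_def mod_mult_self2) simp
qed

lemma zord_eq: "j < n \<Longrightarrow> zord (int j + 1 - int n * m) = m"
proof -
  assume "j < n"
  moreover have "int j + 1 - int n * m - 1 = int j + int n * (- m)" by simp
  moreover have "n \<noteq> 0" using n_pos by simp
  ultimately show ?thesis
    by (simp only: zord_def) (subst div_mult_self2, auto)
qed

lemma idx_small [simp]: "j < n \<Longrightarrow> idx (int j + 1) = j" and zord_small [simp]: "j < n \<Longrightarrow> zord (int j + 1) = 0"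
  using idx_eq[of j 0] zord_eq[of j 0] by simp_all

lemma index_cases:
  obtains j m where "j < n" "l = int j + 1 - int n * m" "idx l = j" "zord l = m"
  using idx_zord[of l] idx_less[of l] by metis

lemma cf_coeff: "j < n \<Longrightarrow> fls_nth (laurent (v $ j)) m = cf (int j + 1 - int n * m) v"
  by (simp add: cf_def idx_eq zord_eq)

lemma zord_le_iff: "zord l \<le> m \<longleftrightarrow> l > int n * (- m)"
proof -
  obtain j q where "j < n" "l = int j + 1 - int n * q" "idx l = j" "zord l = q" by (rule index_cases)
  moreover have "q \<le> m \<longleftrightarrow> int j - int n * q \<ge> int n * (- m)" if "j < n"
  proof
    assume "q \<le> m"
    then have "int n * q \<le> int n * m" by (simp add: mult_left_mono)
    then show "int j - int n * q \<ge> int n * (- m)" by simp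
  next
    assume *: "int j - int n * q \<ge> int n * (- m)"
    show "q \<le> m"
    proof (rule ccontr)
      assume "\<not> q \<le> m"
      then have "int n * q \<ge> int n * (m + 1)" by (intro mult_left_mono) auto
      with * that show False by (simp add: algebra_simps)
    qed
  qed
  ultimately show ?thesis by auto
qed

text \<open>
  The lattice \<open>z^m \<Lambda>^n\<close> consists of the vectors without coefficients of order below \<open>m\<close>; this turns
  that condition into a bound for the index.
\<close>

lemma zord_less_iff: "zord l < m \<longleftrightarrow> l > int n - int n * m"
  using zord_le_iff[of l "m - 1"] zle_diff1_eq[of "zord l" m] by (simp add: algebra_simps)

lemma E_carrier [simp]: "E l \<in> carrier_vec n"
  by (simp add: E_def)

lemma Lam_carrier: "v \<in> Lam i \<Longrightarrow> v \<in> carrier_vec n"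
  by (simp add: Lam_def)

lemma vsum_carrier [simp]: "vsum S c u \<in> carrier_vec n"
  by (simp add: vsum_def)

lemma cf_add: "u \<in> carrier_vec n \<Longrightarrow> v \<in> carrier_vec n \<Longrightarrow> cf l (u + v) = cf l u + cf l v"
  using idx_less[of l] by (simp add: cf_def)

lemma cf_diff: "u \<in> carrier_vec n \<Longrightarrow> v \<in> carrier_vec n \<Longrightarrow> cf l (u - v) = cf l u - cf l v"
  using idx_less[of l] by (simp add: cf_def)

lemma cf_smult: "v \<in> carrier_vec n \<Longrightarrow> cf l (const c \<cdot>\<^sub>v v) = c * cf l v"
  using idx_less[of l] by (simp add: cf_def)

lemma cf_zero [simp]: "cf l (0\<^sub>v n) = 0"
  by (simp add: cf_def)

lemma cf_vsum: "cf l (vsum S c u) = (\<Sum>k\<in>S. c k * cf l (u k))"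
  by (simp add: cf_def vsum_def laurent_sum nth_fls_sum)

lemma cf_E: "cf k (E l) = (if k = l then 1 else 0)"
proof -
  have "k = l \<longleftrightarrow> idx k = idx l \<and> zord k = zord l"
    using idx_zord[of k] idx_zord[of l] by metis
  moreover have "cf k (E l) = (if idx k = idx l \<and> zord k = zord l then 1 else 0)"
    by (simp add: cf_def E_def laurent_zvar_powi)
  ultimately show ?thesis by simp
qed

lemma cf_eqI:
  assumes "u \<in> carrier_vec n" "v \<in> carrier_vec n" "\<And>l. cf l u = cf l v"
  shows "u = v"
proof (rule eq_vecI)
  show "dim_vec u = dim_vec v" using assms by simp
  fix j assume "j < dim_vec v"
  then have "laurent (u $ j) = laurent (v $ j)"
    using assms by (intro fls_eqI) (simp add: cf_coeff)
  then show "u $ j = v $ j" by (simp add: laurent_inject)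
qed

lemma lattice_eq_Lam: "lattice n m = Lam (int n - int n * m)"
proof -
  have "(\<forall>j<n. \<forall>k<m. fls_nth (laurent (v $ j)) k = 0) \<longleftrightarrow> (\<forall>l>int n - int n * m. cf l v = 0)" for v
  proof
    assume *: "\<forall>j<n. \<forall>k<m. fls_nth (laurent (v $ j)) k = 0"
    show "\<forall>l>int n - int n * m. cf l v = 0"
      using * by (simp add: cf_def zord_less_iff)
  next
    assume *: "\<forall>l>int n - int n * m. cf l v = 0"
    show "\<forall>j<n. \<forall>k<m. fls_nth (laurent (v $ j)) k = 0"
    proof (intro allI impI)
      fix j k assume jk: "j < n" "k < m"
      then show "fls_nth (laurent (v $ j)) k = 0"
        using * zord_less_iff[of "int j + 1 - int n * k" m] by (simp add: cf_coeff zord_eq)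
    qed
  qed
  then show ?thesis
    unfolding lattice_def Lam_def zvar_powi_regular_iff by auto
qed

lemma std_lattice_eq_Lam:
  assumes "i \<le> n"
  shows "std_lattice n i = Lam (int i)"
proof -
  have 1: "f \<in> (*) zvar ` regular_ratfun \<longleftrightarrow> (\<forall>k<1. fls_nth (laurent f) k = 0)" for f
    using zvar_powi_regular_iff[of f 1] by simp
  have eq: "j < i \<and> m < 0 \<or> \<not> j < i \<and> m < 1 \<longleftrightarrow> int j + 1 - int n * m > int i" if "j < n" for j m
  proof (cases "m \<le> 0")
    case True
    show ?thesis
    proof (cases "m = 0")
      case False
      with True have "int n * m \<le> int n * (-1)" by (intro mult_left_mono) auto
      with True False assms show ?thesis by auto
    qed auto
  next
    case False
    then have "int n * m \<ge> int n * 1" by (intro mult_left_mono) auto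
    moreover have "int j + 1 \<le> int n" using that by linarith
    ultimately have "int j + 1 - int n * m \<le> 0" by linarith
    with False show ?thesis by linarith
  qed
  have "(\<forall>j<n. v $ j \<in> (if j < i then regular_ratfun else (*) zvar ` regular_ratfun))
      = (\<forall>l>int i. cf l v = 0)" for v
  proof -
    have "(\<forall>j<n. v $ j \<in> (if j < i then regular_ratfun else (*) zvar ` regular_ratfun))
        = (\<forall>j<n. \<forall>m. (j < i \<and> m < 0 \<or> \<not> j < i \<and> m < 1) \<longrightarrow> fls_nth (laurent (v $ j)) m = 0)"
      by (auto simp: 1 regular_ratfun_iff)
    also have "\<dots> = (\<forall>j<n. \<forall>m. int j + 1 - int n * m > int i \<longrightarrow> cf (int j + 1 - int n * m) v = 0)"
      using eq cf_coeff by (metis (no_types, lifting))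
    also have "\<dots> = (\<forall>l>int i. cf l v = 0)"
      by (metis index_cases)
    finally show ?thesis .
  qed
  then show ?thesis
    unfolding std_lattice_def Lam_def by auto
qed

section \<open>Complex subspaces\<close>

definition csub :: "ratfun vec set \<Rightarrow> bool" where
  "csub M \<longleftrightarrow> M \<subseteq> carrier_vec n \<and> 0\<^sub>v n \<in> M \<and> (\<forall>u\<in>M. \<forall>v\<in>M. u + v \<in> M) \<and> (\<forall>c. \<forall>u\<in>M. const c \<cdot>\<^sub>v u \<in> M)"

lemma csub_carrier: "csub M \<Longrightarrow> u \<in> M \<Longrightarrow> u \<in> carrier_vec n"
  by (auto simp: csub_def)

lemma csub_Lam: "csub (Lam i)"
  by (auto simp: csub_def Lam_def cf_add cf_smult)

lemma csub_diff: "csub M \<Longrightarrow> u \<in> M \<Longrightarrow> v \<in> M \<Longrightarrow> u - v \<in> M"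
proof -
  assume M: "csub M" "u \<in> M" "v \<in> M"
  then have "u + const (-1) \<cdot>\<^sub>v v \<in> M" by (auto simp: csub_def)
  moreover have "u + const (-1) \<cdot>\<^sub>v v = u - v"
    using M csub_carrier[of M] by (intro cf_eqI) (auto simp: cf_add cf_diff cf_smult)
  ultimately show ?thesis by simp
qed

lemma csub_vsum:
  assumes "csub M" "\<And>k. k \<in> S \<Longrightarrow> u k \<in> M"
  shows "vsum S c u \<in> M"
  using assms(2)
proof (induction S rule: infinite_finite_induct)
  case (insert x S)
  have "vsum (insert x S) c u = const (c x) \<cdot>\<^sub>v u x + vsum S c u"
    using insert assms csub_carrier[of M]
    by (intro cf_eqI) (auto simp: cf_add cf_vsum cf_smult)
  with insert assms show ?case by (auto simp: csub_def)
next
  case empty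
  have "vsum {} c u = 0\<^sub>v n" by (intro cf_eqI) (auto simp: cf_vsum)
  with assms show ?case by (simp add: csub_def)
next
  case (infinite S)
  have "vsum S c u = 0\<^sub>v n" using infinite by (intro cf_eqI) (auto simp: cf_vsum)
  with assms show ?case by (simp add: csub_def)
qed

lemma Lam_mono: "i \<le> j \<Longrightarrow> Lam i \<subseteq> Lam j"
  by (auto simp: Lam_def)

lemma E_in_Lam [simp]: "E l \<in> Lam i \<longleftrightarrow> l \<le> i"
  by (auto simp: Lam_def cf_E)

lemma bounded_in_Lam:
  assumes "v \<in> carrier_vec n"
  shows "\<exists>K. v \<in> Lam K"
proof -
  define s where "s = Min ((\<lambda>j. fls_subdegree (laurent (v $ j))) ` {..<n})"
  have "cf l v = 0" if "l > int n - int n * s" for l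
  proof -
    have "zord l < s" using that by (simp add: zord_less_iff)
    also have "s \<le> fls_subdegree (laurent (v $ idx l))"
      unfolding s_def by (intro Min_le) auto
    finally show ?thesis by (simp add: cf_def)
  qed
  with assms show ?thesis by (auto simp: Lam_def)
qed

text \<open>
  A vector has only finitely many coefficients above \<open>i\<close>. Splitting them off replaces infinite
  linear combinations throughout: modulo any lattice, a vector is a finite combination of the \<open>E l\<close>.
\<close>

lemma truncate_in_Lam:
  assumes "v \<in> Lam K"
  shows "v - vsum {i<..K} (\<lambda>l. cf l v) E \<in> Lam i"
proof -
  have "cf l v = (\<Sum>k\<in>{i<..K}. cf k v * cf l (E k))" if "l > i" for l
  proof -
    have "(\<Sum>k\<in>{i<..K}. cf k v * cf l (E k)) = (\<Sum>k\<in>{i<..K}. if k = l then cf l v else 0)"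
      by (intro sum.cong) (auto simp: cf_E)
    also have "\<dots> = cf l v"
      using that assms by (auto simp: Lam_def)
    finally show ?thesis by simp
  qed
  with assms show ?thesis
    by (auto simp: Lam_def cf_diff cf_vsum)
qed

section \<open>Matrices acting on indexed vectors\<close>

lemma mat_vsum:
  assumes "A \<in> carrier_mat n n" "\<And>k. k \<in> S \<Longrightarrow> u k \<in> carrier_vec n"
  shows "A *\<^sub>v vsum S c u = vsum S c (\<lambda>k. A *\<^sub>v u k)"
proof (rule eq_vecI)
  show "dim_vec (A *\<^sub>v vsum S c u) = dim_vec (vsum S c (\<lambda>k. A *\<^sub>v u k))"
    using assms by (simp add: vsum_def)
  fix r assume "r < dim_vec (vsum S c (\<lambda>k. A *\<^sub>v u k))"
  then have r: "r < n" by (simp add: vsum_def)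
  have "(A *\<^sub>v vsum S c u) $ r = (\<Sum>j<n. A $$ (r, j) * (\<Sum>k\<in>S. const (c k) * u k $ j))"
    using assms r by (auto simp: vsum_def scalar_prod_def atLeast0LessThan intro!: sum.cong)
  also have "\<dots> = (\<Sum>k\<in>S. const (c k) * (\<Sum>j<n. A $$ (r, j) * u k $ j))"
    by (simp add: sum_distrib_left sum.swap[of _ S] algebra_simps)
  also have "\<dots> = (\<Sum>k\<in>S. const (c k) * (A *\<^sub>v u k) $ r)"
  proof (rule sum.cong)
    fix k assume "k \<in> S"
    then have "u k \<in> carrier_vec n" using assms by simp
    then show "const (c k) * (\<Sum>j<n. A $$ (r, j) * u k $ j) = const (c k) * (A *\<^sub>v u k) $ r"
      using assms(1) r by (auto simp: scalar_prod_def atLeast0LessThan intro!: sum.cong)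
  qed simp
  finally show "(A *\<^sub>v vsum S c u) $ r = vsum S c (\<lambda>k. A *\<^sub>v u k) $ r"
    using r by (simp add: vsum_def)
qed

lemma entries_bounded_below:
  assumes "A \<in> carrier_mat n n"
  shows "\<exists>s\<ge>0. \<forall>r<n. \<forall>c<n. \<forall>k. k < - s \<longrightarrow> fls_nth (laurent (A $$ (r, c))) k = 0"
proof -
  define s where "s = Max (insert 0 ((\<lambda>(r, c). - fls_subdegree (laurent (A $$ (r, c)))) ` ({..<n} \<times> {..<n})))"
  have "fls_nth (laurent (A $$ (r, c))) k = 0" if "r < n" "c < n" "k < - s" for r c k
  proof -
    have "- fls_subdegree (laurent (A $$ (r, c))) \<le> s"
      unfolding s_def using that by (intro Max_ge) auto
    then show ?thesis using that by simp
  qed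
  moreover have "s \<ge> 0" unfolding s_def by (intro Max_ge) auto
  ultimately show ?thesis by blast
qed

text \<open>
  A crude bound, from the largest pole of an entry. It makes the action of a matrix continuous and
  so reduces every statement about \<open>A *\<^sub>v v\<close> to the vectors \<open>A *\<^sub>v E l\<close>.
\<close>

lemma mat_Lam_bounded:
  assumes "A \<in> carrier_mat n n"
  shows "\<exists>C\<ge>0. \<forall>m. \<forall>v\<in>Lam m. A *\<^sub>v v \<in> Lam (m + C)"
proof -
  obtain s where s0: "s \<ge> 0"
    and A0: "\<And>r c k. r < n \<Longrightarrow> c < n \<Longrightarrow> k < - s \<Longrightarrow> fls_nth (laurent (A $$ (r, c))) k = 0"
    using entries_bounded_below[OF assms] by blast
  define C where "C = int n + int n * s"
  have "A *\<^sub>v v \<in> Lam (m + C)" if v: "v \<in> Lam m" for m v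
  proof -
    define o' where "o' = (- m) div int n + 1"
    have v0: "fls_nth (laurent (v $ c)) k = 0" if "c < n" "k < o'" for c k
    proof -
      have "int n * k \<le> int n * ((- m) div int n)" using that by (intro mult_left_mono) (auto simp: o'_def)
      also have "\<dots> \<le> - m" using n_pos by (smt (verit) minus_mult_div_eq_mod of_nat_0_less_iff pos_mod_sign)
      finally show ?thesis using v that by (simp add: cf_coeff Lam_def)
    qed
    have "cf l (A *\<^sub>v v) = 0" if l: "l > m + C" for l
    proof -
      define r where "r = idx l"
      have r: "r < n" by (simp add: r_def)
      have "zord l < o' + - s"
      proof -
        have "int n * ((- m) div int n) > - m - int n"
          using n_pos by (smt (verit) minus_mult_div_eq_mod of_nat_0_less_iff pos_mod_bound)
        then have "int n - int n * (o' - s) < l"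
          using l by (simp add: o'_def C_def algebra_simps)
        then show ?thesis by (simp add: zord_less_iff)
      qed
      then have *: "fls_nth (laurent (A $$ (r, c) * v $ c)) (zord l) = 0" if "c < n" for c
        using A0[OF r that] v0[OF that] by (intro nth_laurent_mult_eq_0[of "- s" _ o']) auto
      have "(A *\<^sub>v v) $ r = (\<Sum>c<n. A $$ (r, c) * v $ c)"
        using assms r Lam_carrier[OF v] by (auto simp: scalar_prod_def atLeast0LessThan intro!: sum.cong)
      then show ?thesis
        using * by (simp add: cf_def r_def laurent_sum nth_fls_sum del: laurent_mult)
    qed
    moreover have "A *\<^sub>v v \<in> carrier_vec n" using assms Lam_carrier[OF v] by simp
    ultimately show ?thesis by (simp add: Lam_def)
  qed
  moreover have "C \<ge> 0" using s0 by (simp add: C_def)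
  ultimately show ?thesis by blast
qed

lemma mat_split:
  assumes A: "A \<in> carrier_mat n n" and v: "v \<in> Lam K"
  shows "A *\<^sub>v v = vsum {i<..K} (\<lambda>k. cf k v) (\<lambda>k. A *\<^sub>v E k) + A *\<^sub>v (v - vsum {i<..K} (\<lambda>l. cf l v) E)"
proof -
  have "v = vsum {i<..K} (\<lambda>l. cf l v) E + (v - vsum {i<..K} (\<lambda>l. cf l v) E)"
    using Lam_carrier[OF v] by (intro cf_eqI) (auto simp: cf_add cf_diff)
  then have "A *\<^sub>v v = A *\<^sub>v (vsum {i<..K} (\<lambda>l. cf l v) E + (v - vsum {i<..K} (\<lambda>l. cf l v) E))" by simp
  also have "\<dots> = A *\<^sub>v vsum {i<..K} (\<lambda>l. cf l v) E + A *\<^sub>v (v - vsum {i<..K} (\<lambda>l. cf l v) E)"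
    using Lam_carrier[OF v] by (intro mult_add_distrib_mat_vec[OF A]) auto
  finally show ?thesis using A by (simp add: mat_vsum)
qed

lemma cf_mat_vec:
  assumes "A \<in> carrier_mat n n" "v \<in> Lam K" "\<And>u. u \<in> Lam i \<Longrightarrow> A *\<^sub>v u \<in> Lam m" "l > m"
  shows "cf l (A *\<^sub>v v) = (\<Sum>k\<in>{i<..K}. cf k v * cf l (A *\<^sub>v E k))"
  using assms(3)[OF truncate_in_Lam[OF assms(2)]] assms Lam_carrier[OF assms(2)]
  by (subst mat_split[OF assms(1,2), of i]) (auto simp: cf_add cf_vsum Lam_def)

text \<open>
  By the crude bound, the coefficient of \<open>A *\<^sub>v v\<close> at a given index depends on finitely many
  coefficients of \<open>v\<close> only.
\<close>

lemma mat_LamI: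
  assumes A: "A \<in> carrier_mat n n" and E: "\<And>l. l \<le> m \<Longrightarrow> A *\<^sub>v E l \<in> Lam m'" and v: "v \<in> Lam m"
  shows "A *\<^sub>v v \<in> Lam m'"
proof -
  obtain C where C: "C \<ge> 0" "\<And>m v. v \<in> Lam m \<Longrightarrow> A *\<^sub>v v \<in> Lam (m + C)"
    using mat_Lam_bounded[OF A] by blast
  have "cf l (A *\<^sub>v v) = 0" if "l > m'" for l
  proof -
    have "cf l (A *\<^sub>v v) = (\<Sum>k\<in>{m' - C<..m}. cf k v * cf l (A *\<^sub>v E k))"
      using C(2)[of _ "m' - C"] that by (intro cf_mat_vec[OF A v]) auto
    also have "\<dots> = 0" using E that by (intro sum.neutral) (auto simp: Lam_def)
    finally show ?thesis .
  qed
  then show ?thesis using A Lam_carrier[OF v] by (simp add: Lam_def)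
qed

lemma E_small: "j < n \<Longrightarrow> E (int j + 1) = unit_vec n j"
  by (simp add: E_def)

lemma mat_unit_vec:
  fixes A :: "ratfun mat"
  assumes "A \<in> carrier_mat n n" "j < n"
  shows "A *\<^sub>v unit_vec n j = col A j"
proof (rule eq_vecI)
  fix i assume "i < dim_vec (col A j)"
  then show "(A *\<^sub>v unit_vec n j) $ i = col A j $ i"
    using assms scalar_prod_right_unit[of j n "row A i"] by simp
qed (use assms in simp)

lemma mat_eqI_E:
  assumes "A \<in> carrier_mat n n" "B \<in> carrier_mat n n" "\<And>l. A *\<^sub>v E l = B *\<^sub>v E l"
  shows "A = B"
proof (rule mat_col_eqI)
  fix j assume "j < dim_col B"
  then have j: "j < n" using assms by simp
  have "A *\<^sub>v unit_vec n j = B *\<^sub>v unit_vec n j"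
    using assms(3)[of "int j + 1"] j by (simp add: E_small)
  then show "col A j = col B j"
    using mat_unit_vec[OF assms(1) j] mat_unit_vec[OF assms(2) j] by simp
qed (use assms in auto)

lemma E_shift: "E (l + int n * k) = zvar powi (- k) \<cdot>\<^sub>v E l"
proof -
  have eq: "l + int n * k - 1 = (l - 1) + int n * k" by simp
  have "idx (l + int n * k) = idx l" "zord (l + int n * k) = zord l - k"
    using n_pos eq div_mult_self2[of "int n" "l - 1" k] by (simp_all only: idx_def zord_def mod_mult_self2)
  then show ?thesis
    by (simp add: E_def smult_smult_assoc flip: power_int_add)
qed

lemma mat_E: "A \<in> carrier_mat n n \<Longrightarrow> A *\<^sub>v E l = zvar powi (zord l) \<cdot>\<^sub>v col A (idx l)"
  unfolding E_def by (subst mult_mat_vec) (auto simp: mat_unit_vec)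

lemma cf_mat_E: "A \<in> carrier_mat n n \<Longrightarrow>
    cf k (A *\<^sub>v E l) = fls_nth (laurent (A $$ (idx k, idx l))) (zord k - zord l)"
  by (auto simp: mat_E cf_def nth_laurent_zvar_mult simp del: laurent_mult)

text \<open>
  The matrix that sends \<open>E l\<close> to \<open>\<phi> l\<close>, for \<open>\<phi>\<close> compatible with multiplication by \<open>z\<close>.
\<close>

definition opmat :: "(int \<Rightarrow> ratfun vec) \<Rightarrow> ratfun mat" where
  "opmat \<phi> = mat n n (\<lambda>(r, c). \<phi> (int c + 1) $ r)"

lemma opmat_carrier [simp]: "opmat \<phi> \<in> carrier_mat n n"
  by (simp add: opmat_def)

lemma opmat_E:
  assumes "\<And>l. \<phi> l \<in> carrier_vec n" "\<And>l k. \<phi> (l + int n * k) = zvar powi (- k) \<cdot>\<^sub>v \<phi> l"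
  shows "opmat \<phi> *\<^sub>v E l = \<phi> l"
proof -
  have "col (opmat \<phi>) (idx l) = \<phi> (int (idx l) + 1)"
    using assms(1)[of "int (idx l) + 1"] by (intro eq_vecI) (auto simp: opmat_def)
  moreover have "\<phi> l = zvar powi (zord l) \<cdot>\<^sub>v \<phi> (int (idx l) + 1)"
    using assms(2)[of "int (idx l) + 1" "- zord l"] idx_zord[of l] by simp
  ultimately show ?thesis by (simp add: mat_E)
qed

end

section \<open>Linear algebra and function algebras\<close>

abbreviation sqmat :: "nat \<Rightarrow> (nat \<Rightarrow> nat \<Rightarrow> 'a) \<Rightarrow> 'a mat" where
  "sqmat m A \<equiv> mat m m (\<lambda>(a, b). A a b)"

definition adj :: "nat \<Rightarrow> (nat \<Rightarrow> nat \<Rightarrow> complex) \<Rightarrow> nat \<Rightarrow> nat \<Rightarrow> complex" where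
  "adj m A b a = adj_mat (sqmat m A) $$ (b, a)"

lemma mult_adj:
  assumes "a < m" "a' < m"
  shows "(\<Sum>b<m. A a' b * adj m A b a) = (if a' = a then det (sqmat m A) else 0)"
proof -
  have c: "sqmat m A \<in> carrier_mat m m" by simp
  have "(\<Sum>b<m. A a' b * adj m A b a) = (sqmat m A * adj_mat (sqmat m A)) $$ (a', a)"
    using assms adj_mat(1)[OF c] by (simp add: scalar_prod_def adj_def atLeast0LessThan)
  also have "\<dots> = (if a' = a then det (sqmat m A) else 0)"
    using assms by (simp add: adj_mat(2)[OF c])
  finally show ?thesis .
qed

lemma det_0_kernel:
  fixes A :: "nat \<Rightarrow> nat \<Rightarrow> complex"
  shows "det (sqmat m A) = 0 \<longleftrightarrow> (\<exists>c. (\<exists>b<m. c b \<noteq> 0) \<and> (\<forall>a<m. (\<Sum>b<m. A a b * c b) = 0))"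
proof -
  have c: "sqmat m A \<in> carrier_mat m m" by simp
  have mv: "(sqmat m A *\<^sub>v v) $ a = (\<Sum>b<m. A a b * v $ b)" if "a < m" "v \<in> carrier_vec m" for a v
    using that by (simp add: scalar_prod_def atLeast0LessThan)
  show ?thesis
    unfolding det_0_iff_vec_prod_zero[OF c]
  proof
    assume "\<exists>v. v \<in> carrier_vec m \<and> v \<noteq> 0\<^sub>v m \<and> sqmat m A *\<^sub>v v = 0\<^sub>v m"
    then obtain v where v: "v \<in> carrier_vec m" "v \<noteq> 0\<^sub>v m" "sqmat m A *\<^sub>v v = 0\<^sub>v m" by blast
    then have "\<exists>b<m. v $ b \<noteq> 0" by (metis carrier_vecD eq_vecI index_zero_vec)
    moreover have "\<forall>a<m. (\<Sum>b<m. A a b * v $ b) = 0"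
      using mv[OF _ v(1)] v(3) by simp
    ultimately show "\<exists>c. (\<exists>b<m. c b \<noteq> 0) \<and> (\<forall>a<m. (\<Sum>b<m. A a b * c b) = 0)" by blast
  next
    assume "\<exists>c. (\<exists>b<m. c b \<noteq> 0) \<and> (\<forall>a<m. (\<Sum>b<m. A a b * c b) = 0)"
    then obtain c b where cb: "b < m" "c b \<noteq> 0" "\<forall>a<m. (\<Sum>b<m. A a b * c b) = 0" by blast
    have "vec m c \<noteq> 0\<^sub>v m" using cb by (metis index_vec index_zero_vec(1))
    moreover have "sqmat m A *\<^sub>v vec m c = 0\<^sub>v m"
      using mv[of _ "vec m c"] cb(3) by (intro eq_vecI) auto
    ultimately show "\<exists>v. v \<in> carrier_vec m \<and> v \<noteq> 0\<^sub>v m \<and> sqmat m A *\<^sub>v v = 0\<^sub>v m"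
      by (intro exI[of _ "vec m c"]) auto
  qed
qed

text \<open>
  Padding with zero rows makes the matrix square and singular.
\<close>

lemma underdetermined:
  fixes A :: "nat \<Rightarrow> nat \<Rightarrow> complex"
  assumes "m < m'"
  shows "\<exists>c. (\<exists>b<m'. c b \<noteq> 0) \<and> (\<forall>a<m. (\<Sum>b<m'. A a b * c b) = 0)"
proof -
  define A' where "A' a b = (if a < m then A a b else 0)" for a b
  have "det (sqmat m' A') = 0"
  proof -
    have c: "sqmat m' A' \<in> carrier_mat m' m'" by simp
    have "(\<Prod>i = 0..<m'. sqmat m' A' $$ (i, p i)) = 0" if "p permutes {0..<m'}" for p
    proof (rule prod_zero)
      have "p m < m'" using that assms permutes_in_image[OF that, of m] by simp
      then show "\<exists>i\<in>{0..<m'}. sqmat m' A' $$ (i, p i) = 0"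
        using assms by (intro bexI[of _ m]) (auto simp: A'_def)
    qed simp
    then show ?thesis unfolding det_def'[OF c] by (intro sum.neutral) auto
  qed
  then obtain c where "\<exists>b<m'. c b \<noteq> 0" "\<forall>a<m'. (\<Sum>b<m'. A' a b * c b) = 0"
    using det_0_kernel by blast
  moreover have "(\<Sum>b<m'. A a b * c b) = 0" if "a < m" for a
  proof -
    have "(\<Sum>b<m'. A' a b * c b) = 0" using \<open>\<forall>a<m'. (\<Sum>b<m'. A' a b * c b) = 0\<close> that assms by simp
    then show ?thesis using that by (simp add: A'_def)
  qed
  ultimately show ?thesis by blast
qed

lemma fun_algebra_sum:
  assumes "\<And>i. i \<in> I \<Longrightarrow> (\<lambda>x. f i x) \<in> fun_algebra S"
  shows "(\<lambda>x. \<Sum>i\<in>I. f i x) \<in> fun_algebra S"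
  using assms
proof (induction I rule: infinite_finite_induct)
  case (insert i I)
  then have "(\<lambda>x. f i x + (\<Sum>i\<in>I. f i x)) \<in> fun_algebra S"
    by (intro fun_algebra.add) auto
  with insert show ?case by simp
qed (simp_all add: fun_algebra.const)

lemma fun_algebra_prod:
  assumes "\<And>i. i \<in> I \<Longrightarrow> (\<lambda>x. f i x) \<in> fun_algebra S"
  shows "(\<lambda>x. \<Prod>i\<in>I. f i x) \<in> fun_algebra S"
  using assms
proof (induction I rule: infinite_finite_induct)
  case (insert i I)
  then have "(\<lambda>x. f i x * (\<Prod>i\<in>I. f i x)) \<in> fun_algebra S"
    by (intro fun_algebra.mult) auto
  with insert show ?case by simp
qed (simp_all add: fun_algebra.const)

lemma fun_algebra_power: "f \<in> fun_algebra S \<Longrightarrow> (\<lambda>x. f x ^ k) \<in> fun_algebra S"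
  using fun_algebra_prod[of "{..<k}" "\<lambda>_. f" S] by simp

lemma fun_algebra_cmult: "f \<in> fun_algebra S \<Longrightarrow> (\<lambda>x. c * f x) \<in> fun_algebra S"
  by (intro fun_algebra.mult fun_algebra.const)

lemma det_sqmat:
  "det (sqmat m A) = (\<Sum>p\<in>{p. p permutes {..<m}}. signof p * (\<Prod>i<m. A i (p i)))"
proof -
  have c: "sqmat m A \<in> carrier_mat m m" by simp
  have "sqmat m A $$ (i, p i) = A i (p i)" if "p permutes {..<m}" "i < m" for i p
    using that permutes_in_image[OF that(1), of i] by simp
  then show ?thesis
    unfolding det_def'[OF c] atLeast0LessThan by (intro sum.cong arg_cong2[of _ _ _ _ "(*)"] prod.cong) auto
qed

lemma fun_algebra_det:
  assumes "\<And>i j. i < m \<Longrightarrow> j < m \<Longrightarrow> (\<lambda>x. A x i j) \<in> fun_algebra S"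
  shows "(\<lambda>x. det (sqmat m (A x))) \<in> fun_algebra S"
  unfolding det_sqmat
proof (rule fun_algebra_sum, rule fun_algebra_cmult, rule fun_algebra_prod)
  fix p i assume "p \<in> {p. p permutes {..<m}}" "i \<in> {..<m}"
  then show "(\<lambda>x. A x i (p i)) \<in> fun_algebra S"
    using permutes_in_image[of p "{..<m}" i] by (intro assms) auto
qed

lemma fun_algebra_adj:
  assumes "\<And>i j. i < m \<Longrightarrow> j < m \<Longrightarrow> (\<lambda>x. A x i j) \<in> fun_algebra S" and "a < m" "b < m"
  shows "(\<lambda>x. adj m (A x) b a) \<in> fun_algebra S"
proof -
  define B where "B x i j = A x (if i < a then i else Suc i) (if j < b then j else Suc j)" for x i j
  have "mat_delete (sqmat m (A x)) a b = sqmat (m - 1) (B x)" for x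
    by (rule eq_matI) (auto simp: mat_delete_def B_def)
  then have "adj m (A x) b a = (-1) ^ (a + b) * det (sqmat (m - 1) (B x))" for x
    using assms by (simp add: adj_def adj_mat_def cofactor_def)
  moreover have "(\<lambda>x. (-1) ^ (a + b) * det (sqmat (m - 1) (B x))) \<in> fun_algebra S"
    using assms(2,3) by (intro fun_algebra_cmult fun_algebra_det) (auto simp: B_def intro!: assms(1))
  ultimately show ?thesis by simp
qed

section \<open>The Iwahori subgroup acts on the lattices\<close>

context loop_dim
begin

lemma loop_group_carrier: "g \<in> loop_group n \<Longrightarrow> g \<in> carrier_mat n n"
  by (simp add: loop_group_def)

lemma loop_groupI:
  assumes "A \<in> carrier_mat n n" "B \<in> carrier_mat n n" "A * B = 1\<^sub>m n" "B * A = 1\<^sub>m n"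
  shows "A \<in> loop_group n"
  using assms unfolding loop_group_def invertible_mat_def inverts_mat_def by auto

lemma loop_group_inverse:
  assumes "g \<in> loop_group n"
  obtains h where "h \<in> carrier_mat n n" "g * h = 1\<^sub>m n" "h * g = 1\<^sub>m n"
proof -
  have g: "g \<in> carrier_mat n n" and "invertible_mat g" using assms by (auto simp: loop_group_def)
  then obtain B where B: "g * B = 1\<^sub>m n" "B * g = 1\<^sub>m (dim_row B)"
    unfolding invertible_mat_def inverts_mat_def by auto
  have "dim_col B = n" using arg_cong[OF B(1), of dim_col] by simp
  moreover have "dim_row B = n" using arg_cong[OF B(2), of dim_col] g by simp
  ultimately show ?thesis using B that[of B] by auto
qed

lemma loop_group_mult:
  assumes "g \<in> loop_group n" "h \<in> loop_group n"
  shows "g * h \<in> loop_group n"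
proof -
  obtain g' where g': "g' \<in> carrier_mat n n" "g * g' = 1\<^sub>m n" "g' * g = 1\<^sub>m n"
    using loop_group_inverse[OF assms(1)] by blast
  obtain h' where h': "h' \<in> carrier_mat n n" "h * h' = 1\<^sub>m n" "h' * h = 1\<^sub>m n"
    using loop_group_inverse[OF assms(2)] by blast
  note c = loop_group_carrier[OF assms(1)] loop_group_carrier[OF assms(2)] g'(1) h'(1)
  have "(g * h) * (h' * g') = g * (h * h') * g'"
    using c by (simp add: assoc_mult_mat[of _ n n _ n _ n])
  moreover have "(h' * g') * (g * h) = h' * (g' * g) * h"
    using c by (simp add: assoc_mult_mat[of _ n n _ n _ n])
  ultimately show ?thesis
    using c g' h' by (intro loop_groupI[of _ "h' * g'"]) auto
qed

lemma iwahori_loop_group: "b \<in> iwahori n \<Longrightarrow> b \<in> loop_group n"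
  by (simp add: iwahori_def)

text \<open>
  In terms of indices, the matrices in \<open>\<bb>\<close> are the upper triangular ones.
\<close>

lemma regular_mat_E_in_Lam:
  assumes x: "x \<in> carrier_mat n n" "elements_mat x \<subseteq> regular_ratfun" "upper_triangular (map_mat at_zero x)"
  shows "x *\<^sub>v E l \<in> Lam l"
proof -
  have "cf k (x *\<^sub>v E l) = 0" if "k > l" for k
  proof -
    have "zord k \<le> zord l"
    proof (rule ccontr)
      assume "\<not> zord k \<le> zord l"
      then have "int n * zord k \<ge> int n * (zord l + 1)" by (intro mult_left_mono) auto
      then show False
        using idx_zord[of k] idx_zord[of l] idx_less[of k] that by (simp add: algebra_simps)
    qed
    moreover have "x $$ (idx k, idx l) \<in> regular_ratfun"
      using x(1,2) idx_less[of k] idx_less[of l] by (meson elements_matI subsetD)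
    moreover have "fls_nth (laurent (x $$ (idx k, idx l))) 0 = 0" if "zord k = zord l"
    proof -
      have "idx l < idx k" using that \<open>k > l\<close> idx_zord[of k] idx_zord[of l] by simp
      then have "map_mat at_zero x $$ (idx k, idx l) = 0"
        using x(1,3) by (intro upper_triangularD) auto
      then show ?thesis using x(1) by (simp add: at_zero_def)
    qed
    ultimately show ?thesis
      using x(1) by (cases "zord k = zord l") (auto simp: cf_mat_E regular_ratfun_iff)
  qed
  then show ?thesis using x(1) by (simp add: Lam_def)
qed

lemma iwahori_E:
  assumes b: "b \<in> iwahori n"
  shows "b *\<^sub>v E l \<in> Lam l" "cf l (b *\<^sub>v E l) \<noteq> 0"
proof -
  have c: "b \<in> carrier_mat n n" using b by (simp add: iwahori_def loop_group_def)
  then show "b *\<^sub>v E l \<in> Lam l"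
    using b by (intro regular_mat_E_in_Lam) (auto simp: iwahori_def)
  have M: "map_mat at_zero b \<in> carrier_mat n n" using c by simp
  have ut: "upper_triangular (map_mat at_zero b)" and "invertible_mat (map_mat at_zero b)"
    using b by (auto simp: iwahori_def)
  then obtain B where B: "map_mat at_zero b * B = 1\<^sub>m n" "B * map_mat at_zero b = 1\<^sub>m (dim_row B)"
    using c unfolding invertible_mat_def inverts_mat_def by auto
  have "dim_col B = n" using arg_cong[OF B(1), of dim_col] by simp
  moreover have "dim_row B = n" using arg_cong[OF B(2), of dim_col] c by simp
  ultimately have "det (map_mat at_zero b) * det B = 1"
    using det_mult[of "map_mat at_zero b" n B] c B by auto
  then have "0 \<notin> set (diag_mat (map_mat at_zero b))"
    using upper_triangular_imp_det_eq_0_iff[OF M ut] by auto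
  moreover have "map_mat at_zero b $$ (idx l, idx l) \<in> set (diag_mat (map_mat at_zero b))"
    using c by (auto simp: diag_mat_def)
  ultimately show "cf l (b *\<^sub>v E l) \<noteq> 0"
    using c by (auto simp: cf_mat_E at_zero_def)
qed

lemma iwahoriI:
  assumes g: "g \<in> loop_group n" and E: "\<And>l. g *\<^sub>v E l \<in> Lam l" "\<And>l. cf l (g *\<^sub>v E l) \<noteq> 0"
  shows "g \<in> iwahori n"
proof -
  have c: "g \<in> carrier_mat n n" using g by (rule loop_group_carrier)
  have coeff: "fls_nth (laurent (g $$ (r, s))) q = cf (int r + 1 - int n * q) (g *\<^sub>v E (int s + 1))"
    if "r < n" "s < n" for r s q
    using that c by (simp add: cf_mat_E idx_eq zord_eq)
  have "g $$ (r, s) \<in> regular_ratfun" if "r < n" "s < n" for r s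
    unfolding regular_ratfun_iff
  proof (intro allI impI)
    fix q :: int assume "q < 0"
    then have "int n * q \<le> int n * (-1)" by (intro mult_left_mono) auto
    then have "int r + 1 - int n * q > int s + 1" using that by simp
    then show "fls_nth (laurent (g $$ (r, s))) q = 0"
      using E(1)[of "int s + 1"] that by (simp add: coeff Lam_def)
  qed
  then have "elements_mat g \<subseteq> regular_ratfun" using c by (auto dest!: elements_matD)
  moreover have ut: "upper_triangular (map_mat at_zero g)"
  proof (rule upper_triangularI)
    fix i j assume "j < i" "i < dim_row (map_mat at_zero g)"
    then show "map_mat at_zero g $$ (i, j) = 0"
      using c E(1)[of "int j + 1"] by (simp add: at_zero_def coeff Lam_def)
  qed
  moreover have "invertible_mat (map_mat at_zero g)"
  proof -
    have M: "map_mat at_zero g \<in> carrier_mat n n" using c by simp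
    have "map_mat at_zero g $$ (i, i) \<noteq> 0" if "i < n" for i
      using c that E(2)[of "int i + 1"] by (simp add: at_zero_def coeff)
    then have "0 \<notin> set (diag_mat (map_mat at_zero g))" using c by (auto simp: diag_mat_def)
    then have "det (map_mat at_zero g) \<noteq> 0"
      using upper_triangular_imp_det_eq_0_iff[OF M ut] by simp
    then obtain B where "B \<in> carrier_mat n n" "B * map_mat at_zero g = 1\<^sub>m n" "map_mat at_zero g * B = 1\<^sub>m n"
      using det_non_zero_imp_unit[OF M] by (auto simp: Units_def ring_mat_def)
    then show ?thesis
      using c unfolding invertible_mat_def inverts_mat_def by (auto intro!: exI[of _ B])
  qed
  ultimately show ?thesis using g by (simp add: iwahori_def)
qed

lemma iwahori_Lam: "b \<in> iwahori n \<Longrightarrow> v \<in> Lam m \<Longrightarrow> b *\<^sub>v v \<in> Lam m"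
  using mat_LamI[of b m m v] iwahori_E(1)[of b] Lam_mono
  by (force simp: iwahori_def loop_group_def)

text \<open>
  By triangularity with invertible diagonal, the top coefficient of the remainder can be removed
  again and again.
\<close>

lemma iwahori_Lam_approx:
  assumes b: "b \<in> iwahori n" and v: "v \<in> Lam m"
  shows "\<exists>u\<in>Lam m. v - b *\<^sub>v u \<in> Lam (m - int s)"
proof (induction s)
  case 0
  have "v - b *\<^sub>v 0\<^sub>v n = v"
    using b v Lam_carrier[OF v] by (intro eq_vecI) (auto simp: iwahori_def loop_group_def)
  then show ?case using v csub_Lam[of m] by (intro bexI[of _ "0\<^sub>v n"]) (auto simp: csub_def)
next
  case (Suc s)
  have c: "b \<in> carrier_mat n n" using b by (simp add: iwahori_def loop_group_def)
  from Suc obtain u where u: "u \<in> Lam m" "v - b *\<^sub>v u \<in> Lam (m - int s)" by blast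
  define l where "l = m - int s"
  define \<alpha> where "\<alpha> = cf l (v - b *\<^sub>v u) / cf l (b *\<^sub>v E l)"
  define u' where "u' = u + const \<alpha> \<cdot>\<^sub>v E l"
  have car: "u \<in> carrier_vec n" "v \<in> carrier_vec n" using u v Lam_carrier by auto
  have "u' \<in> Lam m" using csub_Lam[of m] u(1) by (simp add: u'_def csub_def l_def)
  moreover have eq: "b *\<^sub>v u' = b *\<^sub>v u + const \<alpha> \<cdot>\<^sub>v (b *\<^sub>v E l)"
    using c car by (simp add: u'_def mult_add_distrib_mat_vec[OF c] mult_mat_vec[OF c])
  have "v - b *\<^sub>v u' = (v - b *\<^sub>v u) - const \<alpha> \<cdot>\<^sub>v (b *\<^sub>v E l)"
    using c car by (intro cf_eqI) (auto simp: eq cf_diff cf_add)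
  moreover have "(v - b *\<^sub>v u) - const \<alpha> \<cdot>\<^sub>v (b *\<^sub>v E l) \<in> Lam (m - int (Suc s))"
  proof -
    have "cf k ((v - b *\<^sub>v u) - const \<alpha> \<cdot>\<^sub>v (b *\<^sub>v E l)) = 0" if "k > l - 1" for k
    proof (cases "k = l")
      case True
      then show ?thesis using c car iwahori_E(2)[OF b, of l] by (simp add: cf_diff cf_smult \<alpha>_def)
    next
      case False
      then have "cf k (v - b *\<^sub>v u) = 0" "cf k (b *\<^sub>v E l) = 0"
        using u(2) iwahori_E(1)[OF b, of l] that by (auto simp: Lam_def l_def)
      moreover have "v - b *\<^sub>v u \<in> carrier_vec n" "b *\<^sub>v E l \<in> carrier_vec n" using c car by auto
      ultimately show ?thesis by (simp add: cf_diff cf_smult)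
    qed
    then show ?thesis using c car by (simp add: Lam_def l_def)
  qed
  ultimately show ?case by metis
qed

text \<open>
  The successive approximations converge only \<open>z\<close>-adically, not to a vector of rational functions.
  Since \<open>b\<close> is invertible over \<open>\<complex>(z)\<close>, its inverse maps a sufficiently small remainder into
  \<open>Lam m\<close>, and finitely many steps are enough.
\<close>

lemma iwahori_Lam_surj:
  assumes b: "b \<in> iwahori n" and v: "v \<in> Lam m"
  shows "v \<in> (*\<^sub>v) b ` Lam m"
proof -
  have c: "b \<in> carrier_mat n n" using b by (simp add: iwahori_def loop_group_def)
  obtain b' where b': "b' \<in> carrier_mat n n" "b * b' = 1\<^sub>m n" "b' * b = 1\<^sub>m n"
    using loop_group_inverse iwahori_loop_group[OF b] by blast
  obtain C where C: "C \<ge> 0" "\<And>m v. v \<in> Lam m \<Longrightarrow> b' *\<^sub>v v \<in> Lam (m + C)"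
    using mat_Lam_bounded[OF b'(1)] by blast
  \<comment> \<open>the remainder is small enough for the pole bound \<open>C\<close> of the inverse matrix\<close>
  obtain u where u: "u \<in> Lam m" "v - b *\<^sub>v u \<in> Lam (m - int (nat C))"
    using iwahori_Lam_approx[OF b v] by blast
  define u' where "u' = b' *\<^sub>v (v - b *\<^sub>v u)"
  have "u' \<in> Lam m" using C(2)[OF u(2)] C(1) by (simp add: u'_def)
  then have "u + u' \<in> Lam m" using u csub_Lam[of m] by (simp add: csub_def)
  moreover have "b *\<^sub>v (u + u') = v"
  proof -
    have car: "u \<in> carrier_vec n" "v \<in> carrier_vec n" using u v Lam_carrier by auto
    have "b *\<^sub>v u' = v - b *\<^sub>v u"
      using b' c car by (simp add: u'_def flip: assoc_mult_mat_vec)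
    then show ?thesis
      using b' c car by (intro cf_eqI) (auto simp: u'_def mult_add_distrib_mat_vec[OF c] cf_add cf_diff)
  qed
  ultimately show ?thesis by blast
qed

end

section \<open>The big cell and its coordinates\<close>

context loop_dim
begin

text \<open>
  The flags for which each \<open>M_i\<close> is a complement of the space spanned by the basis vectors of index
  above \<open>i\<close>, that is, the graph of a map from \<open>L_i\<close> to that space. They form the
  open cell around the base point that is opposite to the Schubert cells.
\<close>

definition big_cell :: "flag set" where
  "big_cell = {M \<in> flags n. \<forall>i\<le>n. \<forall>l\<le>int i.
      \<exists>!v. v \<in> M i \<and> (\<forall>k\<le>int i. cf k v = (if k = l then 1 else 0))}"

text \<open>
  The point of the graph \<open>M_i\<close> above \<open>E l\<close>. Its coefficients at the indices above \<open>i\<close> are the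
  coordinates of \<open>M\<close>; they make no reference to a level \<open>N\<close>.
\<close>

definition canv :: "flag \<Rightarrow> nat \<Rightarrow> int \<Rightarrow> ratfun vec" where
  "canv M i l = (THE v. v \<in> M i \<and> (\<forall>k\<le>int i. cf k v = (if k = l then 1 else 0)))"

abbreviation lo :: "nat \<Rightarrow> int" where
  "lo N \<equiv> int n - int n * int N"

abbreviation hi :: "nat \<Rightarrow> int" where
  "hi N \<equiv> int n + int n * int N"

definition incl :: "nat \<Rightarrow> flag \<Rightarrow> bool" where
  "incl N M \<longleftrightarrow> (\<forall>i\<le>n. Lam (lo N) \<subseteq> M i \<and> M i \<subseteq> Lam (hi N))"

definition coord_algebra :: "(flag \<Rightarrow> complex) set" where
  "coord_algebra = fun_algebra {\<lambda>M. cf k (canv M i l) | i k l. i \<le> n \<and> l \<le> int i}"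

text \<open>
  The dimension of \<open>L_0 / z^N \<Lambda>^n\<close>.
\<close>

definition dim0 :: "nat \<Rightarrow> nat" where
  "dim0 N = n * (N - 1)"

text \<open>
  The coefficients of a frame at the indices \<open>i, i - 1, \<dots>\<close>. With \<open>dim0 N + i\<close> rows, these are all the
  indices above \<open>lo N\<close> up to \<open>i\<close>, and the matrix describes the projection of \<open>M_i / z^N \<Lambda>^n\<close> to
  \<open>L_i / z^N \<Lambda>^n\<close>.
\<close>

definition umat :: "frame \<Rightarrow> nat \<Rightarrow> nat \<Rightarrow> nat \<Rightarrow> complex" where
  "umat fr i a b = cf (int i - int a) (fr i b)"

lemma lo_nonpos: "N \<ge> 1 \<Longrightarrow> lo N \<le> 0"
proof -
  assume "N \<ge> 1"
  then have "int n * 1 \<le> int n * int N" by (intro mult_left_mono) auto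
  then show ?thesis by simp
qed

lemma incl_lower: "incl N M \<Longrightarrow> i \<le> n \<Longrightarrow> Lam (lo N) \<subseteq> M i"
  and incl_upper: "incl N M \<Longrightarrow> i \<le> n \<Longrightarrow> M i \<subseteq> Lam (hi N)"
  by (simp_all add: incl_def)

lemma int_dim0: "N \<ge> 1 \<Longrightarrow> int (dim0 N) = int n * int N - int n"
  by (simp add: dim0_def of_nat_diff algebra_simps)

lemma flag_of_Lam: "i \<le> n \<Longrightarrow> flag_of n g i = (*\<^sub>v) g ` Lam (int i)"
  by (simp add: flag_of_def std_lattice_eq_Lam)

lemma csub_image:
  assumes "g \<in> carrier_mat n n" "csub M"
  shows "csub ((*\<^sub>v) g ` M)"
proof -
  have c: "u \<in> carrier_vec n" if "u \<in> M" for u using csub_carrier[OF assms(2) that] .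
  have "g *\<^sub>v 0\<^sub>v n = 0\<^sub>v n" using assms by (intro eq_vecI) auto
  moreover have "g *\<^sub>v u + g *\<^sub>v v = g *\<^sub>v (u + v)" if "u \<in> M" "v \<in> M" for u v
    using mult_add_distrib_mat_vec[OF assms(1) c[OF that(1)] c[OF that(2)]] by simp
  moreover have "k \<cdot>\<^sub>v (g *\<^sub>v u) = g *\<^sub>v (k \<cdot>\<^sub>v u)" if "u \<in> M" for u k
    using mult_mat_vec[OF assms(1) c[OF that]] by simp
  ultimately show ?thesis
    using assms c unfolding csub_def by (auto intro!: image_eqI[of "0\<^sub>v n" _ "0\<^sub>v n"])
qed

lemma csub_flag: "M \<in> flags n \<Longrightarrow> i \<le> n \<Longrightarrow> csub (M i)"
  by (auto simp: flags_def flag_of_Lam intro!: csub_image csub_Lam loop_group_carrier)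

lemma big_cell_flags: "M \<in> big_cell \<Longrightarrow> M \<in> flags n"
  by (simp add: big_cell_def)

lemma canv:
  assumes "M \<in> big_cell" "i \<le> n" "l \<le> int i"
  shows "canv M i l \<in> M i" "k \<le> int i \<Longrightarrow> cf k (canv M i l) = (if k = l then 1 else 0)"
proof -
  have "\<exists>!v. v \<in> M i \<and> (\<forall>k\<le>int i. cf k v = (if k = l then 1 else 0))"
    using assms by (simp add: big_cell_def)
  from theI'[OF this] show "canv M i l \<in> M i"
    "k \<le> int i \<Longrightarrow> cf k (canv M i l) = (if k = l then 1 else 0)"
    unfolding canv_def by auto
qed

lemma canv_eqI:
  assumes "M \<in> big_cell" "i \<le> n" "l \<le> int i"
    and "v \<in> M i" "\<And>k. k \<le> int i \<Longrightarrow> cf k v = (if k = l then 1 else 0)"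
  shows "canv M i l = v"
proof -
  have "\<exists>!v. v \<in> M i \<and> (\<forall>k\<le>int i. cf k v = (if k = l then 1 else 0))"
    using assms by (simp add: big_cell_def)
  then show ?thesis
    unfolding canv_def by (rule the1_equality) (use assms in auto)
qed

lemma canv_carrier:
  assumes "M \<in> big_cell" "i \<le> n" "l \<le> int i"
  shows "canv M i l \<in> carrier_vec n"
  using canv(1)[OF assms] csub_flag[OF big_cell_flags[OF assms(1)] assms(2)] csub_carrier by blast

lemma big_cell_zero:
  assumes "M \<in> big_cell" "i \<le> n" "u \<in> M i" "\<And>k. k \<le> int i \<Longrightarrow> cf k u = 0"
  shows "u = 0\<^sub>v n"
proof -
  have M: "csub (M i)" using csub_flag[OF big_cell_flags[OF assms(1)] assms(2)] .
  have c: "u \<in> carrier_vec n" "canv M i (int i) \<in> carrier_vec n"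
    using csub_carrier[OF M assms(3)] canv_carrier[OF assms(1,2)] by auto
  have "canv M i (int i) = canv M i (int i) + u"
    using assms M canv[OF assms(1,2), of "int i"] c
    by (intro canv_eqI) (auto simp: csub_def cf_add)
  then have "cf l u = 0" for l
    using c cf_add[OF c(2,1), of l] by simp
  then show ?thesis using c by (intro cf_eqI) auto
qed

text \<open>
  The part of \<open>u\<close> at indices above \<open>i\<close> differs from \<open>u\<close> by an element of \<open>z^N \<Lambda>^n \<subseteq> M_i\<close>, so it lies
  in \<open>M_i\<close> and vanishes.
\<close>

lemma big_cell_low:
  assumes "M \<in> big_cell" "incl N M" "i \<le> n" "u \<in> M i"
    and 0: "\<And>k. lo N < k \<Longrightarrow> k \<le> int i \<Longrightarrow> cf k u = 0"
  shows "u \<in> Lam (lo N)"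
proof -
  define e where "e = lo N"
  have M: "csub (M i)" using csub_flag[OF big_cell_flags[OF assms(1)] assms(3)] .
  have c: "u \<in> carrier_vec n" using csub_carrier[OF M assms(4)] .
  obtain K where K: "u \<in> Lam K" using bounded_in_Lam[OF c] by blast
  define t where "t = vsum {e<..K} (\<lambda>l. cf l u) E"
  have low: "u - t \<in> Lam e" unfolding t_def by (rule truncate_in_Lam[OF K])
  then have "u - t \<in> M i" using assms(2,3) by (auto simp: incl_def e_def)
  then have "u - (u - t) \<in> M i" by (rule csub_diff[OF M assms(4)])
  moreover have tc: "t \<in> carrier_vec n" by (simp add: t_def)
  moreover have "u - (u - t) = t" using c tc by (intro cf_eqI) (auto simp: cf_diff)
  moreover have "cf k t = 0" if "k \<le> int i" for k
    unfolding t_def cf_vsum using 0 that by (intro sum.neutral) (auto simp: cf_E e_def)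
  ultimately have "t = 0\<^sub>v n" using big_cell_zero[OF assms(1,3), of t] by simp
  then have "u - t = u" using c by simp
  then show ?thesis using low by (simp add: e_def)
qed

section \<open>Frames of flags\<close>

lemma is_frame_iff:
  "is_frame n N d M fr \<longleftrightarrow> (\<forall>i\<le>n. (\<forall>k<d + i. fr i k \<in> M i) \<and>
      (\<forall>v\<in>M i. \<exists>!c. c \<in> {..<d + i} \<rightarrow>\<^sub>E UNIV \<and>
         v - vsum {..<d + i} c (fr i) \<in> Lam (lo N)))"
  by (simp add: is_frame_def vsum_def lattice_eq_Lam)

lemma frame_in: "is_frame n N d M fr \<Longrightarrow> i \<le> n \<Longrightarrow> k < d + i \<Longrightarrow> fr i k \<in> M i"
  by (simp add: is_frame_iff)

lemma frame_span:
  "is_frame n N d M fr \<Longrightarrow> i \<le> n \<Longrightarrow> v \<in> M i \<Longrightarrow>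
    \<exists>c. v - vsum {..<d + i} c (fr i) \<in> Lam (lo N)"
  unfolding is_frame_iff by blast

lemma vsum_restrict: "vsum S (restrict c S) u = vsum S c u"
  by (simp add: vsum_def cong: sum.cong)

lemma frame_indep:
  assumes "is_frame n N d M fr" "M \<in> flags n" "i \<le> n"
    and v: "vsum {..<d + i} c (fr i) \<in> Lam (lo N)" and "k < d + i"
  shows "c k = 0"
proof -
  define S where "S = {..<d + i}"
  have M: "csub (M i)" using csub_flag assms by blast
  have ex1: "\<exists>!c. c \<in> S \<rightarrow>\<^sub>E UNIV \<and> 0\<^sub>v n - vsum S c (fr i) \<in> Lam (lo N)"
  proof -
    have "\<forall>v\<in>M i. \<exists>!c. c \<in> S \<rightarrow>\<^sub>E UNIV \<and> v - vsum S c (fr i) \<in> Lam (lo N)"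
      using assms(1,3) unfolding is_frame_iff S_def by simp
    moreover have "0\<^sub>v n \<in> M i" using M by (simp add: csub_def)
    ultimately show ?thesis by (rule bspec)
  qed
  have z: "0\<^sub>v n \<in> Lam (lo N)" using csub_Lam by (auto simp: csub_def)
  have "0\<^sub>v n - vsum S (restrict c S) (fr i) \<in> Lam (lo N)"
    using csub_diff[OF csub_Lam z v] by (simp add: vsum_restrict S_def)
  moreover have "0\<^sub>v n - vsum S (restrict (\<lambda>_. 0) S) (fr i) = 0\<^sub>v n"
    unfolding vsum_restrict by (intro cf_eqI) (auto simp: cf_def vsum_def laurent_sum nth_fls_sum)
  moreover obtain c0 where "\<And>c. c \<in> S \<rightarrow>\<^sub>E UNIV \<Longrightarrow> 0\<^sub>v n - vsum S c (fr i) \<in> Lam (lo N) \<Longrightarrow> c = c0"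
    using ex1 by (elim ex1E) blast
  moreover have "restrict c S \<in> S \<rightarrow>\<^sub>E UNIV" "restrict (\<lambda>_. 0) S \<in> S \<rightarrow>\<^sub>E UNIV"
    by auto
  ultimately have "restrict c S = restrict (\<lambda>_. 0) S" using z by metis
  then show ?thesis using assms(5) by (metis S_def lessThan_iff restrict_apply')
qed

lemma is_frameI:
  assumes M: "M \<in> flags n"
    and in_M: "\<And>i k. i \<le> n \<Longrightarrow> k < d + i \<Longrightarrow> fr i k \<in> M i"
    and span: "\<And>i v. i \<le> n \<Longrightarrow> v \<in> M i \<Longrightarrow> \<exists>c. v - vsum {..<d + i} c (fr i) \<in> Lam (lo N)"
    and indep: "\<And>i c k. i \<le> n \<Longrightarrow> vsum {..<d + i} c (fr i) \<in> Lam (lo N) \<Longrightarrow> k < d + i \<Longrightarrow> c k = 0"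
  shows "is_frame n N d M fr"
  unfolding is_frame_iff
proof (intro allI impI conjI ballI)
  fix i v assume i: "i \<le> n" and v: "v \<in> M i"
  define S where "S = {..<d + i}"
  obtain c where c: "v - vsum S c (fr i) \<in> Lam (lo N)" using span[OF i v] by (auto simp: S_def)
  show "\<exists>!c. c \<in> {..<d + i} \<rightarrow>\<^sub>E UNIV \<and> v - vsum {..<d + i} c (fr i) \<in> Lam (lo N)"
    unfolding S_def[symmetric]
  proof (rule ex1I[of _ "restrict c S"])
    show "restrict c S \<in> S \<rightarrow>\<^sub>E UNIV \<and> v - vsum S (restrict c S) (fr i) \<in> Lam (lo N)"
      using c by (simp add: vsum_restrict)
  next
    fix c' assume c': "c' \<in> S \<rightarrow>\<^sub>E UNIV \<and> v - vsum S c' (fr i) \<in> Lam (lo N)"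
    have vc: "v \<in> carrier_vec n" using csub_carrier[OF csub_flag[OF M i] v] .
    have "(v - vsum S c (fr i)) - (v - vsum S c' (fr i)) \<in> Lam (lo N)"
      using csub_diff[OF csub_Lam c] c' by blast
    moreover have "(v - vsum S c (fr i)) - (v - vsum S c' (fr i)) = vsum S (\<lambda>k. c' k - c k) (fr i)"
      using vc by (intro cf_eqI) (auto simp: cf_diff cf_vsum sum_subtractf algebra_simps)
    ultimately have "c' k - c k = 0" if "k \<in> S" for k
      using indep[OF i, of "\<lambda>k. c' k - c k" k] that by (auto simp: S_def)
    then show "c' = restrict c S"
      using c' by (intro ext) (auto simp: restrict_def PiE_def extensional_def)
  qed
qed (use in_M in auto)

text \<open>
  More vectors of \<open>M_0\<close> than a frame has are linearly dependent modulo \<open>z^N \<Lambda>^n\<close>.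
\<close>

lemma frame_dim_unique:
  assumes fr: "is_frame n N d M fr" and fr': "is_frame n N d' M fr'" and M: "M \<in> flags n"
  shows "d' \<le> d"
proof (rule ccontr)
  assume "\<not> d' \<le> d"
  then have less: "d < d'" by simp
  have "\<exists>c. k < d' \<longrightarrow> fr' 0 k - vsum {..<d} c (fr 0) \<in> Lam (lo N)" for k
    using frame_span[OF fr, of 0 "fr' 0 k"] frame_in[OF fr', of 0 k] by auto
  then obtain C where C: "\<And>k. k < d' \<Longrightarrow> fr' 0 k - vsum {..<d} (C k) (fr 0) \<in> Lam (lo N)"
    by metis
  obtain c where c: "\<exists>b<d'. c b \<noteq> 0" "\<forall>a<d. (\<Sum>b<d'. C b a * c b) = 0"
    using underdetermined[OF less, of "\<lambda>a b. C b a"] by blast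
  have "vsum {..<d'} c (\<lambda>k. fr' 0 k - vsum {..<d} (C k) (fr 0)) \<in> Lam (lo N)"
    using C by (intro csub_vsum csub_Lam) auto
  also have "vsum {..<d'} c (\<lambda>k. fr' 0 k - vsum {..<d} (C k) (fr 0)) = vsum {..<d'} c (fr' 0)"
  proof (intro cf_eqI)
    fix l
    have "fr' 0 k \<in> carrier_vec n" if "k < d'" for k
      using frame_in[OF fr', of 0 k] that csub_carrier[OF csub_flag[OF M]] by auto
    then have "cf l (vsum {..<d'} c (\<lambda>k. fr' 0 k - vsum {..<d} (C k) (fr 0)))
        = (\<Sum>k<d'. c k * (cf l (fr' 0 k) - (\<Sum>a<d. C k a * cf l (fr 0 a))))"
      by (simp add: cf_vsum cf_diff)
    also have "\<dots> = (\<Sum>k<d'. c k * cf l (fr' 0 k)) - (\<Sum>k<d'. \<Sum>a<d. C k a * c k * cf l (fr 0 a))"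
      by (simp add: algebra_simps sum_subtractf sum_distrib_left)
    also have "(\<Sum>k<d'. \<Sum>a<d. C k a * c k * cf l (fr 0 a)) = (\<Sum>a<d. (\<Sum>k<d'. C k a * c k) * cf l (fr 0 a))"
      by (subst sum.swap) (simp add: sum_distrib_right)
    finally show "cf l (vsum {..<d'} c (\<lambda>k. fr' 0 k - vsum {..<d} (C k) (fr 0))) = cf l (vsum {..<d'} c (fr' 0))"
      using c(2) by (simp add: cf_vsum)
  qed auto
  finally show False
    using frame_indep[OF fr' M, of 0 c] c(1) by auto
qed

text \<open>
  Cramer's rule.
\<close>

lemma interpolate:
  assumes "det (sqmat m (umat fr i)) \<noteq> 0"
  shows "\<exists>c. \<forall>a<m. cf (int i - int a) (vsum {..<m} c (fr i)) = y a"
proof (intro exI allI impI)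
  let ?D = "det (sqmat m (umat fr i))"
  fix a assume a: "a < m"
  have "cf (int i - int a) (vsum {..<m} (\<lambda>b. (\<Sum>a'<m. adj m (umat fr i) b a' * y a') / ?D) (fr i))
      = (\<Sum>b<m. \<Sum>a'<m. umat fr i a b * adj m (umat fr i) b a' * y a') / ?D"
    by (simp add: cf_vsum umat_def sum_divide_distrib sum_distrib_left mult_ac)
  also have "(\<Sum>b<m. \<Sum>a'<m. umat fr i a b * adj m (umat fr i) b a' * y a')
      = (\<Sum>a'<m. (\<Sum>b<m. umat fr i a b * adj m (umat fr i) b a') * y a')"
    by (subst sum.swap) (simp add: sum_distrib_right)
  also have "\<dots> = (\<Sum>a'<m. if a' = a then ?D * y a else 0)"
    using a by (intro sum.cong) (auto simp: mult_adj)
  finally show "cf (int i - int a) (vsum {..<m} (\<lambda>b. (\<Sum>a'<m. adj m (umat fr i) b a' * y a') / ?D) (fr i)) = y a"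
    using a assms by simp
qed

lemma index_range:
  assumes "N \<ge> 1" "lo N < k" "k \<le> int i"
  obtains a where "a < dim0 N + i" "k = int i - int a"
  using that[of "nat (int i - k)"] assms int_dim0[OF assms(1)] by auto

lemma frame_if_det:
  assumes M: "M \<in> big_cell" "incl N M" and N: "N \<ge> 1"
    and in_M: "\<And>i k. i \<le> n \<Longrightarrow> k < dim0 N + i \<Longrightarrow> fr i k \<in> M i"
    and det: "\<And>i. i \<le> n \<Longrightarrow> det (sqmat (dim0 N + i) (umat fr i)) \<noteq> 0"
  shows "is_frame n N (dim0 N) M fr"
proof (rule is_frameI)
  show fl: "M \<in> flags n" using M by (simp add: big_cell_flags)
  show "fr i k \<in> M i" if "i \<le> n" "k < dim0 N + i" for i k using in_M that by blast
  fix i assume i: "i \<le> n"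
  define m where "m = dim0 N + i"
  have csubM: "csub (M i)" using csub_flag[OF fl i] .
  {
    fix v assume v: "v \<in> M i"
    obtain c where c: "\<And>a. a < m \<Longrightarrow> cf (int i - int a) (vsum {..<m} c (fr i)) = cf (int i - int a) v"
      using interpolate[OF det[OF i], folded m_def, where y = "\<lambda>a. cf (int i - int a) v"] by blast
    have "v - vsum {..<m} c (fr i) \<in> Lam (lo N)"
    proof (rule big_cell_low[OF M i])
      show vM: "v - vsum {..<m} c (fr i) \<in> M i"
        using v in_M i by (intro csub_diff csubM csub_vsum) (auto simp: m_def)
      fix k assume "lo N < k" "k \<le> int i"
      then obtain a where "a < m" "k = int i - int a" unfolding m_def by (elim index_range[OF N])
      then have "cf k (vsum {..<m} c (fr i)) = cf k v" using c by simp
      then show "cf k (v - vsum {..<m} c (fr i)) = 0"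
        using csub_carrier[OF csubM v] by (simp add: cf_diff)
    qed
    then show "\<exists>c. v - vsum {..<dim0 N + i} c (fr i) \<in> Lam (lo N)"
      by (auto simp: m_def)
  next
    fix c k assume c: "vsum {..<dim0 N + i} c (fr i) \<in> Lam (lo N)" and k: "k < dim0 N + i"
    have "(\<Sum>b<m. umat fr i a b * c b) = 0" if "a < m" for a
    proof -
      have "int i - int a > lo N" using that int_dim0[OF N] by (simp add: m_def)
      then have "cf (int i - int a) (vsum {..<m} c (fr i)) = 0" using c by (simp add: Lam_def m_def)
      then show ?thesis by (simp add: cf_vsum umat_def mult.commute)
    qed
    then show "c k = 0"
      using det_0_kernel[of m "umat fr i"] det[OF i] k by (auto simp: m_def)
  }
qed

text \<open>
  The frame of a flag in the big cell on which the projection to \<open>L_i\<close> is the identity matrix. The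
  frame of a lower level is an initial segment of that of a higher level.
\<close>

definition canframe :: "flag \<Rightarrow> frame" where
  "canframe M i k = canv M i (int i - int k)"

lemma umat_canframe:
  "M \<in> big_cell \<Longrightarrow> i \<le> n \<Longrightarrow> umat (canframe M) i a b = (if a = b then 1 else 0)"
  by (simp add: umat_def canframe_def canv)

lemma canframe_is_frame:
  assumes "M \<in> big_cell" "incl N M" "N \<ge> 1"
  shows "is_frame n N (dim0 N) M (canframe M)"
proof (rule frame_if_det[OF assms])
  fix i assume i: "i \<le> n"
  have "sqmat m (umat (canframe M) i) = 1\<^sub>m m" for m
    by (rule eq_matI) (auto simp: umat_canframe[OF assms(1) i])
  then show "det (sqmat (dim0 N + i) (umat (canframe M) i)) \<noteq> 0" by simp
qed (simp add: canframe_def canv assms)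

lemma not_incl_0: "M \<in> big_cell \<Longrightarrow> \<not> incl 0 M"
proof
  assume M: "M \<in> big_cell" "incl 0 M"
  moreover have "E 1 \<in> Lam (int n)" using n_pos by simp
  ultimately have "E 1 \<in> M 0" using incl_lower[OF M(2), of 0] by auto
  then have "E 1 = 0\<^sub>v n" using big_cell_zero[OF M(1), of 0 "E 1"] by (auto simp: cf_E)
  then show False using cf_E[of 1 1] by simp
qed

lemma flags_lvl_incl: "M \<in> flags_lvl n N d \<Longrightarrow> incl N M"
  by (simp add: flags_lvl_def incl_def lattice_eq_Lam)

text \<open>
  The canonical frame exists as soon as the lattice bounds hold, and its size is the only possible one.
\<close>

lemma flags_lvl_iff:
  assumes "M \<in> big_cell"
  shows "M \<in> flags_lvl n N d \<longleftrightarrow> N \<ge> 1 \<and> d = dim0 N \<and> incl N M"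
proof
  assume L: "M \<in> flags_lvl n N d"
  have N: "N \<ge> 1" using not_incl_0[OF assms] flags_lvl_incl[OF L] by (cases N) auto
  obtain fr where "is_frame n N d M fr" using L by (auto simp: flags_lvl_def)
  then have "d = dim0 N"
    using frame_dim_unique canframe_is_frame[OF assms flags_lvl_incl[OF L] N] big_cell_flags[OF assms]
    by (metis order_antisym)
  then show "N \<ge> 1 \<and> d = dim0 N \<and> incl N M" using N flags_lvl_incl[OF L] by simp
next
  assume "N \<ge> 1 \<and> d = dim0 N \<and> incl N M"
  then show "M \<in> flags_lvl n N d"
    using canframe_is_frame[OF assms] big_cell_flags[OF assms]
    by (auto simp: flags_lvl_def incl_def lattice_eq_Lam)
qed

lemma incl_mono: "incl N M \<Longrightarrow> N \<le> N' \<Longrightarrow> incl N' M"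
proof -
  assume M: "incl N M" "N \<le> N'"
  then have "int n * int N \<le> int n * int N'" by (intro mult_left_mono) auto
  then have "Lam (lo N') \<subseteq> Lam (lo N)"
    "Lam (hi N) \<subseteq> Lam (hi N')"
    by (auto intro!: Lam_mono)
  with M(1) show ?thesis unfolding incl_def by blast
qed

text \<open>
  The big cell is where the projections of \<open>M_i / z^N \<Lambda>^n\<close> to \<open>L_i / z^N \<Lambda>^n\<close> are bijective.
\<close>

lemma big_cell_iff_det:
  assumes M: "M \<in> flags n" "incl N M" and N: "N \<ge> 1" and fr: "is_frame n N (dim0 N) M fr"
  shows "M \<in> big_cell \<longleftrightarrow> (\<forall>i\<le>n. det (sqmat (dim0 N + i) (umat fr i)) \<noteq> 0)"
proof
  assume bc: "M \<in> big_cell"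
  show "\<forall>i\<le>n. det (sqmat (dim0 N + i) (umat fr i)) \<noteq> 0"
  proof (intro allI impI notI)
    fix i assume i: "i \<le> n" and 0: "det (sqmat (dim0 N + i) (umat fr i)) = 0"
    define m where "m = dim0 N + i"
    obtain c where c: "\<exists>b<m. c b \<noteq> 0" "\<forall>a<m. (\<Sum>b<m. umat fr i a b * c b) = 0"
      using 0 det_0_kernel[of m "umat fr i"] by (auto simp: m_def)
    have "vsum {..<m} c (fr i) \<in> Lam (lo N)"
    proof (rule big_cell_low[OF bc M(2) i])
      show "vsum {..<m} c (fr i) \<in> M i"
        using frame_in[OF fr i] by (intro csub_vsum csub_flag M i) (auto simp: m_def)
      fix k assume "lo N < k" "k \<le> int i"
      then have "nat (int i - k) < m" "k = int i - int (nat (int i - k))"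
        using int_dim0[OF N] by (auto simp: m_def)
      then show "cf k (vsum {..<m} c (fr i)) = 0"
        using c(2) unfolding cf_vsum umat_def by (metis (no_types, lifting) mult.commute sum.cong)
    qed
    then show False using frame_indep[OF fr M(1) i] c(1) by (auto simp: m_def)
  qed
next
  assume det: "\<forall>i\<le>n. det (sqmat (dim0 N + i) (umat fr i)) \<noteq> 0"
  show "M \<in> big_cell"
    unfolding big_cell_def
  proof (intro CollectI conjI allI impI M(1))
    fix i and l :: int assume i: "i \<le> n" and l: "l \<le> int i"
    define m where "m = dim0 N + i"
    define e where "e = lo N"
    have csubM: "csub (M i)" using csub_flag[OF M(1) i] .
    have d: "det (sqmat m (umat fr i)) \<noteq> 0" using det i by (simp add: m_def)
    have low: "Lam e \<subseteq> M i" using M(2) i by (simp add: incl_def e_def)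
    have uniq: "u = 0\<^sub>v n" if u: "u \<in> M i" "\<And>k. k \<le> int i \<Longrightarrow> cf k u = 0" for u
    proof -
      obtain c where c: "u - vsum {..<m} c (fr i) \<in> Lam e"
        using frame_span[OF fr i u(1)] by (auto simp: m_def e_def)
      have uc: "u \<in> carrier_vec n" using csub_carrier[OF csubM u(1)] .
      have "(\<Sum>b<m. umat fr i a b * c b) = 0" if "a < m" for a
      proof -
        have "int i - int a > e" using that int_dim0[OF N] by (simp add: m_def e_def)
        then have "cf (int i - int a) (u - vsum {..<m} c (fr i)) = 0" using c by (simp add: Lam_def)
        then show ?thesis using u(2) uc by (simp add: cf_diff cf_vsum umat_def mult.commute)
      qed
      then have "c b = 0" if "b < m" for b using det_0_kernel[of m "umat fr i"] d that by auto
      then have "vsum {..<m} c (fr i) = 0\<^sub>v n" by (intro cf_eqI) (auto simp: cf_vsum)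
      then have "u \<in> Lam e" using c uc by simp
      moreover have "e \<le> int i" using lo_nonpos[OF N] by (simp add: e_def)
      ultimately have "cf k u = 0" for k using u(2)[of k] by (cases "k \<le> e") (auto simp: Lam_def)
      then show ?thesis using uc by (intro cf_eqI) auto
    qed
    have ex: "\<exists>v. v \<in> M i \<and> (\<forall>k\<le>int i. cf k v = (if k = l then 1 else 0))"
    proof (cases "l \<le> e")
      case True
      then have "E l \<in> M i" using low by auto
      then show ?thesis by (intro exI[of _ "E l"]) (simp add: cf_E)
    next
      case False
      define a where "a = nat (int i - l)"
      have a: "a < m" "l = int i - int a" using False l int_dim0[OF N] by (auto simp: a_def m_def e_def)
      obtain c where vk: "\<And>a'. a' < m \<Longrightarrow> cf (int i - int a') (vsum {..<m} c (fr i)) = (if a' = a then 1 else 0)"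
        using interpolate[OF d, where y = "\<lambda>a'. if a' = a then 1 else 0"] by blast
      define v where "v = vsum {..<m} c (fr i)"
      have vM: "v \<in> M i" unfolding v_def using frame_in[OF fr i] by (intro csub_vsum csubM) (auto simp: m_def)
      have vc: "v \<in> carrier_vec n" by (simp add: v_def)
      obtain K where K: "v \<in> Lam K" using bounded_in_Lam[OF vc] by blast
      \<comment> \<open>the tail of \<open>v\<close> below the level is removed, since the point of the graph has no coefficients
        there\<close>
      define t where "t = vsum {e<..K} (\<lambda>l. cf l v) E"
      have "v - t \<in> Lam e" unfolding t_def by (rule truncate_in_Lam[OF K])
      then have "v - t \<in> M i" using low by blast
      then have "v - (v - t) \<in> M i" by (rule csub_diff[OF csubM vM])
      moreover have "v - (v - t) = t" using vc by (intro cf_eqI) (auto simp: cf_diff t_def)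
      ultimately have "t \<in> M i" by simp
      moreover have "cf k t = (if k = l then 1 else 0)" if "k \<le> int i" for k
      proof (cases "k > e")
        case True
        have "cf k t = cf k v"
          using \<open>v - t \<in> Lam e\<close> True vc by (auto simp: Lam_def cf_diff t_def)
        moreover have "nat (int i - k) < m" "k = int i - int (nat (int i - k))"
          using True that int_dim0[OF N] by (auto simp: m_def e_def)
        moreover have "nat (int i - k) = a \<longleftrightarrow> k = l" using that l by (auto simp: a_def)
        ultimately show ?thesis using vk[of "nat (int i - k)"] by (metis v_def)
      next
        case False
        then have "cf k t = 0" unfolding t_def cf_vsum by (intro sum.neutral) (auto simp: cf_E)
        then show ?thesis using False \<open>\<not> l \<le> e\<close> by auto
      qed
      ultimately show ?thesis by blast
    qed
    show "\<exists>!v. v \<in> M i \<and> (\<forall>k\<le>int i. cf k v = (if k = l then 1 else 0))"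
    proof (rule ex_ex1I[OF ex])
      fix u v assume u: "u \<in> M i \<and> (\<forall>k\<le>int i. cf k u = (if k = l then 1 else 0))"
        and v: "v \<in> M i \<and> (\<forall>k\<le>int i. cf k v = (if k = l then 1 else 0))"
      then have c: "u \<in> carrier_vec n" "v \<in> carrier_vec n" using csub_carrier[OF csubM] by auto
      have "u - v = 0\<^sub>v n" using u v c by (intro uniq csub_diff csubM) (auto simp: cf_diff)
      then have "cf l u = cf l v" for l using c by (metis cf_diff cf_zero right_minus_eq)
      then show "u = v" using c by (intro cf_eqI) auto
    qed
  qed
qed

section \<open>Coordinates as rational functions of frames\<close>

lemma frame_polyI:
  assumes "i \<le> n" "b < d + i" "lo N < k" "k \<le> hi N"
  shows "(\<lambda>fr. cf k (fr i b)) \<in> frame_poly n N d"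
proof -
  have "zord k < int N" using assms by (simp add: zord_less_iff)
  moreover have "- int N \<le> zord k"
    using zord_less_iff[of k "- int N"] assms by simp
  ultimately show ?thesis
    using assms unfolding frame_poly_def cf_def by (intro fun_algebra.gen) (use idx_less in blast)
qed

definition udet :: "nat \<Rightarrow> frame \<Rightarrow> complex" where
  "udet N fr = (\<Prod>i\<le>n. det (sqmat (dim0 N + i) (umat fr i)))"

lemma umat_frame_poly:
  assumes "N \<ge> 1" "i \<le> n" "a < dim0 N + i" "b < dim0 N + i"
  shows "(\<lambda>fr. umat fr i a b) \<in> frame_poly n N (dim0 N)"
  unfolding umat_def using assms int_dim0[OF assms(1)] by (intro frame_polyI) auto

lemma det_frame_poly:
  assumes "N \<ge> 1" "i \<le> n"
  shows "(\<lambda>fr. det (sqmat (dim0 N + i) (umat fr i))) \<in> frame_poly n N (dim0 N)"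
  using umat_frame_poly[OF assms] unfolding frame_poly_def by (rule fun_algebra_det)

lemma udet_frame_poly: "N \<ge> 1 \<Longrightarrow> udet N \<in> frame_poly n N (dim0 N)"
  using det_frame_poly[of N] unfolding udet_def frame_poly_def
  by (intro fun_algebra_prod[of "{..n}" "\<lambda>i fr. det (sqmat (dim0 N + i) (umat fr i))", unfolded]) auto

lemma udet_nonzero_iff:
  assumes "M \<in> flags n" "incl N M" "N \<ge> 1" "is_frame n N (dim0 N) M fr"
  shows "udet N fr \<noteq> 0 \<longleftrightarrow> M \<in> big_cell"
  using big_cell_iff_det[OF assms] by (auto simp: udet_def)

text \<open>
  The numerator in Cramer's rule for the coordinate at \<open>k\<close> of the point of \<open>M_i\<close> above
  \<open>E (i - a)\<close>, with \<open>udet\<close> as the denominator.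
\<close>

definition coordnum :: "nat \<Rightarrow> nat \<Rightarrow> int \<Rightarrow> nat \<Rightarrow> frame \<Rightarrow> complex" where
  "coordnum N i k a fr = (\<Sum>b<dim0 N + i. adj (dim0 N + i) (umat fr i) b a * cf k (fr i b)) *
      (\<Prod>i'\<in>{..n} - {i}. det (sqmat (dim0 N + i') (umat fr i')))"

lemma coordnum_frame_poly:
  assumes "N \<ge> 1" "i \<le> n" "a < dim0 N + i" "lo N < k" "k \<le> hi N"
  shows "coordnum N i k a \<in> frame_poly n N (dim0 N)"
proof -
  have "(\<lambda>fr. adj (dim0 N + i) (umat fr i) b a * cf k (fr i b)) \<in> frame_poly n N (dim0 N)"
    if "b < dim0 N + i" for b
    unfolding frame_poly_def
  proof (rule fun_algebra.mult)
    show "(\<lambda>fr. adj (dim0 N + i) (umat fr i) b a) \<in> fun_algebra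
     {\<lambda>fr. fls_nth (laurent (fr i k $ j)) m | i k j m.
        i \<le> n \<and> k < dim0 N + i \<and> j < n \<and> - int N \<le> m \<and> m < int N}"
      using umat_frame_poly[OF assms(1,2)] assms(3) that unfolding frame_poly_def
      by (intro fun_algebra_adj) auto
  qed (use frame_polyI[OF assms(2) that assms(4,5)] in \<open>simp add: frame_poly_def\<close>)
  then have "(\<lambda>fr. \<Sum>b<dim0 N + i. adj (dim0 N + i) (umat fr i) b a * cf k (fr i b)) \<in> frame_poly n N (dim0 N)"
    unfolding frame_poly_def by (intro fun_algebra_sum) auto
  moreover have "(\<lambda>fr. \<Prod>i'\<in>{..n} - {i}. det (sqmat (dim0 N + i') (umat fr i'))) \<in> frame_poly n N (dim0 N)"
    using det_frame_poly[OF assms(1)] unfolding frame_poly_def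
    by (intro fun_algebra_prod[of _ "\<lambda>i' fr. det (sqmat (dim0 N + i') (umat fr i'))"]) auto
  ultimately show ?thesis
    unfolding coordnum_def[abs_def] frame_poly_def by (rule fun_algebra.mult)
qed

lemma coordnum:
  assumes M: "M \<in> big_cell" "incl N M" and N: "N \<ge> 1" and fr: "is_frame n N (dim0 N) M fr"
    and i: "i \<le> n" and a: "a < dim0 N + i" and k: "k > lo N"
  shows "cf k (canv M i (int i - int a)) * udet N fr = coordnum N i k a fr"
proof -
  define m where "m = dim0 N + i"
  define D where "D = det (sqmat m (umat fr i))"
  have fl: "M \<in> flags n" using M(1) by (rule big_cell_flags)
  have D: "D \<noteq> 0" using big_cell_iff_det[OF fl M(2) N fr] M(1) i by (simp add: D_def m_def)
  have csubM: "csub (M i)" using csub_flag[OF fl i] .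
  define v where "v = vsum {..<m} (\<lambda>b. adj m (umat fr i) b a / D) (fr i)"
  define w where "w = canv M i (int i - int a)"
  have w: "w \<in> M i" "\<And>k. k \<le> int i \<Longrightarrow> cf k w = (if k = int i - int a then 1 else 0)"
    using canv[OF M(1) i, of "int i - int a"] by (auto simp: w_def)
  have vM: "v \<in> M i" unfolding v_def using frame_in[OF fr i] by (intro csub_vsum csubM) (auto simp: m_def)
  have c: "v \<in> carrier_vec n" "w \<in> carrier_vec n" using vM w csub_carrier[OF csubM] by auto
  have cfv: "cf k v = (\<Sum>b<m. adj m (umat fr i) b a * cf k (fr i b)) / D" for k
    by (simp add: v_def cf_vsum sum_divide_distrib)
  have "v - w \<in> Lam (lo N)"
  proof (rule big_cell_low[OF M i])
    show "v - w \<in> M i" using csub_diff[OF csubM vM w(1)] .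
    fix k assume "lo N < k" "k \<le> int i"
    then have a': "nat (int i - k) < m" "k = int i - int (nat (int i - k))"
      using int_dim0[OF N] by (auto simp: m_def)
    define a' where "a' = nat (int i - k)"
    have "cf k v = (\<Sum>b<m. umat fr i a' b * adj m (umat fr i) b a) / D"
      unfolding cfv umat_def using a' by (simp add: a'_def mult.commute)
    also have "\<dots> = (if a' = a then 1 else 0)"
      using a a' D by (simp add: mult_adj m_def a'_def D_def)
    also have "\<dots> = cf k w" using w(2)[OF \<open>k \<le> int i\<close>] \<open>k \<le> int i\<close> by (auto simp: a'_def)
    finally show "cf k (v - w) = 0" using c by (simp add: cf_diff)
  qed
  then have "cf k v = cf k w" using k c by (auto simp: Lam_def cf_diff)
  then have eq: "cf k w * D = (\<Sum>b<m. adj m (umat fr i) b a * cf k (fr i b))"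
    using cfv[of k] D by (simp add: field_simps)
  have "udet N fr = D * (\<Prod>i'\<in>{..n} - {i}. det (sqmat (dim0 N + i') (umat fr i')))"
    unfolding udet_def D_def m_def using i by (subst prod.remove[of _ i]) auto
  then have "cf k w * udet N fr = (cf k w * D) * (\<Prod>i'\<in>{..n} - {i}. det (sqmat (dim0 N + i') (umat fr i')))"
    by simp
  then show ?thesis unfolding eq by (simp add: w_def coordnum_def m_def)
qed

lemma canv_low:
  assumes "M \<in> big_cell" "incl N M" "i \<le> n" "l \<le> lo N" "N \<ge> 1"
  shows "canv M i l = E l"
proof -
  have "E l \<in> M i" by (rule subsetD[OF incl_lower[OF assms(2,3)]]) (simp add: assms(4))
  moreover have "l \<le> int i" using assms(4) lo_nonpos[OF assms(5)] by simp
  ultimately show ?thesis by (intro canv_eqI assms) (auto simp: cf_E)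
qed

text \<open>
  By Cramer's rule for the coordinates with indices inside the level; the other coordinates are
  constant on flags of that level.
\<close>

lemma coord_algebra_level:
  assumes F: "F \<in> coord_algebra" and N: "N \<ge> 1"
  shows "\<exists>f\<in>frame_poly n N (dim0 N). \<exists>e. \<forall>M fr. M \<in> big_cell \<longrightarrow> incl N M \<longrightarrow>
    is_frame n N (dim0 N) M fr \<longrightarrow> F M * udet N fr ^ e = f fr"
  using F unfolding coord_algebra_def
proof (induction F rule: fun_algebra.induct)
  case (const c)
  show ?case
    by (intro bexI[of _ "\<lambda>_. c"] exI[of _ 0]) (auto simp: frame_poly_def fun_algebra.const)
next
  case (gen F)
  then obtain i k l where ikl: "F = (\<lambda>M. cf k (canv M i l))" "i \<le> n" "l \<le> int i" by blast
  have triv: ?case if "\<And>M. M \<in> big_cell \<Longrightarrow> incl N M \<Longrightarrow> F M = c" for c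
    using that by (intro bexI[of _ "\<lambda>_. c"] exI[of _ 0]) (auto simp: frame_poly_def fun_algebra.const)
  \<comment> \<open>only in the last case the coordinate is not constant\<close>
  consider "k \<le> int i" | "k > hi N" | "l \<le> lo N"
    | "k > int i" "k \<le> hi N" "l > lo N" by linarith
  then show ?case
  proof cases
    case 1
    then show ?thesis using ikl canv(2) by (intro triv[of "if k = l then 1 else 0"]) auto
  next
    case 2
    have "F M = 0" if "M \<in> big_cell" "incl N M" for M
      using canv(1)[OF that(1) ikl(2,3)] that(2) ikl 2 by (auto simp: incl_def Lam_def)
    then show ?thesis by (rule triv)
  next
    case 3
    then show ?thesis using ikl canv_low N by (intro triv[of "if k = l then 1 else 0"]) (auto simp: cf_E)
  next
    case 4
    define a where "a = nat (int i - l)"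
    have a: "a < dim0 N + i" "l = int i - int a" using 4 ikl int_dim0[OF N] by (auto simp: a_def)
    have k: "k > lo N" using 4 ikl by linarith
    have "F M * udet N fr ^ 1 = coordnum N i k a fr"
      if "M \<in> big_cell" "incl N M" "is_frame n N (dim0 N) M fr" for M fr
      using coordnum[OF that(1,2) N that(3) ikl(2) a(1) k] ikl a by simp
    then show ?thesis
      using coordnum_frame_poly[OF N ikl(2) a(1) k 4(2)] by blast
  qed
next
  case (add F G)
  then obtain f e g e' where *: "f \<in> frame_poly n N (dim0 N)" "g \<in> frame_poly n N (dim0 N)"
    "\<And>M fr. M \<in> big_cell \<Longrightarrow> incl N M \<Longrightarrow> is_frame n N (dim0 N) M fr \<Longrightarrow> F M * udet N fr ^ e = f fr"
    "\<And>M fr. M \<in> big_cell \<Longrightarrow> incl N M \<Longrightarrow> is_frame n N (dim0 N) M fr \<Longrightarrow> G M * udet N fr ^ e' = g fr"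
    by blast
  show ?case
  proof (intro bexI[of _ "\<lambda>fr. f fr * udet N fr ^ e' + g fr * udet N fr ^ e"] exI[of _ "e + e'"] allI impI)
    fix M fr assume "M \<in> big_cell" "incl N M" "is_frame n N (dim0 N) M fr"
    note ** = *(3)[OF this] *(4)[OF this]
    show "(F M + G M) * udet N fr ^ (e + e') = f fr * udet N fr ^ e' + g fr * udet N fr ^ e"
      unfolding **[symmetric] by (simp add: power_add algebra_simps)
  next
    show "(\<lambda>fr. f fr * udet N fr ^ e' + g fr * udet N fr ^ e) \<in> frame_poly n N (dim0 N)"
      using * udet_frame_poly[OF N] unfolding frame_poly_def
      by (intro fun_algebra.add fun_algebra.mult fun_algebra_power) 
  qed
next
  case (mult F G)
  then obtain f e g e' where *: "f \<in> frame_poly n N (dim0 N)" "g \<in> frame_poly n N (dim0 N)"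
    "\<And>M fr. M \<in> big_cell \<Longrightarrow> incl N M \<Longrightarrow> is_frame n N (dim0 N) M fr \<Longrightarrow> F M * udet N fr ^ e = f fr"
    "\<And>M fr. M \<in> big_cell \<Longrightarrow> incl N M \<Longrightarrow> is_frame n N (dim0 N) M fr \<Longrightarrow> G M * udet N fr ^ e' = g fr"
    by blast
  show ?case
  proof (intro bexI[of _ "\<lambda>fr. f fr * g fr"] exI[of _ "e + e'"] allI impI)
    fix M fr assume "M \<in> big_cell" "incl N M" "is_frame n N (dim0 N) M fr"
    note ** = *(3)[OF this] *(4)[OF this]
    show "F M * G M * udet N fr ^ (e + e') = f fr * g fr"
      unfolding **[symmetric] by (simp add: power_add algebra_simps)
  next
    show "(\<lambda>fr. f fr * g fr) \<in> frame_poly n N (dim0 N)"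
      using * unfolding frame_poly_def by (intro fun_algebra.mult)
  qed
qed

text \<open>
  At level \<open>N\<close> the set is cut out by the numerator of \<open>F\<close> times \<open>udet\<close>, which vanishes exactly outside
  the big cell.
\<close>

lemma coord_algebra_zclosed:
  assumes F: "F \<in> coord_algebra"
  shows "zclosed n {M \<in> flags n. M \<in> big_cell \<longrightarrow> F M = 0}"
  unfolding zclosed_def
proof (intro conjI allI)
  fix N d
  show "\<exists>P\<subseteq>frame_poly n N d. \<forall>M\<in>flags_lvl n N d. (M \<in> {M \<in> flags n. M \<in> big_cell \<longrightarrow> F M = 0}) =
    (\<forall>f\<in>P. \<forall>fr. is_frame n N d M fr \<longrightarrow> f fr = 0)"
  proof (cases "N \<ge> 1 \<and> d = dim0 N")
    case False
    then show ?thesis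
      by (intro exI[of _ "{}"]) (auto simp: flags_lvl_iff, auto simp: flags_lvl_def)
  next
    case True
    then have N: "N \<ge> 1" and d: "d = dim0 N" by auto
    obtain f e where f: "f \<in> frame_poly n N (dim0 N)" and
      fe: "\<And>M fr. M \<in> big_cell \<Longrightarrow> incl N M \<Longrightarrow> is_frame n N (dim0 N) M fr \<Longrightarrow> F M * udet N fr ^ e = f fr"
      using coord_algebra_level[OF F N] by blast
    show ?thesis
    proof (intro exI[of _ "{\<lambda>fr. udet N fr * f fr}"] conjI ballI)
      show "{\<lambda>fr. udet N fr * f fr} \<subseteq> frame_poly n N d"
        using f udet_frame_poly[OF N] unfolding frame_poly_def d by (auto intro: fun_algebra.mult)
      fix M assume M: "M \<in> flags_lvl n N d"
      then have fl: "M \<in> flags n" and inc: "incl N M" and ex: "\<exists>fr. is_frame n N d M fr"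
        using flags_lvl_incl by (auto simp: flags_lvl_def)
      have nz: "udet N fr \<noteq> 0 \<longleftrightarrow> M \<in> big_cell" if "is_frame n N d M fr" for fr
        using udet_nonzero_iff[OF fl inc N] that by (simp add: d)
      show "(M \<in> {M \<in> flags n. M \<in> big_cell \<longrightarrow> F M = 0}) =
          (\<forall>f\<in>{\<lambda>fr. udet N fr * f fr}. \<forall>fr. is_frame n N d M fr \<longrightarrow> f fr = 0)"
      proof (cases "M \<in> big_cell")
        case bc: True
        have "F M = 0 \<longleftrightarrow> f fr = 0" if "is_frame n N d M fr" for fr
          using fe[OF bc inc] that nz[OF that] bc by (auto simp: d simp flip: fe[OF bc inc])
        then show ?thesis using bc fl ex nz by auto
      next
        case bc: False
        then show ?thesis using fl nz by auto
      qed
    qed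
  qed
qed auto

text \<open>
  Some frame polynomial \<open>f\<close> vanishes on all frames of members of \<open>Z\<close> but not on a certain frame of
  \<open>M0\<close>. Expressing this frame by the canonical one and applying the same change of basis to the
  canonical frame of a variable flag makes \<open>f\<close> a polynomial in the coordinates.
\<close>

lemma zclosed_separate:
  assumes Z: "zclosed n Z" and M0: "M0 \<in> big_cell" "M0 \<notin> Z" "incl N M0" and N: "N \<ge> 1"
  shows "\<exists>G\<in>coord_algebra. G M0 \<noteq> 0 \<and> (\<forall>M\<in>big_cell. incl N M \<longrightarrow> G M \<noteq> 0 \<longrightarrow> M \<notin> Z)"
proof -
  obtain P where P: "P \<subseteq> frame_poly n N (dim0 N)" and
    Piff: "\<And>M. M \<in> flags_lvl n N (dim0 N) \<Longrightarrow> M \<in> Z \<longleftrightarrow> (\<forall>f\<in>P. \<forall>fr. is_frame n N (dim0 N) M fr \<longrightarrow> f fr = 0)"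
  proof -
    have "\<exists>P\<subseteq>frame_poly n N (dim0 N). \<forall>M\<in>flags_lvl n N (dim0 N).
        (M \<in> Z) = (\<forall>f\<in>P. \<forall>fr. is_frame n N (dim0 N) M fr \<longrightarrow> f fr = 0)"
      using Z unfolding zclosed_def by simp
    then show ?thesis using that by auto
  qed
  have "M0 \<in> flags_lvl n N (dim0 N)" using M0 N by (simp add: flags_lvl_iff)
  then obtain f fr where f: "f \<in> P" and fr: "is_frame n N (dim0 N) M0 fr" and nz: "f fr \<noteq> 0"
    using Piff M0(2) by blast
  define T where "T M i b = vsum {..<dim0 N + i} (\<lambda>a. umat fr i a b) (\<lambda>a. canv M i (int i - int a))"
    for M i b
  have T_in: "T M i b \<in> M i" if "M \<in> big_cell" "i \<le> n" for M i b
    unfolding T_def using canv(1)[OF that] csub_flag[OF big_cell_flags[OF that(1)] that(2)]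
    by (intro csub_vsum) auto
  have umT: "umat (T M) i a b = umat fr i a b"
    if "M \<in> big_cell" "i \<le> n" "a < dim0 N + i" for M i a b
  proof -
    have "umat (T M) i a b = (\<Sum>k<dim0 N + i. if k = a then umat fr i a b else 0)"
      unfolding umat_def[of "T M"] T_def cf_vsum
      by (intro sum.cong) (auto simp: canv(2)[OF that(1,2)])
    then show ?thesis using that(3) by simp
  qed
  have T_frame: "is_frame n N (dim0 N) M (T M)" if M: "M \<in> big_cell" "incl N M" for M
  proof (rule frame_if_det[OF M N])
    fix i assume i: "i \<le> n"
    have "sqmat (dim0 N + i) (umat (T M) i) = sqmat (dim0 N + i) (umat fr i)"
      by (rule eq_matI) (auto simp: umT[OF M(1) i])
    then show "det (sqmat (dim0 N + i) (umat (T M) i)) \<noteq> 0"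
      using big_cell_iff_det[OF big_cell_flags[OF M0(1)] M0(3) N fr] M0(1) i by simp
  qed (use T_in M in blast)
  have fP: "f \<in> frame_poly n N (dim0 N)" using f P by blast
  have alg: "(\<lambda>M. h (T M)) \<in> coord_algebra" if "h \<in> frame_poly n N (dim0 N)" for h
    using that unfolding frame_poly_def coord_algebra_def
  proof (induction h rule: fun_algebra.induct)
    case (gen h)
    then obtain i k j m where h: "h = (\<lambda>fr. fls_nth (laurent (fr i k $ j)) m)" "i \<le> n" "j < n" by blast
    have "(\<lambda>M. h (T M)) = (\<lambda>M. \<Sum>a<dim0 N + i. umat fr i a k * cf (int j + 1 - int n * m) (canv M i (int i - int a)))"
      using h by (simp add: cf_coeff T_def cf_vsum)
    also have "\<dots> \<in> fun_algebra {\<lambda>M. cf k (canv M i l) |i k l. i \<le> n \<and> l \<le> int i}"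
      using h(2) by (intro fun_algebra_sum fun_algebra_cmult fun_algebra.gen) force
    finally show ?case .
  qed (auto intro: fun_algebra.const fun_algebra.add fun_algebra.mult)
  \<comment> \<open>\<open>T M0\<close> and \<open>fr\<close> may differ by elements of \<open>z^N \<Lambda>^n\<close>, which frame polynomials do not see\<close>
  have same: "h (T M0) = h fr" if "h \<in> frame_poly n N (dim0 N)" for h
    using that unfolding frame_poly_def
  proof (induction h rule: fun_algebra.induct)
    case (gen h)
    then obtain i k j m where h: "h = (\<lambda>fr. fls_nth (laurent (fr i k $ j)) m)" "i \<le> n" "j < n"
      "k < dim0 N + i" "m < int N" by blast
    define l where "l = int j + 1 - int n * m"
    have c: "T M0 i k \<in> carrier_vec n" "fr i k \<in> carrier_vec n"
      using T_in[OF M0(1) h(2)] frame_in[OF fr h(2,4)] csub_carrier[OF csub_flag[OF big_cell_flags[OF M0(1)] h(2)]]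
      by auto
    have "T M0 i k - fr i k \<in> Lam (lo N)"
    proof (rule big_cell_low[OF M0(1,3) h(2)])
      show "T M0 i k - fr i k \<in> M0 i"
        using T_in[OF M0(1) h(2)] frame_in[OF fr h(2,4)]
        by (intro csub_diff csub_flag big_cell_flags M0 h)
      fix q assume q: "lo N < q" "q \<le> int i"
      then have "nat (int i - q) < dim0 N + i" "q = int i - int (nat (int i - q))"
        using int_dim0[OF N] by auto
      then have "cf q (T M0 i k) = cf q (fr i k)"
        using umT[OF M0(1) h(2), of "nat (int i - q)" k] unfolding umat_def by simp
      then show "cf q (T M0 i k - fr i k) = 0" using c by (simp add: cf_diff)
    qed
    moreover have "l > lo N"
      using zord_less_iff[of l "int N"] h by (simp add: l_def zord_eq)
    ultimately have "cf l (T M0 i k) = cf l (fr i k)" using c by (auto simp: Lam_def cf_diff)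
    then show ?case using h by (simp add: cf_coeff l_def)
  qed auto
  show ?thesis
  proof (intro bexI[of _ "\<lambda>M. f (T M)"] conjI ballI impI)
    show "f (T M0) \<noteq> 0" using same[OF fP] nz by simp
    show "(\<lambda>M. f (T M)) \<in> coord_algebra" using alg[OF fP] .
    fix M assume M: "M \<in> big_cell" "incl N M" "f (T M) \<noteq> 0"
    have "M \<in> flags_lvl n N (dim0 N)" using M N by (simp add: flags_lvl_iff)
    then show "M \<notin> Z" using Piff f T_frame[OF M(1,2)] M(3) by blast
  qed
qed

end

section \<open>The local ring\<close>

context loop_dim
begin

lemma base_pt_Lam: "i \<le> n \<Longrightarrow> base_pt n i = Lam (int i)"
  using Lam_carrier by (force simp: base_pt_def flag_of_Lam)

lemma base_pt_flags: "base_pt n \<in> flags n"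
  unfolding base_pt_def flags_def by (intro imageI loop_groupI[of _ "1\<^sub>m n"]) auto

lemma base_pt_big_cell: "base_pt n \<in> big_cell"
  unfolding big_cell_def
proof (intro CollectI conjI allI impI base_pt_flags)
  fix i and l :: int assume i: "i \<le> n" and l: "l \<le> int i"
  show "\<exists>!v. v \<in> base_pt n i \<and> (\<forall>k\<le>int i. cf k v = (if k = l then 1 else 0))"
  proof (rule ex1I[of _ "E l"])
    show "E l \<in> base_pt n i \<and> (\<forall>k\<le>int i. cf k (E l) = (if k = l then 1 else 0))"
      using i l by (simp add: base_pt_Lam cf_E)
    fix v assume v: "v \<in> base_pt n i \<and> (\<forall>k\<le>int i. cf k v = (if k = l then 1 else 0))"
    then have "v \<in> Lam (int i)" using i by (simp add: base_pt_Lam)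
    moreover from this have "cf k v = cf k (E l)" for k
      using v l by (cases "k \<le> int i") (auto simp: cf_E Lam_def)
    ultimately show "v = E l" using Lam_carrier by (intro cf_eqI) auto
  qed
qed

lemma canv_base_pt: "i \<le> n \<Longrightarrow> l \<le> int i \<Longrightarrow> canv (base_pt n) i l = E l"
  by (intro canv_eqI base_pt_big_cell) (auto simp: base_pt_Lam cf_E)

lemma incl_base_pt: "N \<ge> 1 \<Longrightarrow> incl N (base_pt n)"
  unfolding incl_def
proof (intro allI impI)
  fix i assume "N \<ge> 1" "i \<le> n"
  then show "Lam (lo N) \<subseteq> base_pt n i \<and> base_pt n i \<subseteq> Lam (hi N)"
    using lo_nonpos[of N] Lam_mono[of "lo N" "int i"] Lam_mono[of "int i" "hi N"]
    by (simp add: base_pt_Lam)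
qed

lemma coord_algebra_intros:
  "(\<lambda>_. c) \<in> coord_algebra"
  "i \<le> n \<Longrightarrow> l \<le> int i \<Longrightarrow> (\<lambda>M. cf k (canv M i l)) \<in> coord_algebra"
  "F \<in> coord_algebra \<Longrightarrow> G \<in> coord_algebra \<Longrightarrow> (\<lambda>M. F M + G M) \<in> coord_algebra"
  "F \<in> coord_algebra \<Longrightarrow> G \<in> coord_algebra \<Longrightarrow> (\<lambda>M. F M * G M) \<in> coord_algebra"
proof -
  show "(\<lambda>_. c) \<in> coord_algebra"
    unfolding coord_algebra_def by (rule fun_algebra.const)
  show "(\<lambda>M. cf k (canv M i l)) \<in> coord_algebra" if "i \<le> n" "l \<le> int i"
    unfolding coord_algebra_def using that
    by (intro fun_algebra.gen CollectI exI[of _ i] exI[of _ k] exI[of _ l]) simp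
  show "(\<lambda>M. F M + G M) \<in> coord_algebra" if "F \<in> coord_algebra" "G \<in> coord_algebra"
    using that unfolding coord_algebra_def by (rule fun_algebra.add)
  show "(\<lambda>M. F M * G M) \<in> coord_algebra" if "F \<in> coord_algebra" "G \<in> coord_algebra"
    using that unfolding coord_algebra_def by (rule fun_algebra.mult)
qed

lemma frame_poly_canframe:
  "h \<in> frame_poly n N d \<Longrightarrow> (\<lambda>M. h (canframe M)) \<in> coord_algebra"
  unfolding frame_poly_def
proof (induction h rule: fun_algebra.induct)
  case (gen h)
  then obtain i k j m where h: "h = (\<lambda>fr. fls_nth (laurent (fr i k $ j)) m)" "i \<le> n" "j < n" by blast
  then show ?case
    using coord_algebra_intros(2)[of i "int i - int k" "int j + 1 - int n * m"]
    by (simp add: cf_coeff canframe_def)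
qed (simp_all add: coord_algebra_intros(1,3,4))

end

text \<open>
  Any set of flags with bounded poles near the base point, such as a Schubert variety.
\<close>

locale germs = loop_dim +
  fixes X :: "flag set" and N0 :: nat
  assumes X_flags: "X \<subseteq> flags n" and base_in: "base_pt n \<in> X" and N0: "N0 \<ge> 1"
    and X_level: "\<And>M. M \<in> X \<Longrightarrow> M \<in> big_cell \<Longrightarrow> incl N0 M"
begin

text \<open>
  Holding on a neighbourhood of the base point in \<open>X\<close>. The neighbourhoods of the form \<open>G \<noteq> 0\<close> suffice
  by \<open>zclosed_separate\<close>, and products show that they are closed under intersection. For general closed
  sets a union is less evident, because their equations may be nonzero on different frames of a flag.
\<close>

definition near :: "(flag \<Rightarrow> bool) \<Rightarrow> bool" where
  "near P \<longleftrightarrow> (\<exists>G\<in>coord_algebra. G (base_pt n) \<noteq> 0 \<and> (\<forall>M\<in>X. M \<in> big_cell \<longrightarrow> G M \<noteq> 0 \<longrightarrow> P M))"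

lemma nearI:
  assumes "G \<in> coord_algebra" "G (base_pt n) \<noteq> 0" "\<And>M. M \<in> X \<Longrightarrow> M \<in> big_cell \<Longrightarrow> G M \<noteq> 0 \<Longrightarrow> P M"
  shows "near P"
  unfolding near_def using assms by (intro bexI[of _ G]) auto

lemma nearE:
  assumes "near P"
  obtains G where "G \<in> coord_algebra" "G (base_pt n) \<noteq> 0" "\<forall>M\<in>X. M \<in> big_cell \<longrightarrow> G M \<noteq> 0 \<longrightarrow> P M"
  using assms unfolding near_def by (elim bexE conjE) (rule that)

lemma near_base: "near P \<Longrightarrow> P (base_pt n)"
  using base_in base_pt_big_cell by (elim nearE) auto

lemma near_mono:
  assumes "near P" "\<And>M. M \<in> X \<Longrightarrow> M \<in> big_cell \<Longrightarrow> P M \<Longrightarrow> Q M"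
  shows "near Q"
proof -
  obtain G where "G \<in> coord_algebra" "G (base_pt n) \<noteq> 0" "\<forall>M\<in>X. M \<in> big_cell \<longrightarrow> G M \<noteq> 0 \<longrightarrow> P M"
    using nearE[OF assms(1)] .
  then show ?thesis using assms(2) by (intro nearI[of G]) simp_all
qed

lemma near_conj: "near P \<Longrightarrow> near Q \<Longrightarrow> near (\<lambda>M. P M \<and> Q M)"
proof -
  assume P: "near P" and Q: "near Q"
  obtain F where F: "F \<in> coord_algebra" "F (base_pt n) \<noteq> 0" "\<forall>M\<in>X. M \<in> big_cell \<longrightarrow> F M \<noteq> 0 \<longrightarrow> P M"
    using nearE[OF P] .
  obtain G where G: "G \<in> coord_algebra" "G (base_pt n) \<noteq> 0" "\<forall>M\<in>X. M \<in> big_cell \<longrightarrow> G M \<noteq> 0 \<longrightarrow> Q M"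
    using nearE[OF Q] .
  show ?thesis
    using F G by (intro nearI[of "\<lambda>M. F M * G M"] coord_algebra_intros(4)) simp_all
qed

lemma near_always: "(\<And>M. M \<in> X \<Longrightarrow> M \<in> big_cell \<Longrightarrow> P M) \<Longrightarrow> near P"
  by (intro nearI[of "\<lambda>_. 1"] coord_algebra_intros(1)) simp_all

lemma near_nonzero: "G \<in> coord_algebra \<Longrightarrow> G (base_pt n) \<noteq> 0 \<Longrightarrow> near (\<lambda>M. G M \<noteq> 0)"
  by (intro nearI[of G]) simp_all

lemma near_zclosed:
  assumes "zclosed n Z" "base_pt n \<notin> Z"
  shows "near (\<lambda>M. M \<notin> Z)"
proof -
  obtain G where "G \<in> coord_algebra" "G (base_pt n) \<noteq> 0" "\<forall>M\<in>big_cell. incl N0 M \<longrightarrow> G M \<noteq> 0 \<longrightarrow> M \<notin> Z"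
    using zclosed_separate[OF assms(1) base_pt_big_cell assms(2) incl_base_pt[OF N0] N0]
    by (elim bexE conjE)
  then show ?thesis using X_level by (intro nearI[of G]) simp_all
qed

lemma zclosed_near:
  assumes "near P"
  obtains Z where "zclosed n Z" "base_pt n \<notin> Z" "\<And>M. M \<in> X - Z \<Longrightarrow> M \<in> big_cell \<and> P M"
proof -
  obtain G where G: "G \<in> coord_algebra" "G (base_pt n) \<noteq> 0" "\<forall>M\<in>X. M \<in> big_cell \<longrightarrow> G M \<noteq> 0 \<longrightarrow> P M"
    using nearE[OF assms] .
  show ?thesis
  proof (rule that[OF coord_algebra_zclosed[OF G(1)]])
    show "base_pt n \<notin> {M \<in> flags n. M \<in> big_cell \<longrightarrow> G M = 0}"
      using G(2) base_pt_big_cell by simp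
    fix M assume "M \<in> X - {M \<in> flags n. M \<in> big_cell \<longrightarrow> G M = 0}"
    then show "M \<in> big_cell \<and> P M" using G(3) X_flags by auto
  qed
qed

abbreviation "Rg \<equiv> regular_funs n X"
abbreviation "LR \<equiv> local_ring n X"

lemma Rg_simps:
  "h \<otimes>\<^bsub>Rg\<^esub> k = (\<lambda>M. h M * k M)" "h \<oplus>\<^bsub>Rg\<^esub> k = (\<lambda>M. h M + k M)"
  "\<one>\<^bsub>Rg\<^esub> = (\<lambda>_. 1)" "\<zero>\<^bsub>Rg\<^esub> = (\<lambda>_. 0)"
  by (simp_all add: regular_funs_def)

lemma carrier_Rg: "h \<in> carrier Rg \<longleftrightarrow> (\<exists>N d Z f g. local_quotient n X N d Z f g h)"
  by (simp add: regular_funs_def)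

text \<open>
  A quotient of polynomials in the coordinates is regular, and can be written as a quotient of
  frame polynomials at each sufficiently high level. Tangent vectors with high poles need high levels.
\<close>

lemma local_quotientI:
  assumes F: "F \<in> coord_algebra" and G: "G \<in> coord_algebra" "G (base_pt n) \<noteq> 0"
    and h: "near (\<lambda>M. h M = F M / G M)" and N: "N \<ge> N0"
  shows "\<exists>Z f g. local_quotient n X N (dim0 N) Z f g h"
proof -
  have N1: "N \<ge> 1" using N N0 by simp
  obtain Z where Z: "zclosed n Z" "base_pt n \<notin> Z" "\<And>M. M \<in> X - Z \<Longrightarrow> M \<in> big_cell \<and> G M \<noteq> 0 \<and> h M = F M / G M"
    using zclosed_near[OF near_conj[OF near_nonzero[OF G] h]] by blast
  obtain f e where f: "f \<in> frame_poly n N (dim0 N)" and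
    fe: "\<And>M fr. M \<in> big_cell \<Longrightarrow> incl N M \<Longrightarrow> is_frame n N (dim0 N) M fr \<Longrightarrow> F M * udet N fr ^ e = f fr"
    using coord_algebra_level[OF F N1] by blast
  obtain g e' where g: "g \<in> frame_poly n N (dim0 N)" and
    ge: "\<And>M fr. M \<in> big_cell \<Longrightarrow> incl N M \<Longrightarrow> is_frame n N (dim0 N) M fr \<Longrightarrow> G M * udet N fr ^ e' = g fr"
    using coord_algebra_level[OF G(1) N1] by blast
  have "local_quotient n X N (dim0 N) Z (\<lambda>fr. f fr * udet N fr ^ e') (\<lambda>fr. g fr * udet N fr ^ e) h"
    unfolding local_quotient_def
  proof (intro conjI ballI allI impI Z)
    have inc: "incl N M" if "M \<in> X - Z" for M
      using that Z(3)[OF that] X_level incl_mono[OF _ N] by blast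
    show "X - Z \<subseteq> flags_lvl n N (dim0 N)" using Z(3) inc N1 flags_lvl_iff by auto
    show "(\<lambda>fr. f fr * udet N fr ^ e') \<in> frame_poly n N (dim0 N)"
      using f udet_frame_poly[OF N1] unfolding frame_poly_def by (intro fun_algebra.mult fun_algebra_power)
    show "(\<lambda>fr. g fr * udet N fr ^ e) \<in> frame_poly n N (dim0 N)"
      using g udet_frame_poly[OF N1] unfolding frame_poly_def by (intro fun_algebra.mult fun_algebra_power)
    fix M fr assume M: "M \<in> X - Z" and fr: "is_frame n N (dim0 N) M fr"
    note bc = conjunct1[OF Z(3)[OF M]]
    have u: "udet N fr \<noteq> 0" using udet_nonzero_iff[OF big_cell_flags[OF bc] inc[OF M] N1 fr] bc by simp
    show "g fr * udet N fr ^ e \<noteq> 0"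
      using u Z(3)[OF M] unfolding ge[OF bc inc[OF M] fr, symmetric] by simp
    show "h M = f fr * udet N fr ^ e' / (g fr * udet N fr ^ e)"
      using u Z(3)[OF M]
      unfolding ge[OF bc inc[OF M] fr, symmetric] fe[OF bc inc[OF M] fr, symmetric] by simp
  qed
  then show ?thesis by blast
qed

lemma local_quotient_level:
  assumes "local_quotient n X N d Z f g h"
  shows "N \<ge> 1" "d = dim0 N"
proof -
  have "base_pt n \<in> X - Z" "X - Z \<subseteq> flags_lvl n N d"
    using assms base_in by (simp_all add: local_quotient_def)
  then have "base_pt n \<in> flags_lvl n N d" by (rule subsetD[rotated])
  then show "N \<ge> 1" "d = dim0 N" using flags_lvl_iff[OF base_pt_big_cell] by simp_all
qed

lemma local_quotient_near:
  assumes "local_quotient n X N d Z f g h"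
  shows "near (\<lambda>M. M \<in> flags_lvl n N d \<and> (\<forall>fr. is_frame n N d M fr \<longrightarrow> g fr \<noteq> 0 \<and> h M = f fr / g fr))"
proof -
  have "zclosed n Z" "base_pt n \<notin> Z" using assms by (simp_all add: local_quotient_def)
  then have "near (\<lambda>M. M \<notin> Z)" by (rule near_zclosed)
  then show ?thesis
  proof (rule near_mono)
    fix M assume "M \<in> X" "M \<notin> Z"
    then have M: "M \<in> X - Z" by simp
    have "X - Z \<subseteq> flags_lvl n N d" and *: "\<forall>M\<in>X - Z. \<forall>fr. is_frame n N d M fr \<longrightarrow> g fr \<noteq> 0 \<and> h M = f fr / g fr"
      using assms by (simp_all add: local_quotient_def)
    from this(1) have "M \<in> flags_lvl n N d" using M by (rule subsetD)
    with bspec[OF * M] show "M \<in> flags_lvl n N d \<and> (\<forall>fr. is_frame n N d M fr \<longrightarrow> g fr \<noteq> 0 \<and> h M = f fr / g fr)"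
      by (rule conjI[rotated])
  qed
qed

text \<open>
  A quotient of frame polynomials does not depend on the frame, so it can be evaluated at the
  canonical frame, whose entries are coordinates. This gives a description of the regular functions
  that is independent of the level, from which their ring structure is clear.
\<close>

lemma regular_iff:
  "h \<in> carrier Rg \<longleftrightarrow> (\<exists>F\<in>coord_algebra. \<exists>G\<in>coord_algebra. G (base_pt n) \<noteq> 0 \<and> near (\<lambda>M. h M = F M / G M))"
proof
  assume "h \<in> carrier Rg"
  then obtain N d Z f g where lq: "local_quotient n X N d Z f g h"
    unfolding carrier_Rg by (elim exE) (rule that)
  note N = local_quotient_level[OF lq]
  have near: "near (\<lambda>M. g (canframe M) \<noteq> 0 \<and> h M = f (canframe M) / g (canframe M))"
  proof (rule near_mono[OF local_quotient_near[OF lq]])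
    fix M assume "M \<in> X" and bc: "M \<in> big_cell"
      and *: "M \<in> flags_lvl n N d \<and> (\<forall>fr. is_frame n N d M fr \<longrightarrow> g fr \<noteq> 0 \<and> h M = f fr / g fr)"
    have "is_frame n N d M (canframe M)"
      using canframe_is_frame[OF bc _ N(1)] * N flags_lvl_incl by auto
    then show "g (canframe M) \<noteq> 0 \<and> h M = f (canframe M) / g (canframe M)" using * by blast
  qed
  have "f \<in> frame_poly n N d" "g \<in> frame_poly n N d" using lq by (simp_all add: local_quotient_def)
  then show "\<exists>F\<in>coord_algebra. \<exists>G\<in>coord_algebra. G (base_pt n) \<noteq> 0 \<and> near (\<lambda>M. h M = F M / G M)"
  proof (intro bexI conjI)
    show "near (\<lambda>M. h M = f (canframe M) / g (canframe M))" by (rule near_mono[OF near]) simp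
    show "g (canframe (base_pt n)) \<noteq> 0" using near_base[OF near] by simp
  qed (auto intro: frame_poly_canframe)
next
  assume "\<exists>F\<in>coord_algebra. \<exists>G\<in>coord_algebra. G (base_pt n) \<noteq> 0 \<and> near (\<lambda>M. h M = F M / G M)"
  then show "h \<in> carrier Rg"
    using local_quotientI[of _ _ h N0] unfolding carrier_Rg by blast
qed

lemma regularE:
  assumes "h \<in> carrier Rg"
  obtains F G where "F \<in> coord_algebra" "G \<in> coord_algebra" "G (base_pt n) \<noteq> 0" "near (\<lambda>M. h M = F M / G M)"
  using assms unfolding regular_iff by (elim bexE conjE) (rule that)

lemma regularI:
  assumes "F \<in> coord_algebra" "G \<in> coord_algebra" "G (base_pt n) \<noteq> 0" "near (\<lambda>M. h M = F M / G M)"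
  shows "h \<in> carrier Rg"
  unfolding regular_iff by (rule bexI[OF _ assms(1)], rule bexI[OF _ assms(2)], rule conjI[OF assms(3,4)])

lemma coord_algebra_regular: "F \<in> coord_algebra \<Longrightarrow> F \<in> carrier Rg"
  by (rule regularI[of F "\<lambda>_. 1"]) (auto intro: coord_algebra_intros(1) near_always)

lemma regular_add:
  assumes "h \<in> carrier Rg" "k \<in> carrier Rg"
  shows "(\<lambda>M. h M + k M) \<in> carrier Rg"
proof -
  obtain F G where 1: "F \<in> coord_algebra" "G \<in> coord_algebra" "G (base_pt n) \<noteq> 0" "near (\<lambda>M. h M = F M / G M)"
    using regularE[OF assms(1)] .
  obtain F' G' where 2: "F' \<in> coord_algebra" "G' \<in> coord_algebra" "G' (base_pt n) \<noteq> 0" "near (\<lambda>M. k M = F' M / G' M)"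
    using regularE[OF assms(2)] .
  have "near (\<lambda>M. h M + k M = (F M * G' M + F' M * G M) / (G M * G' M))"
    by (rule near_mono[OF near_conj[OF near_conj[OF 1(4) 2(4)] near_conj[OF near_nonzero[OF 1(2,3)] near_nonzero[OF 2(2,3)]]]])
       (auto simp: field_simps)
  then show ?thesis
    by (rule regularI[rotated -1]) (use 1 2 in \<open>simp_all add: coord_algebra_intros(3,4)\<close>)
qed

lemma regular_mult:
  assumes "h \<in> carrier Rg" "k \<in> carrier Rg"
  shows "(\<lambda>M. h M * k M) \<in> carrier Rg"
proof -
  obtain F G where 1: "F \<in> coord_algebra" "G \<in> coord_algebra" "G (base_pt n) \<noteq> 0" "near (\<lambda>M. h M = F M / G M)"
    using regularE[OF assms(1)] .
  obtain F' G' where 2: "F' \<in> coord_algebra" "G' \<in> coord_algebra" "G' (base_pt n) \<noteq> 0" "near (\<lambda>M. k M = F' M / G' M)"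
    using regularE[OF assms(2)] .
  have "near (\<lambda>M. h M * k M = (F M * F' M) / (G M * G' M))"
    by (rule near_mono[OF near_conj[OF 1(4) 2(4)]]) auto
  then show ?thesis
    by (rule regularI[rotated -1]) (use 1 2 in \<open>simp_all add: coord_algebra_intros(4)\<close>)
qed

lemma regular_const: "(\<lambda>_. c) \<in> carrier Rg"
  by (intro coord_algebra_regular coord_algebra_intros)

lemma regular_near: "h \<in> carrier Rg \<Longrightarrow> near (\<lambda>M. k M = h M) \<Longrightarrow> k \<in> carrier Rg"
proof -
  assume "h \<in> carrier Rg" and n: "near (\<lambda>M. k M = h M)"
  then obtain F G where 1: "F \<in> coord_algebra" "G \<in> coord_algebra" "G (base_pt n) \<noteq> 0" "near (\<lambda>M. h M = F M / G M)"
    by (elim regularE)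
  have "near (\<lambda>M. k M = F M / G M)" by (rule near_mono[OF near_conj[OF n 1(4)]]) simp
  then show ?thesis by (rule regularI[OF 1(1-3)])
qed

lemma cring_Rg: "cring Rg"
proof (rule cringI)
  show "abelian_group Rg"
  proof (rule abelian_groupI)
    fix h assume "h \<in> carrier Rg"
    then have "(\<lambda>M. (-1) * h M) \<in> carrier Rg" by (intro regular_mult regular_const)
    then show "\<exists>k\<in>carrier Rg. k \<oplus>\<^bsub>Rg\<^esub> h = \<zero>\<^bsub>Rg\<^esub>" by (rule rev_bexI) (simp add: Rg_simps)
  qed (auto simp: Rg_simps regular_add regular_const algebra_simps)
  show "comm_monoid Rg"
    by (rule comm_monoidI) (auto simp: Rg_simps regular_mult regular_const algebra_simps)
qed (simp add: Rg_simps algebra_simps)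

lemma null_iff: "h \<in> null_funs n X \<longleftrightarrow> near (\<lambda>M. h M = 0)"
proof
  assume "h \<in> null_funs n X"
  then obtain Z where Z: "zclosed n Z" "base_pt n \<notin> Z" "\<forall>M\<in>X - Z. h M = 0" by (auto simp: null_funs_def)
  show "near (\<lambda>M. h M = 0)" by (rule near_mono[OF near_zclosed[OF Z(1,2)]]) (use Z in auto)
next
  assume n: "near (\<lambda>M. h M = 0)"
  then have "h \<in> carrier Rg" using regular_near[OF regular_const[of 0]] by simp
  moreover obtain Z where "zclosed n Z" "base_pt n \<notin> Z" "\<And>M. M \<in> X - Z \<Longrightarrow> M \<in> big_cell \<and> h M = 0"
    using zclosed_near[OF n] by blast
  ultimately show "h \<in> null_funs n X" unfolding null_funs_def by blast
qed

lemma null_regular: "h \<in> null_funs n X \<Longrightarrow> h \<in> carrier Rg"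
  by (simp add: null_funs_def)

lemma null_ideal: "ideal (null_funs n X) Rg"
proof -
  interpret Rg: cring Rg by (rule cring_Rg)
  show ?thesis
  proof (rule idealI)
    show "ring Rg" by (rule Rg.ring_axioms)
    show "subgroup (null_funs n X) (add_monoid Rg)"
    proof (rule group.subgroupI)
      show "group (add_monoid Rg)" by (rule Rg.a_group)
      show "null_funs n X \<subseteq> carrier (add_monoid Rg)" using null_regular by auto
      have "(\<lambda>_. 0) \<in> null_funs n X" unfolding null_iff by (rule near_always) simp
      then show "null_funs n X \<noteq> {}" by blast
    next
      fix h assume h: "h \<in> null_funs n X"
      have "(\<lambda>M. (-1) * h M) \<in> carrier Rg" using null_regular[OF h] by (intro regular_mult regular_const)
      then have "\<ominus>\<^bsub>Rg\<^esub> h = (\<lambda>M. (-1) * h M)"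
        using null_regular[OF h] by (intro Rg.minus_equality) (auto simp: Rg_simps)
      moreover have "(\<lambda>M. (-1) * h M) \<in> null_funs n X"
        using h unfolding null_iff by (elim near_mono) simp
      ultimately show "inv\<^bsub>add_monoid Rg\<^esub> h \<in> null_funs n X" by (simp add: a_inv_def)
    next
      fix h k assume "h \<in> null_funs n X" "k \<in> null_funs n X"
      then have "near (\<lambda>M. h M = 0 \<and> k M = 0)" unfolding null_iff by (rule near_conj)
      then have "near (\<lambda>M. h M + k M = 0)" by (rule near_mono) simp
      then show "h \<otimes>\<^bsub>add_monoid Rg\<^esub> k \<in> null_funs n X"
        by (simp add: null_iff Rg_simps)
    qed
  next
    fix h k assume "h \<in> null_funs n X"
    then have h: "near (\<lambda>M. h M = 0)" by (simp add: null_iff)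
    have "near (\<lambda>M. k M * h M = 0)" "near (\<lambda>M. h M * k M = 0)"
      by (rule near_mono[OF h], simp)+
    then show "k \<otimes>\<^bsub>Rg\<^esub> h \<in> null_funs n X" "h \<otimes>\<^bsub>Rg\<^esub> k \<in> null_funs n X"
      by (simp_all add: null_iff Rg_simps)
  qed
qed

text \<open>
  A germ consists of the functions that agree near the base point.
\<close>

lemma germ_eq: "h \<in> carrier Rg \<Longrightarrow> germ n X h = {k. near (\<lambda>M. k M = h M)}"
proof -
  assume h: "h \<in> carrier Rg"
  have "k \<in> germ n X h \<longleftrightarrow> near (\<lambda>M. k M = h M)" for k
  proof
    assume "k \<in> germ n X h"
    then obtain z where "z \<in> null_funs n X" "k = (\<lambda>M. z M + h M)"
      unfolding germ_def a_r_coset_def' by (auto simp: Rg_simps)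
    then show "near (\<lambda>M. k M = h M)" unfolding null_iff by (elim near_mono) simp
  next
    assume "near (\<lambda>M. k M = h M)"
    then have "(\<lambda>M. k M - h M) \<in> null_funs n X" unfolding null_iff by (elim near_mono) simp
    then show "k \<in> germ n X h"
      unfolding germ_def a_r_coset_def' by (intro UN_I) (auto simp: Rg_simps)
  qed
  then show ?thesis by blast
qed

lemma germ_self: "h \<in> carrier Rg \<Longrightarrow> h \<in> germ n X h"
  by (simp add: germ_eq near_always)

lemma germ_eq_iff:
  assumes "h \<in> carrier Rg" "k \<in> carrier Rg"
  shows "germ n X h = germ n X k \<longleftrightarrow> near (\<lambda>M. h M = k M)"
proof
  assume "germ n X h = germ n X k"
  then show "near (\<lambda>M. h M = k M)" using germ_self[OF assms(1)] germ_eq[OF assms(2)] by auto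
next
  assume hk: "near (\<lambda>M. h M = k M)"
  show "germ n X h = germ n X k"
    unfolding germ_eq[OF assms(1)] germ_eq[OF assms(2)]
  proof (rule Collect_cong, rule iffI)
    fix z assume "near (\<lambda>M. z M = h M)"
    from near_conj[OF hk this] show "near (\<lambda>M. z M = k M)" by (rule near_mono) simp
  next
    fix z assume "near (\<lambda>M. z M = k M)"
    from near_conj[OF hk this] show "near (\<lambda>M. z M = h M)" by (rule near_mono) simp
  qed
qed

lemma germ_mem: "h \<in> carrier Rg \<Longrightarrow> k \<in> germ n X h \<Longrightarrow> k \<in> carrier Rg \<and> germ n X k = germ n X h"
  using germ_eq regular_near germ_eq_iff by auto

lemma cring_LR: "cring LR"
  unfolding local_ring_def using ideal.quotient_is_cring[OF null_ideal cring_Rg] .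

lemma germ_hom: "germ n X \<in> Ring.ring_hom Rg LR"
  using ideal.rcos_ring_hom[OF null_ideal] unfolding local_ring_def germ_def[abs_def] .

lemma germ_closed: "h \<in> carrier Rg \<Longrightarrow> germ n X h \<in> carrier LR"
  using Ring.ring_hom_closed[OF germ_hom] .

lemma germ_add:
  "h \<in> carrier Rg \<Longrightarrow> k \<in> carrier Rg \<Longrightarrow> germ n X h \<oplus>\<^bsub>LR\<^esub> germ n X k = germ n X (\<lambda>M. h M + k M)"
  using Ring.ring_hom_add[OF germ_hom] by (simp add: Rg_simps)

lemma germ_mult:
  "h \<in> carrier Rg \<Longrightarrow> k \<in> carrier Rg \<Longrightarrow> germ n X h \<otimes>\<^bsub>LR\<^esub> germ n X k = germ n X (\<lambda>M. h M * k M)"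
  using Ring.ring_hom_mult[OF germ_hom] by (simp add: Rg_simps)

lemma germ_zero: "germ n X (\<lambda>_. 0) = \<zero>\<^bsub>LR\<^esub>"
  using Ring.ring_hom_zero[OF germ_hom] cring_Rg cring_LR by (simp add: Rg_simps cring_def)

lemma germ_surj: "a \<in> carrier LR \<Longrightarrow> \<exists>h\<in>carrier Rg. a = germ n X h"
  by (auto simp: local_ring_def FactRing_def A_RCOSETS_def' germ_def)

lemma max_ideal_iff: "h \<in> carrier Rg \<Longrightarrow> germ n X h \<in> max_ideal n X \<longleftrightarrow> h (base_pt n) = 0"
  unfolding max_ideal_def using germ_eq_iff near_base by fastforce

lemma max_ideal_carrier: "max_ideal n X \<subseteq> carrier LR"
  by (auto simp: max_ideal_def germ_closed)

lemma max_ideal_ideal: "ideal (max_ideal n X) LR"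
proof -
  interpret LR: cring LR by (rule cring_LR)
  show ?thesis
  proof (rule idealI)
    show "ring LR" by (rule LR.ring_axioms)
    show "subgroup (max_ideal n X) (add_monoid LR)"
    proof (rule group.subgroupI)
      show "group (add_monoid LR)" by (rule LR.a_group)
      show "max_ideal n X \<subseteq> carrier (add_monoid LR)" using max_ideal_carrier by simp
      show "max_ideal n X \<noteq> {}" using max_ideal_iff[OF regular_const[of 0]] by auto
    next
      fix a assume "a \<in> max_ideal n X"
      then obtain h where h: "h \<in> carrier Rg" "h (base_pt n) = 0" "a = germ n X h" by (auto simp: max_ideal_def)
      have r: "(\<lambda>M. (-1) * h M) \<in> carrier Rg" using h by (intro regular_mult regular_const)
      have "germ n X (\<lambda>M. (-1) * h M) \<oplus>\<^bsub>LR\<^esub> a = \<zero>\<^bsub>LR\<^esub>"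
        using h r by (simp add: germ_add germ_zero)
      then have "\<ominus>\<^bsub>LR\<^esub> a = germ n X (\<lambda>M. (-1) * h M)"
        using h r by (intro LR.minus_equality germ_closed) (auto intro: germ_closed)
      then show "inv\<^bsub>add_monoid LR\<^esub> a \<in> max_ideal n X"
        using max_ideal_iff[OF r] h by (simp add: a_inv_def)
    next
      fix a b assume "a \<in> max_ideal n X" "b \<in> max_ideal n X"
      then obtain h k where "h \<in> carrier Rg" "h (base_pt n) = 0" "a = germ n X h"
        "k \<in> carrier Rg" "k (base_pt n) = 0" "b = germ n X k" by (auto simp: max_ideal_def)
      then show "a \<otimes>\<^bsub>add_monoid LR\<^esub> b \<in> max_ideal n X"
        by (simp add: germ_add max_ideal_iff regular_add)
    qed
  next
    fix a x assume "a \<in> max_ideal n X" "x \<in> carrier LR"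
    then obtain h where *: "h \<in> carrier Rg" "h (base_pt n) = 0" "a = germ n X h" by (auto simp: max_ideal_def)
    obtain k where **: "k \<in> carrier Rg" "x = germ n X k" using germ_surj[OF \<open>x \<in> carrier LR\<close>] by blast
    from * ** show "x \<otimes>\<^bsub>LR\<^esub> a \<in> max_ideal n X" "a \<otimes>\<^bsub>LR\<^esub> x \<in> max_ideal n X"
      by (simp_all add: germ_mult max_ideal_iff regular_mult)
  qed
qed

section \<open>The associated graded ring\<close>

abbreviation mpow where "mpow \<equiv> max_ideal_pow n X"

lemma mpow_ideal: "ideal (mpow k) LR"
proof -
  interpret LR: cring LR by (rule cring_LR)
  show ?thesis
    by (induction k) (auto intro: LR.oneideal LR.ideal_prod_is_ideal max_ideal_ideal)
qed

lemma mpow_carrier: "a \<in> mpow k \<Longrightarrow> a \<in> carrier LR"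
  using ideal.Icarr[OF mpow_ideal] .

lemma mpow_Suc: "mpow (Suc k) \<subseteq> mpow k"
proof -
  interpret LR: cring LR by (rule cring_LR)
  show ?thesis using LR.ideal_prod_inter[OF max_ideal_ideal mpow_ideal[of k]] by simp
qed

lemma mpow_mult:
  assumes "a \<in> mpow i" "b \<in> mpow j"
  shows "a \<otimes>\<^bsub>LR\<^esub> b \<in> mpow (i + j)"
  using assms
proof (induction i arbitrary: a)
  case 0
  then show ?case using ideal.I_l_closed[OF mpow_ideal] by simp
next
  case (Suc i)
  interpret LR: cring LR by (rule cring_LR)
  from Suc.prems(1) have "a \<in> ideal_prod LR (max_ideal n X) (mpow i)" by simp
  then show ?case
  proof (induction a rule: ideal_prod.induct)
    case (prod x y)
    then have c: "x \<in> carrier LR" "y \<in> carrier LR" "b \<in> carrier LR"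
      using max_ideal_carrier mpow_carrier Suc.prems(2) by auto
    have "x \<otimes>\<^bsub>LR\<^esub> (y \<otimes>\<^bsub>LR\<^esub> b) \<in> mpow (Suc (i + j))"
      using prod Suc by (auto intro: ideal_prod.prod)
    then show ?case using c by (simp add: LR.m_assoc)
  next
    case (sum s1 s2)
    have c: "s1 \<in> carrier LR" "s2 \<in> carrier LR" "b \<in> carrier LR"
      using sum.hyps mpow_carrier[of _ "Suc i"] mpow_carrier[OF Suc.prems(2)] by auto
    then show ?case
      using sum.IH additive_subgroup.a_closed[OF ideal.axioms(1)[OF mpow_ideal[of "Suc i + j"]]]
      by (simp add: LR.l_distr del: max_ideal_pow.simps)
  qed
qed

lemma mpow_1: "mpow 1 = max_ideal n X"
proof -
  interpret LR: cring LR by (rule cring_LR)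
  have "x \<in> max_ideal n X" if "x \<in> mpow 1" for x
    using that LR.ideal_prod_inter[OF max_ideal_ideal mpow_ideal[of 0]] by auto
  moreover have "x \<in> mpow 1" if "x \<in> max_ideal n X" for x
  proof -
    have "x \<otimes>\<^bsub>LR\<^esub> \<one>\<^bsub>LR\<^esub> \<in> mpow 1" using that by (auto intro: ideal_prod.prod)
    then show ?thesis using that max_ideal_carrier by auto
  qed
  ultimately show ?thesis by blast
qed

lemma abelian_subgroup_mpow: "abelian_subgroup (mpow k) LR"
  using abelian_subgroupI3[OF ideal.axioms(1)[OF mpow_ideal]] cring_LR
  by (simp add: cring.axioms(1) ring.axioms(1) cring_def ring_def)

lemma gr_coset_mem: "a \<in> carrier LR \<Longrightarrow> b \<in> gr_coset n X k a \<longleftrightarrow> (\<exists>r\<in>mpow (Suc k). b = r \<oplus>\<^bsub>LR\<^esub> a)"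
  by (auto simp: gr_coset_def a_r_coset_def')

lemma gr_coset_eqI:
  assumes "a \<in> carrier LR" "r \<in> mpow (Suc k)"
  shows "gr_coset n X k (r \<oplus>\<^bsub>LR\<^esub> a) = gr_coset n X k a"
proof -
  interpret A: abelian_subgroup "mpow (Suc k)" LR by (rule abelian_subgroup_mpow)
  have "r \<oplus>\<^bsub>LR\<^esub> a \<in> mpow (Suc k) +>\<^bsub>LR\<^esub> a"
    using assms by (auto simp: a_r_coset_def' simp del: max_ideal_pow.simps)
  from A.a_repr_independence'[OF this assms(1)] show ?thesis unfolding gr_coset_def by simp
qed

lemma gr_coset_zero: "a \<in> mpow (Suc k) \<Longrightarrow> gr_coset n X k a = mpow (Suc k)"
proof -
  interpret LR: cring LR by (rule cring_LR)
  interpret A: abelian_subgroup "mpow (Suc k)" LR by (rule abelian_subgroup_mpow)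
  assume "a \<in> mpow (Suc k)"
  then show ?thesis unfolding gr_coset_def using A.a_rcos_const by simp
qed

lemma gr_coset_self: "a \<in> carrier LR \<Longrightarrow> a \<in> gr_coset n X k a"
proof -
  interpret A: abelian_subgroup "mpow (Suc k)" LR by (rule abelian_subgroup_mpow)
  show "a \<in> carrier LR \<Longrightarrow> a \<in> gr_coset n X k a" unfolding gr_coset_def by (rule A.a_rcos_self)
qed

lemma gr_coset_add:
  assumes "a \<in> carrier LR" "b \<in> carrier LR"
  shows "gr_coset n X k a <+>\<^bsub>LR\<^esub> gr_coset n X k b = gr_coset n X k (a \<oplus>\<^bsub>LR\<^esub> b)"
proof -
  interpret A: abelian_subgroup "mpow (Suc k)" LR by (rule abelian_subgroup_mpow)
  show ?thesis unfolding gr_coset_def using A.a_rcos_sum[OF assms] .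
qed

lemma zero_mpow: "\<zero>\<^bsub>LR\<^esub> \<in> mpow k"
  using additive_subgroup.zero_closed[OF ideal.axioms(1)[OF mpow_ideal]] .

lemma add_mpow: "a \<in> mpow k \<Longrightarrow> b \<in> mpow k \<Longrightarrow> a \<oplus>\<^bsub>LR\<^esub> b \<in> mpow k"
  using additive_subgroup.a_closed[OF ideal.axioms(1)[OF mpow_ideal]] .

lemma finsum_mpow:
  assumes "\<And>i. i \<in> S \<Longrightarrow> f i \<in> mpow k"
  shows "finsum LR f S \<in> mpow k"
proof -
  interpret LR: cring LR by (rule cring_LR)
  show ?thesis
    using assms
  proof (induction S rule: infinite_finite_induct)
    case (insert x S)
    then have "f \<in> S \<rightarrow> carrier LR" "f x \<in> carrier LR" using mpow_carrier by auto
    with insert show ?case by (simp add: add_mpow)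
  qed (simp_all add: zero_mpow)
qed

lemma gr_simps:
  "s \<oplus>\<^bsub>gr_ring n X\<^esub> t = (\<lambda>k. s k <+>\<^bsub>LR\<^esub> t k)"
  "\<zero>\<^bsub>gr_ring n X\<^esub> = (\<lambda>k. mpow (Suc k))"
  "(s \<otimes>\<^bsub>gr_ring n X\<^esub> t) k = gr_coset n X k (\<Oplus>\<^bsub>LR\<^esub>i\<in>{..k}. (SOME a. a \<in> s i) \<otimes>\<^bsub>LR\<^esub> (SOME b. b \<in> t (k - i)))"
  by (simp_all add: gr_ring_def)

lemma gr_homog_add:
  assumes "a \<in> carrier LR" "b \<in> carrier LR"
  shows "gr_homog n X k a \<oplus>\<^bsub>gr_ring n X\<^esub> gr_homog n X k b = gr_homog n X k (a \<oplus>\<^bsub>LR\<^esub> b)"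
proof -
  have "mpow (Suc i) <+>\<^bsub>LR\<^esub> mpow (Suc i) = mpow (Suc i)" for i
  proof -
    interpret LR: cring LR by (rule cring_LR)
    show ?thesis using gr_coset_add[OF LR.zero_closed LR.zero_closed, of i]
      by (simp add: gr_coset_zero zero_mpow del: max_ideal_pow.simps)
  qed
  then show ?thesis
    using gr_coset_add[OF assms] by (intro ext) (simp add: gr_simps gr_homog_def del: max_ideal_pow.simps)
qed

lemma gr_homog_zero: "a \<in> mpow (Suc k) \<Longrightarrow> gr_homog n X k a = \<zero>\<^bsub>gr_ring n X\<^esub>"
  by (intro ext) (simp add: gr_homog_def gr_simps gr_coset_zero del: max_ideal_pow.simps)

text \<open>
  The product in the graded ring multiplies arbitrarily chosen representatives of the cosets.
\<close>

lemma gr_homog_some: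
  assumes "a \<in> mpow k"
  shows "\<exists>r\<in>mpow (Suc i). (SOME x. x \<in> gr_homog n X k a i) = (if i = k then r \<oplus>\<^bsub>LR\<^esub> a else r)"
proof (cases "i = k")
  case True
  have "(SOME x. x \<in> gr_coset n X k a) \<in> gr_coset n X k a"
    using gr_coset_self[OF mpow_carrier[OF assms], of k] by (rule someI)
  then show ?thesis
    using gr_coset_mem[OF mpow_carrier[OF assms]] True by (auto simp: gr_homog_def simp del: max_ideal_pow.simps)
next
  case False
  have "(SOME x. x \<in> mpow (Suc i)) \<in> mpow (Suc i)" using zero_mpow by (rule someI)
  then show ?thesis using False by (auto simp: gr_homog_def simp del: max_ideal_pow.simps)
qed

text \<open>
  In degree \<open>q = k + l\<close> the chosen representatives differ from \<open>a\<close> and \<open>b\<close> by elements of higher order;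
  all other products in the convolution have order above \<open>q\<close>.
\<close>

lemma gr_homog_mult:
  assumes a: "a \<in> mpow k" and b: "b \<in> mpow l"
  shows "gr_homog n X k a \<otimes>\<^bsub>gr_ring n X\<^esub> gr_homog n X l b = gr_homog n X (k + l) (a \<otimes>\<^bsub>LR\<^esub> b)"
proof
  interpret LR: cring LR by (rule cring_LR)
  fix q
  define P where "P i = (SOME x. x \<in> gr_homog n X k a i)" for i
  define Q where "Q i = (SOME x. x \<in> gr_homog n X l b i)" for i
  have Pe: "\<exists>r\<in>mpow (Suc i). P i = (if i = k then r \<oplus>\<^bsub>LR\<^esub> a else r)" for i
    unfolding P_def by (rule gr_homog_some[OF a])
  have Qe: "\<exists>r\<in>mpow (Suc i). Q i = (if i = l then r \<oplus>\<^bsub>LR\<^esub> b else r)" for i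
    unfolding Q_def by (rule gr_homog_some[OF b])
  have P1: "P i \<in> mpow (Suc i)" if "i \<noteq> k" for i using Pe[of i] that by auto
  have Q1: "Q i \<in> mpow (Suc i)" if "i \<noteq> l" for i using Qe[of i] that by auto
  have P0: "P i \<in> mpow i" for i
    using Pe[of i] mpow_Suc[of i] a add_mpow by (cases "i = k") (auto simp del: max_ideal_pow.simps)
  have Q0: "Q i \<in> mpow i" for i
    using Qe[of i] mpow_Suc[of i] b add_mpow by (cases "i = l") (auto simp del: max_ideal_pow.simps)
  have term1: "P i \<otimes>\<^bsub>LR\<^esub> Q (q - i) \<in> mpow (Suc q)" if "i \<le> q" "i \<noteq> k \<or> q - i \<noteq> l" for i
    using that(2)
  proof
    assume "i \<noteq> k"
    then have "P i \<otimes>\<^bsub>LR\<^esub> Q (q - i) \<in> mpow (Suc i + (q - i))" using P1 Q0 by (intro mpow_mult)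
    moreover have "Suc i + (q - i) = Suc q" using that(1) by simp
    ultimately show ?thesis by (simp del: max_ideal_pow.simps)
  next
    assume "q - i \<noteq> l"
    then have "P i \<otimes>\<^bsub>LR\<^esub> Q (q - i) \<in> mpow (i + Suc (q - i))" using P0 Q1 by (intro mpow_mult)
    moreover have "i + Suc (q - i) = Suc q" using that(1) by simp
    ultimately show ?thesis by (simp del: max_ideal_pow.simps)
  qed
  have mult_q: "(gr_homog n X k a \<otimes>\<^bsub>gr_ring n X\<^esub> gr_homog n X l b) q
      = gr_coset n X q (\<Oplus>\<^bsub>LR\<^esub>i\<in>{..q}. P i \<otimes>\<^bsub>LR\<^esub> Q (q - i))"
    by (simp add: gr_simps P_def Q_def)
  show "(gr_homog n X k a \<otimes>\<^bsub>gr_ring n X\<^esub> gr_homog n X l b) q = gr_homog n X (k + l) (a \<otimes>\<^bsub>LR\<^esub> b) q"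
  proof (cases "q = k + l")
    case False
    have "(\<Oplus>\<^bsub>LR\<^esub>i\<in>{..q}. P i \<otimes>\<^bsub>LR\<^esub> Q (q - i)) \<in> mpow (Suc q)"
      using False by (intro finsum_mpow term1) auto
    then show ?thesis
      unfolding mult_q using False by (simp add: gr_coset_zero gr_homog_def del: max_ideal_pow.simps)
  next
    case True
    have c: "P i \<in> carrier LR" "Q i \<in> carrier LR" for i using P0 Q0 mpow_carrier by blast+
    have ca: "a \<in> carrier LR" "b \<in> carrier LR" using a b mpow_carrier by auto
    obtain r where r: "r \<in> mpow (Suc k)" "P k = r \<oplus>\<^bsub>LR\<^esub> a" using Pe[of k] by auto
    obtain r' where r': "r' \<in> mpow (Suc l)" "Q l = r' \<oplus>\<^bsub>LR\<^esub> b" using Qe[of l] by auto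
    have cr: "r \<in> carrier LR" "r' \<in> carrier LR" using r r' mpow_carrier by blast+
    define rest where "rest = (\<Oplus>\<^bsub>LR\<^esub>i\<in>{..q} - {k}. P i \<otimes>\<^bsub>LR\<^esub> Q (q - i))"
    have rest: "rest \<in> mpow (Suc q)" unfolding rest_def using True by (intro finsum_mpow term1) auto
    have "(\<Oplus>\<^bsub>LR\<^esub>i\<in>insert k ({..q} - {k}). P i \<otimes>\<^bsub>LR\<^esub> Q (q - i)) = P k \<otimes>\<^bsub>LR\<^esub> Q (q - k) \<oplus>\<^bsub>LR\<^esub> rest"
      unfolding rest_def using c by (intro LR.finsum_insert) auto
    moreover have "insert k ({..q} - {k}) = {..q}" using True by auto
    moreover have "P k \<otimes>\<^bsub>LR\<^esub> Q (q - k) = (r \<otimes>\<^bsub>LR\<^esub> Q l \<oplus>\<^bsub>LR\<^esub> a \<otimes>\<^bsub>LR\<^esub> r') \<oplus>\<^bsub>LR\<^esub> a \<otimes>\<^bsub>LR\<^esub> b"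
      using True ca cr c by (simp add: r r' LR.l_distr LR.r_distr LR.a_ac)
    ultimately have "(\<Oplus>\<^bsub>LR\<^esub>i\<in>{..q}. P i \<otimes>\<^bsub>LR\<^esub> Q (q - i))
        = (rest \<oplus>\<^bsub>LR\<^esub> (r \<otimes>\<^bsub>LR\<^esub> Q l \<oplus>\<^bsub>LR\<^esub> a \<otimes>\<^bsub>LR\<^esub> r')) \<oplus>\<^bsub>LR\<^esub> a \<otimes>\<^bsub>LR\<^esub> b"
      using rest ca cr c mpow_carrier[OF rest] by (simp add: LR.a_ac)
    moreover have "r \<otimes>\<^bsub>LR\<^esub> Q l \<in> mpow (Suc q)" using mpow_mult[OF r(1) Q0[of l]] True by simp
    moreover have "a \<otimes>\<^bsub>LR\<^esub> r' \<in> mpow (Suc q)" using mpow_mult[OF a r'(1)] True by simp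
    ultimately show ?thesis
      unfolding mult_q using True rest ca
      by (simp add: gr_homog_def gr_coset_eqI add_mpow del: max_ideal_pow.simps)
  qed
qed

end

section \<open>Bounds for flags, and unipotent matrices\<close>

context loop_dim
begin

lemma mat_act_carrier [simp]: "A \<in> carrier_mat n n \<Longrightarrow> v \<in> carrier_vec n \<Longrightarrow> A *\<^sub>v v \<in> carrier_vec n"
  and mat_mult_carrier [simp]: "A \<in> carrier_mat n n \<Longrightarrow> B \<in> carrier_mat n n \<Longrightarrow> A * B \<in> carrier_mat n n"
  for A B :: "ratfun mat"
  by auto

lemma mat_mult_act: "A \<in> carrier_mat n n \<Longrightarrow> B \<in> carrier_mat n n \<Longrightarrow> v \<in> carrier_vec n \<Longrightarrow>
    (A * B) *\<^sub>v v = A *\<^sub>v (B *\<^sub>v v)" for A B :: "ratfun mat"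
  by (rule assoc_mult_mat_vec)

lemma mat_act_add: "A \<in> carrier_mat n n \<Longrightarrow> u \<in> carrier_vec n \<Longrightarrow> v \<in> carrier_vec n \<Longrightarrow>
    A *\<^sub>v (u + v) = A *\<^sub>v u + A *\<^sub>v v" for A :: "ratfun mat"
  by (rule mult_add_distrib_mat_vec)

lemma mat_act_smult: "A \<in> carrier_mat n n \<Longrightarrow> v \<in> carrier_vec n \<Longrightarrow> A *\<^sub>v (c \<cdot>\<^sub>v v) = c \<cdot>\<^sub>v (A *\<^sub>v v)"
  for A :: "ratfun mat"
  by (rule mult_mat_vec)

lemma smult_zvec: "a \<cdot>\<^sub>v 0\<^sub>v n = (0\<^sub>v n :: ratfun vec)"
  by (intro eq_vecI) auto

lemma mat_zvec: "A \<in> carrier_mat n n \<Longrightarrow> A *\<^sub>v 0\<^sub>v n = (0\<^sub>v n :: ratfun vec)"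
  by (intro eq_vecI) auto

text \<open>
  The poles of \<open>g\<close> and of its inverse are bounded.
\<close>

lemma flags_incl:
  assumes "M \<in> flags n"
  shows "\<exists>N. incl N M"
proof -
  obtain g where g: "g \<in> loop_group n" "M = flag_of n g" using assms by (auto simp: flags_def)
  then obtain h where h: "h \<in> carrier_mat n n" "g * h = 1\<^sub>m n" "h * g = 1\<^sub>m n"
    using loop_group_inverse by blast
  have gc: "g \<in> carrier_mat n n" using g(1) by (rule loop_group_carrier)
  obtain C where C: "C \<ge> 0" "\<And>m v. v \<in> Lam m \<Longrightarrow> g *\<^sub>v v \<in> Lam (m + C)"
    using mat_Lam_bounded[OF gc] by blast
  obtain C' where C': "C' \<ge> 0" "\<And>m v. v \<in> Lam m \<Longrightarrow> h *\<^sub>v v \<in> Lam (m + C')"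
    using mat_Lam_bounded[OF h(1)] by blast
  define N where "N = nat (C + C') + 1"
  have N: "int n * int N \<ge> int n + C + C'"
  proof -
    have "int n * (C + C') \<ge> 1 * (C + C')" using n_pos C(1) C'(1) by (intro mult_right_mono) auto
    then show ?thesis using C(1) C'(1) by (simp add: N_def algebra_simps)
  qed
  have "incl N M"
    unfolding incl_def
  proof (intro allI impI conjI subsetI)
    fix i v assume i: "i \<le> n" and v: "v \<in> Lam (lo N)"
    have "v \<in> Lam (int i - C')"
      using v Lam_mono[of "lo N" "int i - C'"] N C(1) by auto
    then have "h *\<^sub>v v \<in> Lam (int i)" using C'(2)[of v "int i - C'"] by simp
    moreover have "g *\<^sub>v (h *\<^sub>v v) = v"
      using gc h Lam_carrier[OF v] by (simp flip: assoc_mult_mat_vec)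
    ultimately show "v \<in> M i"
      unfolding g(2) flag_of_Lam[OF i] by (intro image_eqI[of _ _ "h *\<^sub>v v"]) simp_all
  next
    fix i v assume i: "i \<le> n" and v: "v \<in> M i"
    then obtain u where "u \<in> Lam (int i)" "v = g *\<^sub>v u" by (auto simp: g(2) flag_of_Lam)
    then have "v \<in> Lam (int i + C)" using C(2) by simp
    then show "v \<in> Lam (hi N)"
      using Lam_mono[of "int i + C" "hi N"] N C'(1) i by auto
  qed
  then show ?thesis ..
qed

text \<open>
  The lattice bounds of level \<open>N\<close> are made a consequence of the vanishing of coordinates, because this
  passes to the closure. The vectors of \<open>M_i\<close> are combinations of points of the graph above the \<open>E l\<close>, up
  to \<open>z^N1 \<Lambda>^n\<close> for large \<open>N1\<close>.
\<close>

lemma incl_if_coords: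
  assumes M: "M \<in> big_cell" and N: "N \<ge> 1"
    and low: "\<And>i l k. i \<le> n \<Longrightarrow> l \<le> lo N \<Longrightarrow> k > int i \<Longrightarrow> cf k (canv M i l) = 0"
    and up: "\<And>i l k. i \<le> n \<Longrightarrow> l \<le> int i \<Longrightarrow> k > hi N \<Longrightarrow> cf k (canv M i l) = 0"
  shows "incl N M"
proof -
  have fl: "M \<in> flags n" using M by (rule big_cell_flags)
  obtain N' where "incl N' M" using flags_incl[OF fl] by blast
  \<comment> \<open>some level, possibly much higher than \<open>N\<close>, at which \<open>M\<close> can be compared with its graph\<close>
  define N1 where "N1 = max N N'"
  have N1: "incl N1 M" "N \<le> N1" using incl_mono[OF \<open>incl N' M\<close>] by (auto simp: N1_def)
  show ?thesis
    unfolding incl_def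
  proof (intro allI impI conjI subsetI)
    fix i v assume i: "i \<le> n" and v: "v \<in> Lam (lo N)"
    define e where "e = lo N1"
    have csubM: "csub (M i)" using csub_flag[OF fl i] .
    define t where "t = vsum {e<..lo N} (\<lambda>l. cf l v) E"
    have EM: "E l \<in> M i" if "l \<le> lo N" for l
    proof -
      have l: "l \<le> int i" using that lo_nonpos[OF N] by simp
      have "cf k (canv M i l) = cf k (E l)" for k
        using canv(2)[OF M i l, of k] low[OF i that, of k] l by (cases "k \<le> int i") (auto simp: cf_E)
      then have "canv M i l = E l" using canv_carrier[OF M i l] by (intro cf_eqI) auto
      then show ?thesis using canv(1)[OF M i l] by simp
    qed
    have tM: "t \<in> M i" unfolding t_def using EM by (intro csub_vsum csubM) auto
    have "v - t \<in> Lam e" unfolding t_def by (rule truncate_in_Lam[OF v])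
    then have "v - t \<in> M i" using incl_lower[OF N1(1) i] by (auto simp: e_def)
    then have "v - t + t \<in> M i" using tM csubM by (simp add: csub_def)
    moreover have "v - t + t = v" using Lam_carrier[OF v] by (intro cf_eqI) (auto simp: cf_add cf_diff t_def)
    ultimately show "v \<in> M i" by simp
  next
    fix i v assume i: "i \<le> n" and v: "v \<in> M i"
    define e where "e = lo N1"
    have csubM: "csub (M i)" using csub_flag[OF fl i] .
    have vc: "v \<in> carrier_vec n" using csub_carrier[OF csubM v] .
    define t where "t = vsum {e<..int i} (\<lambda>l. cf l v) (\<lambda>l. canv M i l)"
    have tM: "t \<in> M i" unfolding t_def using canv(1)[OF M i] by (intro csub_vsum csubM) auto
    have "v - t \<in> Lam (lo N1)"
    proof (rule big_cell_low[OF M N1(1) i csub_diff[OF csubM v tM]])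
      fix k assume k: "lo N1 < k" "k \<le> int i"
      have "cf k t = (\<Sum>l\<in>{e<..int i}. if l = k then cf k v else 0)"
        unfolding t_def cf_vsum using canv(2)[OF M i _ k(2)] by (intro sum.cong) auto
      also have "\<dots> = cf k v" using k by (simp add: e_def)
      finally show "cf k (v - t) = 0" using vc by (simp add: cf_diff t_def)
    qed
    moreover have "N1 \<ge> 1" using N N1 by simp
    moreover have "lo N1 < k" if "k > hi N" for k
    proof -
      have "0 \<le> int n * int N" by simp
      then show ?thesis using that lo_nonpos[OF \<open>N1 \<ge> 1\<close>] n_pos by linarith
    qed
    ultimately have "cf k (v - t) = 0" if "k > hi N" for k
      using that by (auto simp: Lam_def)
    moreover have "cf k t = 0" if "k > hi N" for k
      unfolding t_def cf_vsum using up[OF i _ that] by (intro sum.neutral) auto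
    ultimately have "cf k v = 0" if "k > hi N" for k
      using that vc cf_diff[OF vc, of t k] by (simp add: t_def)
    then show "v \<in> Lam (hi N)" using vc by (simp add: Lam_def)
  qed
qed

lemma one_plus_mult:
  assumes "A \<in> carrier_mat n n" "v \<in> carrier_vec n"
  shows "(1\<^sub>m n + const t \<cdot>\<^sub>m A) *\<^sub>v v = v + const t \<cdot>\<^sub>v (A *\<^sub>v v)"
proof -
  have "(const t \<cdot>\<^sub>m A) *\<^sub>v v = const t \<cdot>\<^sub>v (A *\<^sub>v v)"
    using assms by (intro eq_vecI) (auto simp: scalar_prod_def sum_distrib_left mult.assoc)
  then show ?thesis using assms by (simp add: add_mult_distrib_mat_vec[of _ n n])
qed

lemma one_plus_loop_group:
  assumes A: "A \<in> carrier_mat n n" and sq: "\<And>l. A *\<^sub>v (A *\<^sub>v E l) = 0\<^sub>v n"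
  shows "1\<^sub>m n + const t \<cdot>\<^sub>m A \<in> loop_group n"
proof -
  have inv: "(1\<^sub>m n + const t \<cdot>\<^sub>m A) * (1\<^sub>m n + const (- t) \<cdot>\<^sub>m A) = 1\<^sub>m n" for t
  proof (rule mat_eqI_E)
    fix l
    have c: "A *\<^sub>v E l \<in> carrier_vec n" using A by simp
    have 0: "A *\<^sub>v (const (- t) \<cdot>\<^sub>v (A *\<^sub>v E l)) = 0\<^sub>v n"
      using mult_mat_vec[OF A c] sq[of l] by (simp add: smult_zvec)
    have "(1\<^sub>m n + const t \<cdot>\<^sub>m A) * (1\<^sub>m n + const (- t) \<cdot>\<^sub>m A) *\<^sub>v E l
        = (1\<^sub>m n + const t \<cdot>\<^sub>m A) *\<^sub>v ((1\<^sub>m n + const (- t) \<cdot>\<^sub>m A) *\<^sub>v E l)"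
      using A by (intro assoc_mult_mat_vec[of _ n n _ n]) auto
    also have "\<dots> = (E l + const (- t) \<cdot>\<^sub>v (A *\<^sub>v E l)) + const t \<cdot>\<^sub>v (A *\<^sub>v (E l + const (- t) \<cdot>\<^sub>v (A *\<^sub>v E l)))"
      using A c by (simp add: one_plus_mult)
    also have "A *\<^sub>v (E l + const (- t) \<cdot>\<^sub>v (A *\<^sub>v E l)) = A *\<^sub>v E l + 0\<^sub>v n"
      using A c 0 by (subst mult_add_distrib_mat_vec[OF A]) auto
    also have "(E l + const (- t) \<cdot>\<^sub>v (A *\<^sub>v E l)) + const t \<cdot>\<^sub>v (A *\<^sub>v E l + 0\<^sub>v n) = 1\<^sub>m n *\<^sub>v E l"
      using c by (intro cf_eqI) (auto simp: cf_add cf_smult)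
    finally show "(1\<^sub>m n + const t \<cdot>\<^sub>m A) * (1\<^sub>m n + const (- t) \<cdot>\<^sub>m A) *\<^sub>v E l = 1\<^sub>m n *\<^sub>v E l" .
  qed (use A in auto)
  show ?thesis
    using A inv[of t] inv[of "- t"] by (intro loop_groupI[of _ "1\<^sub>m n + const (- t) \<cdot>\<^sub>m A"]) auto
qed

end

section \<open>Schubert varieties of involutions\<close>

locale affine_involution = loop_dim +
  fixes w :: "int \<Rightarrow> int"
  assumes w_affine: "w \<in> affine_sym n" and w_invol: "w \<circ> w = id"
begin

lemma w_w [simp]: "w (w i) = i"
  using w_invol by (simp add: fun_eq_iff)

lemma w_eq_iff: "w i = j \<longleftrightarrow> i = w j"
  using w_w by metis

lemma w_shift: "w (i + int n * k) = w i + int n * k"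
proof -
  have 1: "w (i + int n) = w i + int n" for i using w_affine by (simp add: affine_sym_def)
  have nat: "w (i + int n * int m) = w i + int n * int m" for i m
  proof (induction m)
    case (Suc m)
    have "w (i + int n * int (Suc m)) = w ((i + int n * int m) + int n)" by (simp add: algebra_simps)
    also have "\<dots> = w (i + int n * int m) + int n" by (rule 1)
    finally show ?case using Suc by (simp add: algebra_simps)
  qed simp
  show ?thesis
  proof (cases "k \<ge> 0")
    case True
    then show ?thesis using nat[of i "nat k"] by simp
  next
    case False
    then show ?thesis using nat[of "i + int n * k" "nat (- k)"] by simp
  qed
qed

lemma w_bounded: "\<exists>C\<ge>0. \<forall>i. \<bar>w i - i\<bar> \<le> C"
proof -
  define C where "C = Max ((\<lambda>j. \<bar>w (int j + 1) - (int j + 1)\<bar>) ` {..<n})"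
  have le: "\<bar>w (int j + 1) - (int j + 1)\<bar> \<le> C" if "j < n" for j
    unfolding C_def using that by (intro Max_ge) auto
  have "\<bar>w i - i\<bar> \<le> C" for i
  proof -
    have "i = (int (idx i) + 1) + int n * (- zord i)" using idx_zord[of i] by simp
    then have "w i - i = w (int (idx i) + 1) - (int (idx i) + 1)"
      using w_shift[of "int (idx i) + 1" "- zord i"] by simp
    then show ?thesis using le[of "idx i"] by simp
  qed
  moreover have "C \<ge> 0" using le[of 0] n_pos by linarith
  ultimately show ?thesis by blast
qed

text \<open>
  In column \<open>l\<close>, the matrix of \<open>w\<close> has its entry in row \<open>w l\<close>. So this is its strictly upper triangular
  part, and \<open>low_mat\<close> its strictly lower triangular part.
\<close>

definition up_mat :: "ratfun mat" where
  "up_mat = opmat (\<lambda>l. if w l < l then E (w l) else 0\<^sub>v n)"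

definition low_mat :: "ratfun mat" where
  "low_mat = opmat (\<lambda>l. if w l > l then E (w l) else 0\<^sub>v n)"

text \<open>
  The diagonal factor \<open>(t, -1/t)\<close> in the identity of 2-by-2 matrices behind
  \<open>one_plus_low_factor\<close>, on each pair of indices interchanged by \<open>w\<close>.
\<close>

definition diag_part :: "complex \<Rightarrow> int \<Rightarrow> complex" where
  "diag_part t l = (if w l > l then t else if w l < l then - (1 / t) else 1)"

definition torus_mat :: "complex \<Rightarrow> ratfun mat" where
  "torus_mat t = opmat (\<lambda>l. const (diag_part t l) \<cdot>\<^sub>v E l)"

lemma diag_part_shift: "diag_part t (l + int n * k) = diag_part t l"
  by (simp add: diag_part_def w_shift)

lemma mats_carrier [simp]:
  "up_mat \<in> carrier_mat n n" "low_mat \<in> carrier_mat n n" "torus_mat t \<in> carrier_mat n n"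
  "weyl_mat n w \<in> carrier_mat n n"
  by (simp_all add: up_mat_def low_mat_def torus_mat_def weyl_mat_def)

lemma weyl_mat_eq: "weyl_mat n w = opmat (\<lambda>l. E (w l))"
proof (rule eq_matI)
  fix r c assume "r < dim_row (opmat (\<lambda>l. E (w l)))" "c < dim_col (opmat (\<lambda>l. E (w l)))"
  then have "r < n" "c < n" by (simp_all add: opmat_def)
  moreover have "int r = (w (int c + 1) - 1) mod int n \<longleftrightarrow> r = idx (w (int c + 1))"
    using n_pos by (simp add: idx_def) (metis nat_int pos_mod_sign int_nat_eq of_nat_0_less_iff)
  ultimately show "weyl_mat n w $$ (r, c) = opmat (\<lambda>l. E (w l)) $$ (r, c)"
    by (simp add: weyl_mat_def opmat_def E_def zord_def unit_vec_def)
qed (simp_all add: weyl_mat_def opmat_def)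

lemma weyl_mat_E: "weyl_mat n w *\<^sub>v E l = E (w l)"
  unfolding weyl_mat_eq by (rule opmat_E) (simp_all add: w_shift E_shift)

lemma up_mat_E: "up_mat *\<^sub>v E l = (if w l < l then E (w l) else 0\<^sub>v n)"
  unfolding up_mat_def by (rule opmat_E) (simp_all add: w_shift E_shift smult_zvec)

lemma low_mat_E: "low_mat *\<^sub>v E l = (if w l > l then E (w l) else 0\<^sub>v n)"
  unfolding low_mat_def by (rule opmat_E) (simp_all add: w_shift E_shift smult_zvec)

lemma torus_mat_E: "torus_mat t *\<^sub>v E l = const (diag_part t l) \<cdot>\<^sub>v E l"
  unfolding torus_mat_def
  by (rule opmat_E, simp, simp only: diag_part_shift E_shift smult_smult_assoc, simp only: mult.commute)

lemma weyl_mat_loop_group: "weyl_mat n w \<in> loop_group n"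
proof -
  have "weyl_mat n w * weyl_mat n w = 1\<^sub>m n"
    by (rule mat_eqI_E) (simp_all add: weyl_mat_E mat_mult_act)
  then show ?thesis by (intro loop_groupI[of _ "weyl_mat n w"]) auto
qed

lemma low_mat_loop_group: "1\<^sub>m n + const t \<cdot>\<^sub>m low_mat \<in> loop_group n"
  by (rule one_plus_loop_group) (auto simp: low_mat_E mat_zvec)

lemma up_mat_loop_group: "1\<^sub>m n + const t \<cdot>\<^sub>m up_mat \<in> loop_group n"
  by (rule one_plus_loop_group) (auto simp: up_mat_E mat_zvec)

lemma torus_mat_loop_group: "t \<noteq> 0 \<Longrightarrow> torus_mat t \<in> loop_group n"
proof -
  assume t: "t \<noteq> 0"
  define B where "B = opmat (\<lambda>l. const (1 / diag_part t l) \<cdot>\<^sub>v E l)"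
  have B: "B \<in> carrier_mat n n" by (simp add: B_def)
  have BE: "B *\<^sub>v E l = const (1 / diag_part t l) \<cdot>\<^sub>v E l" for l
    unfolding B_def
    by (rule opmat_E, simp, simp only: diag_part_shift E_shift smult_smult_assoc, simp only: mult.commute)
  have d: "diag_part t l \<noteq> 0" for l using t by (simp add: diag_part_def)
  have d1: "const (diag_part t l) * const (1 / diag_part t l) = 1"
    and d2: "const (1 / diag_part t l) * const (diag_part t l) = 1" for l
    using d by (simp_all flip: const_mult)
  have "torus_mat t * B = 1\<^sub>m n"
    using B by (intro mat_eqI_E) (simp_all add: mat_mult_act BE torus_mat_E mat_act_smult smult_smult_assoc d2)
  moreover have "B * torus_mat t = 1\<^sub>m n"
    using B by (intro mat_eqI_E) (simp_all add: mat_mult_act BE torus_mat_E mat_act_smult smult_smult_assoc d1)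
  ultimately show ?thesis using B by (intro loop_groupI[of _ B]) auto
qed

lemma up_mat_iwahori: "1\<^sub>m n + const s \<cdot>\<^sub>m up_mat \<in> iwahori n"
proof (rule iwahoriI[OF up_mat_loop_group])
  fix l
  show "(1\<^sub>m n + const s \<cdot>\<^sub>m up_mat) *\<^sub>v E l \<in> Lam l" "cf l ((1\<^sub>m n + const s \<cdot>\<^sub>m up_mat) *\<^sub>v E l) \<noteq> 0"
    by (auto simp: one_plus_mult up_mat_E Lam_def cf_add cf_smult cf_E smult_zvec)
qed

lemma torus_up_E:
  "(torus_mat t * (1\<^sub>m n + const s \<cdot>\<^sub>m up_mat)) *\<^sub>v E l = const (diag_part t l) \<cdot>\<^sub>v E l
    + const (if w l < l then s * diag_part t (w l) else 0) \<cdot>\<^sub>v E (w l)"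
proof -
  have "(torus_mat t * (1\<^sub>m n + const s \<cdot>\<^sub>m up_mat)) *\<^sub>v E l = torus_mat t *\<^sub>v ((1\<^sub>m n + const s \<cdot>\<^sub>m up_mat) *\<^sub>v E l)"
    by (intro assoc_mult_mat_vec[of _ n n _ n]) auto
  also have "\<dots> = torus_mat t *\<^sub>v E l + torus_mat t *\<^sub>v (const s \<cdot>\<^sub>v (up_mat *\<^sub>v E l))"
    by (simp add: one_plus_mult mat_act_add)
  also have "torus_mat t *\<^sub>v (const s \<cdot>\<^sub>v (up_mat *\<^sub>v E l)) = const s \<cdot>\<^sub>v (torus_mat t *\<^sub>v (up_mat *\<^sub>v E l))"
    by (simp add: mat_act_smult)
  also have "torus_mat t *\<^sub>v (up_mat *\<^sub>v E l) = (if w l < l then const (diag_part t (w l)) \<cdot>\<^sub>v E (w l) else 0\<^sub>v n)"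
    by (simp add: up_mat_E torus_mat_E mat_zvec)
  finally show ?thesis
    by (intro cf_eqI) (auto simp: torus_mat_E cf_add cf_smult)
qed

lemma torus_up_iwahori:
  assumes "t \<noteq> 0"
  shows "torus_mat t * (1\<^sub>m n + const s \<cdot>\<^sub>m up_mat) \<in> iwahori n"
proof (rule iwahoriI)
  show "torus_mat t * (1\<^sub>m n + const s \<cdot>\<^sub>m up_mat) \<in> loop_group n"
    by (intro loop_group_mult torus_mat_loop_group up_mat_loop_group assms)
  fix l
  have "diag_part t l \<noteq> 0" using assms by (simp add: diag_part_def)
  then show "(torus_mat t * (1\<^sub>m n + const s \<cdot>\<^sub>m up_mat)) *\<^sub>v E l \<in> Lam l"
    "cf l ((torus_mat t * (1\<^sub>m n + const s \<cdot>\<^sub>m up_mat)) *\<^sub>v E l) \<noteq> 0"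
    unfolding torus_up_E by (auto simp: Lam_def cf_add cf_smult cf_E)
qed

text \<open>
  The identity \<open>(1, 0; t, 1) = (1, 1/t; 0, 1) (0, 1; 1, 0) (t, 0; 0, -1/t) (1, 1/t; 0, 1)\<close> on each of
  the disjoint pairs of indices that the involution interchanges.
\<close>

lemma one_plus_low_factor:
  assumes t: "t \<noteq> 0"
  shows "1\<^sub>m n + const t \<cdot>\<^sub>m low_mat
    = (1\<^sub>m n + const (1 / t) \<cdot>\<^sub>m up_mat) * weyl_mat n w * (torus_mat t * (1\<^sub>m n + const (1 / t) \<cdot>\<^sub>m up_mat))"
    (is "_ = ?U * _ * ?T")
proof (rule mat_eqI_E)
  fix l
  have c: "?T \<in> carrier_mat n n" "?U \<in> carrier_mat n n" by simp_all
  then have "(?U * weyl_mat n w * ?T) *\<^sub>v E l = ?U *\<^sub>v (weyl_mat n w *\<^sub>v (?T *\<^sub>v E l))"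
    using mat_mult_act[OF _ c(1), of "?U * weyl_mat n w" "E l"] mat_mult_act[OF c(2), of "weyl_mat n w" "?T *\<^sub>v E l"]
    by simp
  also have "weyl_mat n w *\<^sub>v (?T *\<^sub>v E l) = const (diag_part t l) \<cdot>\<^sub>v E (w l)
      + const (if w l < l then 1 / t * diag_part t (w l) else 0) \<cdot>\<^sub>v E l"
    unfolding torus_up_E
    by (simp add: mat_act_add mat_act_smult weyl_mat_E)
  also have "?U *\<^sub>v \<dots> = const (diag_part t l) \<cdot>\<^sub>v (?U *\<^sub>v E (w l))
      + const (if w l < l then 1 / t * diag_part t (w l) else 0) \<cdot>\<^sub>v (?U *\<^sub>v E l)"
    using c(2) by (simp add: mat_act_add mat_act_smult)
  also have "\<dots> = (1\<^sub>m n + const t \<cdot>\<^sub>m low_mat) *\<^sub>v E l"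
    using t by (intro cf_eqI)
      (auto simp: one_plus_mult up_mat_E low_mat_E cf_add cf_smult diag_part_def field_simps smult_zvec)
  finally show "(1\<^sub>m n + const t \<cdot>\<^sub>m low_mat) *\<^sub>v E l = (?U * weyl_mat n w * ?T) *\<^sub>v E l" by simp
qed (auto intro!: mult_carrier_mat[of _ n n])

section \<open>Bruhat cells and a curve through the base point\<close>

definition cell :: "flag set" where
  "cell = {flag_of n (b * weyl_mat n w * b') | b b'. b \<in> iwahori n \<and> b' \<in> iwahori n}"

lemma schubert_eq: "schubert n w = zclosure n cell"
  by (simp add: schubert_def cell_def)

definition curve :: "complex \<Rightarrow> flag" where
  "curve t = flag_of n (1\<^sub>m n + const t \<cdot>\<^sub>m low_mat)"

lemma curve_cell: "t \<noteq> 0 \<Longrightarrow> curve t \<in> cell"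
  unfolding cell_def curve_def one_plus_low_factor
  using up_mat_iwahori torus_up_iwahori by blast

lemma cell_flags: "cell \<subseteq> flags n"
proof
  fix M assume "M \<in> cell"
  then obtain b b' where b: "b \<in> iwahori n" "b' \<in> iwahori n" "M = flag_of n (b * weyl_mat n w * b')"
    by (auto simp: cell_def)
  then have "b * weyl_mat n w * b' \<in> loop_group n"
    by (intro loop_group_mult iwahori_loop_group weyl_mat_loop_group)
  then show "M \<in> flags n" using b by (simp add: flags_def)
qed

lemma curve_flags: "curve t \<in> flags n"
  unfolding curve_def flags_def by (intro imageI low_mat_loop_group)

lemma curve_Lam: "i \<le> n \<Longrightarrow> curve t i = (\<lambda>v. v + const t \<cdot>\<^sub>v (low_mat *\<^sub>v v)) ` Lam (int i)"
  unfolding curve_def using Lam_carrier by (auto simp: flag_of_Lam one_plus_mult intro!: image_cong)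

lemma curve_0: "curve 0 = base_pt n"
proof -
  have "1\<^sub>m n + const 0 \<cdot>\<^sub>m low_mat = 1\<^sub>m n"
  proof (rule mat_eqI_E)
    fix l
    have "(1\<^sub>m n + const 0 \<cdot>\<^sub>m low_mat) *\<^sub>v E l = E l + const 0 \<cdot>\<^sub>v (low_mat *\<^sub>v E l)"
      by (rule one_plus_mult) simp_all
    also have "\<dots> = 1\<^sub>m n *\<^sub>v E l" by (intro cf_eqI) (simp_all add: cf_add cf_smult del: const_0)
    finally show "(1\<^sub>m n + const 0 \<cdot>\<^sub>m low_mat) *\<^sub>v E l = 1\<^sub>m n *\<^sub>v E l" .
  qed (simp_all del: const_0)
  then show ?thesis by (simp add: curve_def base_pt_def)
qed

lemma cf_perm_mat:
  assumes A: "A \<in> carrier_mat n n" and AE: "\<And>l. A *\<^sub>v E l = (if P l then E (w l) else 0\<^sub>v n)"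
    and v: "v \<in> carrier_vec n"
  shows "cf k (A *\<^sub>v v) = (if P (w k) then cf (w k) v else 0)"
proof -
  obtain K where K: "v \<in> Lam K" using bounded_in_Lam[OF v] by blast
  obtain C where C: "C \<ge> 0" "\<And>m u. u \<in> Lam m \<Longrightarrow> A *\<^sub>v u \<in> Lam (m + C)"
    using mat_Lam_bounded[OF A] by blast
  define m where "m = min (w k) (k - C) - 1"
  have "cf k (A *\<^sub>v v) = (\<Sum>l\<in>{m<..K}. cf l v * cf k (A *\<^sub>v E l))"
    by (rule cf_mat_vec[OF A K, of m "m + C"]) (use C(2)[of _ m] in \<open>auto simp: m_def\<close>)
  also have "\<dots> = (\<Sum>l\<in>{m<..K}. if l = w k then (if P (w k) then cf (w k) v else 0) else 0)"
  proof (rule sum.cong)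
    fix l
    have "k = w l \<longleftrightarrow> l = w k" using w_eq_iff by metis
    then show "cf l v * cf k (A *\<^sub>v E l) = (if l = w k then (if P (w k) then cf (w k) v else 0) else 0)"
      by (auto simp: AE cf_E)
  qed simp
  also have "\<dots> = (if P (w k) then cf (w k) v else 0)"
    using K by (auto simp: m_def Lam_def)
  finally show ?thesis .
qed

lemma cf_low_mat: "v \<in> carrier_vec n \<Longrightarrow> cf k (low_mat *\<^sub>v v) = (if w k < k then cf (w k) v else 0)"
  using cf_perm_mat[of low_mat "\<lambda>l. w l > l" v k] by (simp add: low_mat_E)

lemma cf_weyl_mat: "v \<in> carrier_vec n \<Longrightarrow> cf k (weyl_mat n w *\<^sub>v v) = cf (w k) v"
  using cf_perm_mat[of "weyl_mat n w" "\<lambda>_. True" v k] by (simp add: weyl_mat_E)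

text \<open>
  If \<open>w l > i\<close>, the vector is the image of \<open>E l\<close>. Otherwise \<open>E l\<close> itself lies in the lattice; when
  \<open>l < w l \<le> i\<close>, it is the image of \<open>E l - t E (w l)\<close>.
\<close>

lemma curve_canv_mem:
  assumes i: "i \<le> n" and l: "l \<le> int i"
  shows "E l + const (if w l > int i then t else 0) \<cdot>\<^sub>v E (w l) \<in> curve t i"
proof -
  define u where "u = E l + const (if l < w l \<and> w l \<le> int i then - t else 0) \<cdot>\<^sub>v E (w l)"
  have uc: "u \<in> carrier_vec n" by (simp add: u_def)
  have "u \<in> Lam (int i)" using l by (auto simp: u_def Lam_def cf_add cf_smult cf_E)
  moreover have "u + const t \<cdot>\<^sub>v (low_mat *\<^sub>v u) = E l + const (if w l > int i then t else 0) \<cdot>\<^sub>v E (w l)"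
  proof (rule cf_eqI)
    fix k
    have "cf k u = (if k = l then 1 else 0) + (if l < w l \<and> w l \<le> int i \<and> k = w l then - t else 0)" for k
      by (auto simp: u_def cf_add cf_smult cf_E)
    then show "cf k (u + const t \<cdot>\<^sub>v (low_mat *\<^sub>v u)) = cf k (E l + const (if w l > int i then t else 0) \<cdot>\<^sub>v E (w l))"
      using l w_eq_iff[of k l] w_eq_iff[of k "w l"]
      by (auto simp: uc cf_add cf_smult cf_low_mat cf_E)
  qed (simp_all add: uc)
  ultimately show ?thesis unfolding curve_Lam[OF i] by (intro image_eqI[of _ _ u]) simp_all
qed

text \<open>
  With \<open>u = v + t x v\<close>, the coefficients of \<open>v\<close> vanish first at the indices \<open>k\<close> with \<open>w k \<ge> k\<close>, where
  \<open>x\<close> does not contribute, and then at the others, where \<open>x\<close> contributes the coefficient at \<open>w k\<close>.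
\<close>

lemma curve_zero:
  assumes i: "i \<le> n" and u: "u \<in> curve t i" "\<And>k. k \<le> int i \<Longrightarrow> cf k u = 0"
  shows "u = 0\<^sub>v n"
proof -
  obtain v where v: "v \<in> Lam (int i)" "u = v + const t \<cdot>\<^sub>v (low_mat *\<^sub>v v)"
    using u(1) i by (auto simp: curve_Lam)
  have vc: "v \<in> carrier_vec n" using Lam_carrier[OF v(1)] .
  have lc: "low_mat *\<^sub>v v \<in> carrier_vec n" using vc by (simp add: mult_mat_vec_carrier[of _ n n])
  have cfu: "cf k u = cf k v + t * (if w k < k then cf (w k) v else 0)" for k
    using vc lc by (simp add: v(2) cf_add cf_smult cf_low_mat)
  have 1: "cf k v = 0" if "\<not> w k < k" for k
    using u(2)[of k] cfu[of k] v(1) that by (cases "k \<le> int i") (auto simp: Lam_def)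
  have "cf k v = 0" for k
  proof (cases "k \<le> int i \<and> w k < k")
    case True
    then have "cf (w k) v = 0" by (intro 1) simp
    then show ?thesis using True u(2)[of k] cfu[of k] by simp
  next
    case False
    then show ?thesis using 1[of k] v(1) by (auto simp: Lam_def)
  qed
  then have "cf k u = 0" for k using cfu by simp
  then show ?thesis using v vc lc by (intro cf_eqI) auto
qed

lemma curve_big_cell: "curve t \<in> big_cell"
  unfolding big_cell_def
proof (intro CollectI conjI allI impI curve_flags)
  fix i and l :: int assume i: "i \<le> n" and l: "l \<le> int i"
  have csubM: "csub (curve t i)" using csub_flag[OF curve_flags i] .
  show "\<exists>!v. v \<in> curve t i \<and> (\<forall>k\<le>int i. cf k v = (if k = l then 1 else 0))"
  proof (rule ex_ex1I)
    show "\<exists>v. v \<in> curve t i \<and> (\<forall>k\<le>int i. cf k v = (if k = l then 1 else 0))"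
      using curve_canv_mem[OF i l, of t] by (intro exI conjI) (auto simp: cf_add cf_smult cf_E)
    fix u v assume u: "u \<in> curve t i \<and> (\<forall>k\<le>int i. cf k u = (if k = l then 1 else 0))"
      and v: "v \<in> curve t i \<and> (\<forall>k\<le>int i. cf k v = (if k = l then 1 else 0))"
    then have c: "u \<in> carrier_vec n" "v \<in> carrier_vec n" using csub_carrier[OF csubM] by auto
    have "u - v \<in> curve t i" using csub_diff[OF csubM] u v by blast
    then have "u - v = 0\<^sub>v n" by (rule curve_zero[OF i]) (use u v c in \<open>simp add: cf_diff\<close>)
    then have "cf l u = cf l v" for l using c by (metis cf_diff cf_zero right_minus_eq)
    then show "u = v" using c by (intro cf_eqI) auto
  qed
qed

lemma canv_curve:
  assumes "i \<le> n" "l \<le> int i"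
  shows "canv (curve t) i l = E l + const (if w l > int i then t else 0) \<cdot>\<^sub>v E (w l)"
  using assms by (intro canv_eqI curve_big_cell curve_canv_mem) (auto simp: cf_add cf_smult cf_E)

lemma coord_algebra_curve:
  "F \<in> coord_algebra \<Longrightarrow> \<exists>P. \<forall>t. F (curve t) = poly P t"
  unfolding coord_algebra_def
proof (induction F rule: fun_algebra.induct)
  case (const c)
  show ?case by (intro exI[of _ "[:c:]"]) simp
next
  case (gen F)
  then obtain i k l where F: "F = (\<lambda>M. cf k (canv M i l))" "i \<le> n" "l \<le> int i" by blast
  have "F (curve t) = poly [:cf k (E l), (if w l > int i then cf k (E (w l)) else 0):] t" for t
    by (simp add: F(1) canv_curve[OF F(2,3)] cf_add cf_smult)
  then show ?case by blast
next
  case (add F G)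
  then obtain P Q where "\<forall>t. F (curve t) = poly P t" "\<forall>t. G (curve t) = poly Q t" by blast
  then show ?case by (intro exI[of _ "P + Q"]) simp
next
  case (mult F G)
  then obtain P Q where "\<forall>t. F (curve t) = poly P t" "\<forall>t. G (curve t) = poly Q t" by blast
  then show ?case by (intro exI[of _ "P * Q"]) simp
qed

lemma cell_mem:
  assumes "M \<in> cell"
  obtains b b' where "b \<in> iwahori n" "b' \<in> iwahori n"
    "\<And>i. i \<le> n \<Longrightarrow> M i = (\<lambda>v. b *\<^sub>v (weyl_mat n w *\<^sub>v (b' *\<^sub>v v))) ` Lam (int i)"
proof -
  obtain b b' where b: "b \<in> iwahori n" "b' \<in> iwahori n" "M = flag_of n (b * weyl_mat n w * b')"
    using assms by (auto simp: cell_def)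
  have c: "b \<in> carrier_mat n n" "b' \<in> carrier_mat n n"
    using b by (auto intro!: loop_group_carrier iwahori_loop_group)
  have "(b * weyl_mat n w * b') *\<^sub>v v = b *\<^sub>v (weyl_mat n w *\<^sub>v (b' *\<^sub>v v))" if "v \<in> carrier_vec n" for v
    using c that by (simp add: assoc_mult_mat_vec[of _ n n _ n] mult_carrier_mat[of _ n n] mult_mat_vec_carrier[of _ n n])
  then have "M i = (\<lambda>v. b *\<^sub>v (weyl_mat n w *\<^sub>v (b' *\<^sub>v v))) ` Lam (int i)" if "i \<le> n" for i
    using that Lam_carrier by (auto simp: b(3) flag_of_Lam intro!: image_cong)
  then show ?thesis using that b by blast
qed

lemma weyl_mat_Lam:
  assumes C: "\<And>i. \<bar>w i - i\<bar> \<le> C" and v: "v \<in> Lam m"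
  shows "weyl_mat n w *\<^sub>v v \<in> Lam (m + C)"
proof -
  have "cf k (weyl_mat n w *\<^sub>v v) = 0" if "k > m + C" for k
    using C[of k] v Lam_carrier[OF v] that by (auto simp: cf_weyl_mat Lam_def)
  then show ?thesis using Lam_carrier[OF v] by (simp add: Lam_def mult_mat_vec_carrier[of _ n n])
qed

text \<open>
  The Iwahori subgroup preserves all the lattices \<open>Lam m\<close>, and an affine permutation moves indices
  by a bounded amount.
\<close>

lemma cell_incl: "\<exists>N\<ge>1. \<forall>M\<in>cell. incl N M"
proof -
  obtain C where C: "C \<ge> 0" "\<And>i. \<bar>w i - i\<bar> \<le> C" using w_bounded by blast
  define N where "N = nat C + 1"
  have N: "int n * int N \<ge> int n + C"
  proof -
    have "int n * C \<ge> 1 * C" using n_pos C(1) by (intro mult_right_mono) auto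
    then show ?thesis using C(1) by (simp add: N_def algebra_simps)
  qed
  have "incl N M" if M: "M \<in> cell" for M
  proof -
    obtain b b' where b: "b \<in> iwahori n" "b' \<in> iwahori n"
      and Mi: "\<And>i. i \<le> n \<Longrightarrow> M i = (\<lambda>v. b *\<^sub>v (weyl_mat n w *\<^sub>v (b' *\<^sub>v v))) ` Lam (int i)"
      using cell_mem[OF M] by blast
    show ?thesis
      unfolding incl_def
    proof (intro allI impI conjI subsetI)
      fix i v assume i: "i \<le> n" and v: "v \<in> Lam (lo N)"
      have "v \<in> Lam (int i - C)"
        using v Lam_mono[of "lo N" "int i - C"] N by auto
      then obtain v1 where v1: "v1 \<in> Lam (int i - C)" "v = b *\<^sub>v v1"
        using iwahori_Lam_surj[OF b(1)] by blast
      define v2 where "v2 = weyl_mat n w *\<^sub>v v1"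
      have "v2 \<in> Lam (int i)" using weyl_mat_Lam[OF C(2) v1(1)] by (simp add: v2_def)
      then obtain v3 where v3: "v3 \<in> Lam (int i)" "v2 = b' *\<^sub>v v3"
        using iwahori_Lam_surj[OF b(2)] by blast
      have "weyl_mat n w *\<^sub>v v2 = v1"
        using Lam_carrier[OF v1(1)]
        by (intro cf_eqI) (auto simp: v2_def cf_weyl_mat mult_mat_vec_carrier[of _ n n])
      then show "v \<in> M i" using v1 v3 Mi[OF i] by auto
    next
      fix i v assume i: "i \<le> n" and v: "v \<in> M i"
      then obtain u where u: "u \<in> Lam (int i)" "v = b *\<^sub>v (weyl_mat n w *\<^sub>v (b' *\<^sub>v u))" using Mi by auto
      have "v \<in> Lam (int i + C)" unfolding u(2)
        by (intro iwahori_Lam b weyl_mat_Lam C(2) u)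
      then show "v \<in> Lam (hi N)"
        using Lam_mono[of "int i + C" "hi N"] N i by auto
    qed
  qed
  then show ?thesis by (intro exI[of _ N]) (simp add: N_def)
qed

text \<open>
  A level on which the whole Bruhat cell, and by \<open>schubert_incl\<close> its closure near the base point, is
  visible.
\<close>

definition level :: nat where
  "level = (SOME N. N \<ge> 1 \<and> (\<forall>M\<in>cell. incl N M))"

lemma level: "level \<ge> 1" "M \<in> cell \<Longrightarrow> incl level M"
  using someI_ex[of "\<lambda>N. N \<ge> 1 \<and> (\<forall>M\<in>cell. incl N M)"] cell_incl unfolding level_def by blast+

lemma zclosed_flags: "zclosed n (flags n)"
  using coord_algebra_zclosed[OF coord_algebra_intros(1)[of 0]] by simp

lemma cell_subset_schubert: "cell \<subseteq> schubert n w"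
  unfolding schubert_eq zclosure_def by blast

lemma schubert_flags: "schubert n w \<subseteq> flags n"
  unfolding schubert_eq zclosure_def using zclosed_flags cell_flags by blast

lemma schubert_vanish:
  assumes "F \<in> coord_algebra" "\<And>M. M \<in> cell \<Longrightarrow> M \<in> big_cell \<Longrightarrow> F M = 0"
    and "M \<in> schubert n w" "M \<in> big_cell"
  shows "F M = 0"
proof -
  have "cell \<subseteq> {M \<in> flags n. M \<in> big_cell \<longrightarrow> F M = 0}" using assms(2) cell_flags by auto
  then have "schubert n w \<subseteq> {M \<in> flags n. M \<in> big_cell \<longrightarrow> F M = 0}"
    unfolding schubert_eq zclosure_def using coord_algebra_zclosed[OF assms(1)] by blast
  then show ?thesis using assms(3,4) by auto
qed

lemma schubert_incl:
  assumes M: "M \<in> schubert n w" "M \<in> big_cell"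
  shows "incl level M"
proof (rule incl_if_coords[OF M(2) level(1)])
  fix i l k assume i: "i \<le> n" and l: "l \<le> lo level" and k: "k > int i"
  have li: "l \<le> int i" using l lo_nonpos[OF level(1)] by simp
  show "cf k (canv M i l) = 0"
  proof (rule schubert_vanish[OF coord_algebra_intros(2)[OF i li] _ M])
    fix M' assume M': "M' \<in> cell" "M' \<in> big_cell"
    show "cf k (canv M' i l) = 0"
      using canv_low[OF M'(2) level(2)[OF M'(1)] i l level(1)] k li by (simp add: cf_E)
  qed
next
  fix i l k assume i: "i \<le> n" and l: "l \<le> int i" and k: "k > hi level"
  show "cf k (canv M i l) = 0"
  proof (rule schubert_vanish[OF coord_algebra_intros(2)[OF i l] _ M])
    fix M' assume M': "M' \<in> cell" "M' \<in> big_cell"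
    then have "canv M' i l \<in> Lam (hi level)"
      using canv(1)[OF M'(2) i l] incl_upper[OF level(2)[OF M'(1)] i] by blast
    then show "cf k (canv M' i l) = 0" using k by (simp add: Lam_def)
  qed
qed

text \<open>
  A polynomial in the coordinates that separates the base point from a closed set containing the
  Bruhat cell would be a nonzero polynomial along the curve, vanishing for all \<open>t \<noteq> 0\<close>.
\<close>

lemma base_in_schubert: "base_pt n \<in> schubert n w"
  unfolding schubert_eq zclosure_def
proof (rule InterI)
  fix Z assume "Z \<in> {Z. zclosed n Z \<and> cell \<subseteq> Z}"
  then have Z: "zclosed n Z" "cell \<subseteq> Z" by auto
  show "base_pt n \<in> Z"
  proof (rule ccontr)
    assume "base_pt n \<notin> Z"
    then obtain G where G: "G \<in> coord_algebra" "G (base_pt n) \<noteq> 0"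
      "\<forall>M\<in>big_cell. incl level M \<longrightarrow> G M \<noteq> 0 \<longrightarrow> M \<notin> Z"
      using zclosed_separate[OF Z(1) base_pt_big_cell _ incl_base_pt[OF level(1)] level(1)] by blast
    obtain P where P: "\<And>t. G (curve t) = poly P t" using coord_algebra_curve[OF G(1)] by blast
    have "poly P 0 \<noteq> 0" using G(2) P[of 0] by (simp add: curve_0)
    then have "P \<noteq> 0" by auto
    then have "finite (insert 0 {t. poly P t = 0})" using poly_roots_finite by simp
    then obtain t where "t \<notin> insert 0 {t. poly P t = 0}"
      using ex_new_if_finite infinite_UNIV_char_0 by blast
    then have t: "t \<noteq> 0" "G (curve t) \<noteq> 0" by (auto simp: P)
    then have "curve t \<notin> Z" using G(3) curve_big_cell level(2)[OF curve_cell] by blast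
    then show False using Z(2) curve_cell[OF t(1)] by blast
  qed
qed

section \<open>Rank conditions on Schubert varieties\<close>

text \<open>
  The rank of the part of the permutation matrix of \<open>w\<close> in rows \<open>\<ge> i\<close> and columns \<open>\<le> j\<close>.
\<close>

definition rk :: "int \<Rightarrow> int \<Rightarrow> nat" where
  "rk i j = card {k. k \<le> j \<and> w k \<ge> i}"

lemma finite_rk: "finite {k. k \<le> j \<and> w k \<ge> i}"
proof -
  obtain C where C: "\<And>i. \<bar>w i - i\<bar> \<le> C" using w_bounded by blast
  have "{k. k \<le> j \<and> w k \<ge> i} \<subseteq> {i - C..j}"
  proof
    fix k assume "k \<in> {k. k \<le> j \<and> w k \<ge> i}"
    then show "k \<in> {i - C..j}" using C[of k] by auto
  qed
  then show ?thesis by (rule finite_subset) simp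
qed

text \<open>
  The left Iwahori factor preserves \<open>Lam (i - 1)\<close> and the right one \<open>Lam j\<close>. So modulo \<open>Lam (i - 1)\<close>
  the vectors of \<open>M j\<close> are combinations of the images of the \<open>rk i j\<close> basis vectors that \<open>w\<close> moves from
  \<open>Lam j\<close> to indices \<open>\<ge> i\<close>, and more vectors than that are linearly dependent.
\<close>

lemma cell_minor:
  assumes M: "M \<in> cell" and j: "j \<le> n" and v: "\<And>b. b < m \<Longrightarrow> v b \<in> M j"
    and k: "\<And>a. a < m \<Longrightarrow> k a \<ge> i" and m: "m > rk i (int j)"
  shows "det (sqmat m (\<lambda>a b. cf (k a) (v b))) = 0"
proof -
  obtain g g' where g: "g \<in> iwahori n" "g' \<in> iwahori n"
    and Mi: "\<And>i. i \<le> n \<Longrightarrow> M i = (\<lambda>v. g *\<^sub>v (weyl_mat n w *\<^sub>v (g' *\<^sub>v v))) ` Lam (int i)"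
    using cell_mem[OF M] by blast
  have gc: "g \<in> carrier_mat n n" using g by (auto intro!: loop_group_carrier iwahori_loop_group)
  have "\<exists>u. u \<in> Lam (int j) \<and> v b = g *\<^sub>v (weyl_mat n w *\<^sub>v u)" if "b < m" for b
    using v[OF that] iwahori_Lam[OF g(2)] unfolding Mi[OF j] by blast
  then obtain u where u: "\<And>b. b < m \<Longrightarrow> u b \<in> Lam (int j)" "\<And>b. b < m \<Longrightarrow> v b = g *\<^sub>v (weyl_mat n w *\<^sub>v u b)"
    by metis
  define S where "S = w ` {k. k \<le> int j \<and> w k \<ge> i}"
  have S: "l \<in> S \<longleftrightarrow> l \<ge> i \<and> w l \<le> int j" for l
    unfolding S_def image_iff by (auto intro!: exI[of _ "w l"])
  have fS: "finite S" unfolding S_def using finite_rk by simp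
  have "inj w" by (metis injI w_w)
  then have cS: "card S = rk i (int j)"
    unfolding S_def rk_def by (intro card_image) (auto simp: inj_on_def inj_def)
  obtain f where f: "bij_betw f {..<card S} S"
    using ex_bij_betw_nat_finite[OF fS] by (auto simp: atLeast0LessThan)
  obtain c where c: "\<exists>b<m. c b \<noteq> 0" "\<forall>s<card S. (\<Sum>b<m. cf (w (f s)) (u b) * c b) = 0"
    using underdetermined[of "card S" m "\<lambda>s b. cf (w (f s)) (u b)"] m cS by auto
  have c0: "(\<Sum>b<m. cf (w l) (u b) * c b) = 0" if "l \<in> S" for l
  proof -
    have "l \<in> f ` {..<card S}" using f that by (simp add: bij_betw_def)
    then obtain s where "s < card S" "l = f s" by auto
    then show ?thesis using c(2) by simp
  qed
  have expand: "cf (k a) (v b) = (\<Sum>l\<in>S. cf (k a) (g *\<^sub>v E l) * cf (w l) (u b))" if a: "a < m" and b: "b < m" for a b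
  proof -
    define y where "y = weyl_mat n w *\<^sub>v u b"
    have uc: "u b \<in> carrier_vec n" using u(1)[OF b] Lam_carrier by blast
    have yc: "y \<in> carrier_vec n" using uc by (simp add: y_def mult_mat_vec_carrier[of _ n n])
    obtain K where K: "y \<in> Lam K" using bounded_in_Lam[OF yc] by blast
    define K' where "K' = max K (Max (insert 0 S))"
    have K': "y \<in> Lam K'" using K Lam_mono[of K K'] by (auto simp: K'_def)
    have SK: "S \<subseteq> {i - 1<..K'}"
    proof
      fix l assume "l \<in> S"
      moreover from this have "l \<le> Max (insert 0 S)" using fS by (intro Max_ge) auto
      ultimately show "l \<in> {i - 1<..K'}" using S by (auto simp: K'_def)
    qed
    have "cf (k a) (v b) = (\<Sum>l\<in>{i - 1<..K'}. cf l y * cf (k a) (g *\<^sub>v E l))"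
      unfolding u(2)[OF b] y_def[symmetric]
      by (rule cf_mat_vec[OF gc K' iwahori_Lam[OF g(1)]]) (use k[OF a] in auto)
    also have "\<dots> = (\<Sum>l\<in>S. cf l y * cf (k a) (g *\<^sub>v E l))"
    proof (rule sum.mono_neutral_right)
      show "\<forall>l\<in>{i - 1<..K'} - S. cf l y * cf (k a) (g *\<^sub>v E l) = 0"
        using u(1)[OF b] uc by (auto simp: S y_def cf_weyl_mat Lam_def)
    qed (use SK in auto)
    also have "\<dots> = (\<Sum>l\<in>S. cf (k a) (g *\<^sub>v E l) * cf (w l) (u b))"
      using uc by (simp add: y_def cf_weyl_mat mult.commute)
    finally show ?thesis .
  qed
  have "(\<Sum>b<m. cf (k a) (v b) * c b) = 0" if a: "a < m" for a
  proof -
    have "(\<Sum>b<m. cf (k a) (v b) * c b) = (\<Sum>b<m. \<Sum>l\<in>S. cf (k a) (g *\<^sub>v E l) * (cf (w l) (u b) * c b))"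
      using expand[OF a] by (simp add: sum_distrib_right mult.assoc)
    also have "\<dots> = (\<Sum>l\<in>S. cf (k a) (g *\<^sub>v E l) * (\<Sum>b<m. cf (w l) (u b) * c b))"
      by (subst sum.swap) (simp add: sum_distrib_left)
    also have "\<dots> = 0" using c0 by simp
    finally show ?thesis .
  qed
  then show ?thesis unfolding det_0_kernel using c(1) by blast
qed

lemma schubert_minor:
  assumes M: "M \<in> schubert n w" "M \<in> big_cell" and j: "j \<le> n"
    and l: "\<And>b. b < m \<Longrightarrow> l b \<le> int j" and k: "\<And>a. a < m \<Longrightarrow> k a \<ge> i" and m: "m > rk i (int j)"
  shows "det (sqmat m (\<lambda>a b. cf (k a) (canv M j (l b)))) = 0"
proof (rule schubert_vanish[OF _ _ M])
  show "(\<lambda>M. det (sqmat m (\<lambda>a b. cf (k a) (canv M j (l b))))) \<in> coord_algebra"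
    using coord_algebra_intros(2)[OF j] l unfolding coord_algebra_def by (intro fun_algebra_det) auto
  fix M assume M: "M \<in> cell" "M \<in> big_cell"
  show "det (sqmat m (\<lambda>a b. cf (k a) (canv M j (l b)))) = 0"
    using canv(1)[OF M(2) j l] by (intro cell_minor[OF M(1) j _ k m])
qed

end

sublocale affine_involution \<subseteq> germs n "schubert n w" level
  by unfold_locales (use schubert_flags base_in_schubert level schubert_incl in auto)

section \<open>Differentials of the coordinates\<close>

context loop_dim
begin

lemma frame_poly_move:
  assumes f: "f \<in> frame_poly n N d" and x: "x \<in> carrier_mat n n"
    and fr: "\<And>i k. i \<le> n \<Longrightarrow> k < d + i \<Longrightarrow> fr i k \<in> carrier_vec n"
  shows "\<exists>P. \<forall>t. f (move_frame x fr t) = poly P t"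
  using f unfolding frame_poly_def
proof (induction f rule: fun_algebra.induct)
  case (const c)
  show ?case by (intro exI[of _ "[:c:]"]) simp
next
  case (gen f)
  then obtain i k j m where f: "f = (\<lambda>fr. fls_nth (laurent (fr i k $ j)) m)" "i \<le> n" "k < d + i" "j < n"
    by blast
  define l where "l = int j + 1 - int n * m"
  have "f (move_frame x fr t) = poly [:cf l (fr i k), cf l (x *\<^sub>v fr i k):] t" for t
    using fr[OF f(2,3)] x f(4) by (simp add: f(1) cf_coeff move_frame_def l_def cf_add cf_smult del: laurent_add)
  then show ?case by blast
next
  case (add f g)
  then obtain P Q where "\<forall>t. f (move_frame x fr t) = poly P t" "\<forall>t. g (move_frame x fr t) = poly Q t" by blast
  then show ?case by (intro exI[of _ "P + Q"]) simp
next
  case (mult f g)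
  then obtain P Q where "\<forall>t. f (move_frame x fr t) = poly P t" "\<forall>t. g (move_frame x fr t) = poly Q t" by blast
  then show ?case by (intro exI[of _ "P * Q"]) simp
qed

lemma regular_multiple:
  assumes x: "x \<in> carrier_mat n n"
  shows "\<exists>N1. \<forall>N\<ge>N1. elements_mat (zvar powi (int N - 1) \<cdot>\<^sub>m x) \<subseteq> regular_ratfun"
proof -
  obtain s where s: "\<And>r c k. r < n \<Longrightarrow> c < n \<Longrightarrow> k < - s \<Longrightarrow> fls_nth (laurent (x $$ (r, c))) k = 0"
    using entries_bounded_below[OF x] by blast
  have "elements_mat (zvar powi (int N - 1) \<cdot>\<^sub>m x) \<subseteq> regular_ratfun" if "N \<ge> nat s + 1" for N
  proof
    fix f assume "f \<in> elements_mat (zvar powi (int N - 1) \<cdot>\<^sub>m x)"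
    then obtain r c where rc: "r < n" "c < n" "f = zvar powi (int N - 1) * x $$ (r, c)"
      using x by (auto dest!: elements_matD)
    show "f \<in> regular_ratfun"
      unfolding regular_ratfun_iff rc(3) nth_laurent_zvar_mult using s[OF rc(1,2)] that by auto
  qed
  then show ?thesis by blast
qed

lemma linear_form_coord:
  assumes E': "is_tangent_subspace n E'" and "k > l"
  shows "(\<lambda>x. cf k (x *\<^sub>v E l)) \<in> linear_forms n E'"
proof -
  have c: "x \<in> carrier_mat n n" if "x \<in> E'" for x using E' that by (auto simp: is_tangent_subspace_def)
  have "cf k ((x + y) *\<^sub>v E l) = cf k (x *\<^sub>v E l) + cf k (y *\<^sub>v E l)" if "x \<in> E'" "y \<in> E'" for x y
    using c[OF that(1)] c[OF that(2)] by (simp add: add_mult_distrib_mat_vec[of _ n n] cf_add)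
  moreover have "cf k ((const a \<cdot>\<^sub>m x) *\<^sub>v E l) = a * cf k (x *\<^sub>v E l)" if "x \<in> E'" for a x
    using c[OF that] by (simp add: cf_mat_E)
  moreover have "cf k (x *\<^sub>v E l) = 0" if "x \<in> iwahori_lie n" for x
    using regular_mat_E_in_Lam[of x l] that assms(2) by (auto simp: iwahori_lie_def Lam_def)
  ultimately show ?thesis by (simp add: linear_forms_def)
qed

end

context germs
begin

lemma tangent_space_carrier: "x \<in> tangent_space n X \<Longrightarrow> x \<in> carrier_mat n n"
  by (simp add: tangent_space_def)

lemma has_differential_regular: "has_differential n X h x c \<Longrightarrow> h \<in> carrier Rg"
  unfolding has_differential_def carrier_Rg by blast

text \<open>
  The definition of the tangent space makes the directional derivative a function of the germ.
\<close>

lemma differential_eq: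
  assumes x: "x \<in> tangent_space n X" and d: "has_differential n X h x c"
  shows "differential n X (germ n X h) x = c"
proof -
  have h: "h \<in> carrier Rg" using has_differential_regular[OF d] .
  obtain \<delta> where \<delta>: "\<And>h c. has_differential n X h x c \<Longrightarrow> c = \<delta> (germ n X h)"
    using x unfolding tangent_space_def by blast
  have "(THE c. \<exists>h'\<in>germ n X h. has_differential n X h' x c) = c"
  proof (rule the_equality)
    show "\<exists>h'\<in>germ n X h. has_differential n X h' x c" using germ_self[OF h] d by blast
    fix c' assume "\<exists>h'\<in>germ n X h. has_differential n X h' x c'"
    then obtain h' where h': "h' \<in> germ n X h" "has_differential n X h' x c'" by blast
    then have "germ n X h' = germ n X h" using germ_mem[OF h] by blast
    then show "c' = c" using \<delta>[OF h'(2)] \<delta>[OF d] by simp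
  qed
  then show ?thesis using x by (simp add: differential_def)
qed

lemma has_differential_exists:
  assumes h: "h \<in> carrier Rg" and x: "x \<in> carrier_mat n n"
  shows "\<exists>c. has_differential n X h x c"
proof -
  obtain N1 where N1: "\<And>N. N \<ge> N1 \<Longrightarrow> elements_mat (zvar powi (int N - 1) \<cdot>\<^sub>m x) \<subseteq> regular_ratfun"
    using regular_multiple[OF x] by blast
  obtain F G where FG: "F \<in> coord_algebra" "G \<in> coord_algebra" "G (base_pt n) \<noteq> 0" "near (\<lambda>M. h M = F M / G M)"
    using regularE[OF h] .
  define N where "N = max N0 N1"
  have N: "N \<ge> N0" "N \<ge> N1" "N \<ge> 1" using N0 by (auto simp: N_def)
  obtain Z f g where lq: "local_quotient n X N (dim0 N) Z f g h"
    using local_quotientI[OF FG N(1)] by blast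
  define fr where "fr = canframe (base_pt n)"
  have fr: "is_frame n N (dim0 N) (base_pt n) fr"
    unfolding fr_def by (rule canframe_is_frame[OF base_pt_big_cell incl_base_pt[OF N(3)] N(3)])
  have frE: "fr i b = E (int i - int b)" if "i \<le> n" for i b
    using that by (simp add: fr_def canframe_def canv_base_pt)
  have fg: "f \<in> frame_poly n N (dim0 N)" "g \<in> frame_poly n N (dim0 N)"
    using lq by (simp_all add: local_quotient_def)
  obtain P where P: "\<And>t. f (move_frame x fr t) = poly P t"
    using frame_poly_move[OF fg(1) x, of fr] frE by auto
  obtain Q where Q: "\<And>t. g (move_frame x fr t) = poly Q t"
    using frame_poly_move[OF fg(2) x, of fr] frE by auto
  have "is_frame n N (dim0 N) (base_pt n) (move_frame x fr 0)"
  proof (rule frame_if_det[OF base_pt_big_cell incl_base_pt[OF N(3)] N(3)])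
    have eq: "move_frame x fr 0 i k = E (int i - int k)" if "i \<le> n" for i k
      using that x by (intro cf_eqI) (simp_all add: move_frame_def frE cf_add cf_smult del: const_0)
    show "move_frame x fr 0 i k \<in> base_pt n i" if "i \<le> n" for i k
      using that by (simp add: eq base_pt_Lam)
    fix i assume i: "i \<le> n"
    have "sqmat (dim0 N + i) (umat (move_frame x fr 0) i) = 1\<^sub>m (dim0 N + i)"
      by (rule eq_matI) (auto simp: umat_def eq[OF i] cf_E)
    then show "det (sqmat (dim0 N + i) (umat (move_frame x fr 0) i)) \<noteq> 0" by simp
  qed
  then have "g (move_frame x fr 0) \<noteq> 0"
    using near_base[OF local_quotient_near[OF lq]] by blast
  then have "poly Q 0 \<noteq> 0" by (simp add: Q)
  then have "((\<lambda>t. poly P t / poly Q t) has_field_derivative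
      (poly (pderiv P) 0 * poly Q 0 - poly P 0 * poly (pderiv Q) 0) / (poly Q 0 * poly Q 0)) (at 0)"
    by (intro DERIV_divide poly_DERIV)
  then show ?thesis
    unfolding has_differential_def P[symmetric] Q[symmetric] using lq fr N1[OF N(2)] by blast
qed

text \<open>
  Along \<open>fr + t x fr\<close>, starting from the canonical frame of the base point, the square matrices
  \<open>umat\<close> are the identity at \<open>t = 0\<close> and the coefficients above \<open>i\<close> are \<open>t\<close> times those of \<open>x fr\<close>. So
  the numerator in Cramer's rule is \<open>t\<close> times a polynomial whose value at 0 is the matrix entry.
\<close>

lemma coord_has_differential:
  assumes i: "i \<le> n" and l: "l \<le> int i" and k: "k > int i" and x: "x \<in> carrier_mat n n"
  shows "has_differential n X (\<lambda>M. cf k (canv M i l)) x (cf k (x *\<^sub>v E l))"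
proof -
  obtain N1 where N1: "\<And>N. N \<ge> N1 \<Longrightarrow> elements_mat (zvar powi (int N - 1) \<cdot>\<^sub>m x) \<subseteq> regular_ratfun"
    using regular_multiple[OF x] by blast
  \<comment> \<open>a level high enough for \<open>X\<close>, for the poles of \<open>x\<close>, and for both indices \<open>k\<close> and \<open>l\<close>\<close>
  define N where "N = max (max N0 N1) (nat (\<bar>l\<bar> + \<bar>k\<bar>) + 2)"
  have N: "N \<ge> N0" "N \<ge> N1" "int N \<ge> \<bar>l\<bar> + \<bar>k\<bar> + 2" "N \<ge> 1" by (auto simp: N_def)
  have "1 * (int N - 1) \<le> int n * (int N - 1)" using n_pos N(4) by (intro mult_right_mono) auto
  then have nN: "int n * (int N - 1) \<ge> int N - 1" by simp
  have l_low: "l > lo N" and k_up: "k \<le> hi N"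
    using nN N(3) by (auto simp: algebra_simps)
  define m where "m = dim0 N + i"
  define a where "a = nat (int i - l)"
  have a: "a < m" "l = int i - int a" using l l_low int_dim0[OF N(4)] by (auto simp: a_def m_def)
  have k_low: "k > lo N" using k lo_nonpos[OF N(4)] by linarith
  define Z where "Z = {M \<in> flags n. M \<in> big_cell \<longrightarrow> (1::complex) = 0}"
  have Z: "zclosed n Z" unfolding Z_def by (rule coord_algebra_zclosed[OF coord_algebra_intros(1)])
  have XZ: "M \<in> big_cell \<and> incl N M" if "M \<in> X - Z" for M
    using that X_flags X_level incl_mono[OF _ N(1)] by (auto simp: Z_def)
  have lq: "local_quotient n X N (dim0 N) Z (coordnum N i k a) (udet N) (\<lambda>M. cf k (canv M i l))"
    unfolding local_quotient_def
  proof (intro conjI ballI allI impI Z udet_frame_poly coordnum_frame_poly i N(4) k_low k_up)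
    show "base_pt n \<notin> Z" using base_pt_big_cell by (simp add: Z_def)
    show "X - Z \<subseteq> flags_lvl n N (dim0 N)" using XZ N(4) flags_lvl_iff by blast
    show "a < dim0 N + i" using a by (simp add: m_def)
    fix M fr assume M: "M \<in> X - Z" and fr: "is_frame n N (dim0 N) M fr"
    note bc = conjunct1[OF XZ[OF M]] and inc = conjunct2[OF XZ[OF M]]
    show u: "udet N fr \<noteq> 0" using udet_nonzero_iff[OF big_cell_flags[OF bc] inc N(4) fr] bc by simp
    show "cf k (canv M i l) = coordnum N i k a fr / udet N fr"
      using coordnum[OF bc inc N(4) fr i a(1)[unfolded m_def] k_low] u
      unfolding a(2)[symmetric] by (simp add: field_simps)
  qed
  define fr where "fr = canframe (base_pt n)"
  have fr: "is_frame n N (dim0 N) (base_pt n) fr"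
    unfolding fr_def by (rule canframe_is_frame[OF base_pt_big_cell incl_base_pt[OF N(4)] N(4)])
  have frE: "fr i' b = E (int i' - int b)" if "i' \<le> n" for i' b
    using that by (simp add: fr_def canframe_def canv_base_pt)
  have frc: "fr i' b \<in> carrier_vec n" if "i' \<le> n" for i' b using frE[OF that] by simp
  define mv where "mv = move_frame x fr"
  have um0: "umat (mv 0) i' a' b = (if a' = b then 1 else 0)" if "i' \<le> n" for i' a' b
    using x that frE[OF that, of b] by (simp add: umat_def mv_def move_frame_def cf_add cf_def)
      (simp add: cf_E flip: cf_def)
  have sq0: "sqmat q (umat (mv 0) i') = 1\<^sub>m q" if "i' \<le> n" for i' q
    by (rule eq_matI) (auto simp: um0[OF that])
  have adj0: "adj m (umat (mv 0) i) b a = (if b = a then 1 else 0)" if "b < m" for b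
  proof -
    have "(\<Sum>b'<m. umat (mv 0) i b b' * adj m (umat (mv 0) i) b' a) = adj m (umat (mv 0) i) b a"
      using that by (simp add: um0[OF i] if_distrib[of "\<lambda>x. x * _"] cong: if_cong)
    then show ?thesis
      using mult_adj[OF a(1) that, of "umat (mv 0) i"] by (cases "b = a") (simp_all add: sq0[OF i])
  qed
  have "\<forall>b. \<exists>P. b < m \<longrightarrow> (\<forall>t. adj m (umat (mv t) i) b a = poly P t)"
  proof (intro allI)
    fix b
    show "\<exists>P. b < m \<longrightarrow> (\<forall>t. adj m (umat (mv t) i) b a = poly P t)"
    proof (cases "b < m")
      case True
      have "(\<lambda>fr. adj m (umat fr i) b a) \<in> frame_poly n N (dim0 N)"
        using umat_frame_poly[OF N(4) i] a(1) True unfolding frame_poly_def m_def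
        by (intro fun_algebra_adj) auto
      from frame_poly_move[OF this x, of fr] show ?thesis using frc unfolding mv_def by auto
    qed simp
  qed
  then obtain PA where PA: "\<And>b t. b < m \<Longrightarrow> adj m (umat (mv t) i) b a = poly (PA b) t" by metis
  have "(\<lambda>fr. \<Prod>i'\<in>{..n} - {i}. det (sqmat (dim0 N + i') (umat fr i'))) \<in> frame_poly n N (dim0 N)"
    using det_frame_poly[OF N(4)] unfolding frame_poly_def
    by (intro fun_algebra_prod[of _ "\<lambda>i' fr. det (sqmat (dim0 N + i') (umat fr i'))"]) auto
  from frame_poly_move[OF this x, of fr]
  obtain PP where PP: "\<And>t. (\<Prod>i'\<in>{..n} - {i}. det (sqmat (dim0 N + i') (umat (mv t) i'))) = poly PP t"
    using frc unfolding mv_def by auto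
  from frame_poly_move[OF udet_frame_poly[OF N(4)] x, of fr]
  obtain PU where PU: "\<And>t. udet N (mv t) = poly PU t" using frc unfolding mv_def by auto
  have PU0: "poly PU 0 = 1" unfolding PU[symmetric] udet_def by (simp add: sq0)
  have PP0: "poly PP 0 = 1" unfolding PP[symmetric] by (simp add: sq0)
  define R where "R = (\<Sum>b<m. [:cf k (x *\<^sub>v E (int i - int b)):] * PA b) * PP"
  have num: "coordnum N i k a (mv t) = t * poly R t" for t
  proof -
    have "cf k (mv t i b) = t * cf k (x *\<^sub>v E (int i - int b))" for b
      using x frE[OF i, of b] k by (simp add: mv_def move_frame_def cf_add cf_smult cf_E)
    then have "coordnum N i k a (mv t) = (\<Sum>b<m. poly (PA b) t * (t * cf k (x *\<^sub>v E (int i - int b)))) * poly PP t"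
      unfolding coordnum_def PP using PA by (simp add: m_def)
    then show ?thesis by (simp add: R_def poly_sum sum_distrib_left mult_ac)
  qed
  have R0: "poly R 0 = cf k (x *\<^sub>v E l)"
  proof -
    have "poly (PA b) 0 = (if b = a then 1 else 0)" if "b < m" for b
      using adj0[OF that] PA[OF that] by simp
    then have "poly R 0 = (\<Sum>b<m. if b = a then cf k (x *\<^sub>v E (int i - int b)) else 0)"
      unfolding R_def by (simp add: poly_sum PP0 if_distrib[of "\<lambda>y. _ * y"] cong: if_cong sum.cong_simp)
    then show ?thesis using a by simp
  qed
  have "((\<lambda>t. t * poly R t / poly PU t) has_field_derivative poly R 0) (at 0)"
    by (auto intro!: derivative_eq_intros simp: PU0)
  then have "((\<lambda>t. coordnum N i k a (mv t) / udet N (mv t)) has_field_derivative cf k (x *\<^sub>v E l)) (at 0)"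
    by (simp add: num PU R0)
  then show ?thesis
    unfolding has_differential_def mv_def using lq fr N1[OF N(2)] by blast
qed

section \<open>Determinantal equations of the tangent cone\<close>

text \<open>
  \<open>q\<close> is a form of degree \<open>r\<close> on the tangent space whose image in the graded ring is the class of \<open>h\<close>.
\<close>

definition lifts :: "nat \<Rightarrow> (ratfun mat \<Rightarrow> complex) \<Rightarrow> (flag \<Rightarrow> complex) \<Rightarrow> bool" where
  "lifts r q h \<longleftrightarrow> h \<in> carrier Rg \<and> germ n X h \<in> mpow r \<and>
     (restrict q (tangent_space n X), gr_homog n X r (germ n X h)) \<in> sym_to_gr n X"

lemma lifts_const: "lifts 0 (\<lambda>_. c) (\<lambda>_. c)"
  unfolding lifts_def using regular_const germ_closed sym_to_gr.const by auto

lemma lifts_zero: "lifts r (\<lambda>_. 0) (\<lambda>_. 0)"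
  using lifts_const[of 0] zero_mpow gr_homog_zero[OF zero_mpow, of r] gr_homog_zero[OF zero_mpow, of 0]
  unfolding lifts_def germ_zero by simp

lemma lifts_mult:
  assumes "lifts r q h" "lifts s q' h'"
  shows "lifts (r + s) (\<lambda>x. q x * q' x) (\<lambda>M. h M * h' M)"
proof -
  have r: "h \<in> carrier Rg" "h' \<in> carrier Rg" and p: "germ n X h \<in> mpow r" "germ n X h' \<in> mpow s"
    using assms by (auto simp: lifts_def)
  have s: "(restrict q (tangent_space n X), gr_homog n X r (germ n X h)) \<in> sym_to_gr n X"
    "(restrict q' (tangent_space n X), gr_homog n X s (germ n X h')) \<in> sym_to_gr n X"
    using assms by (simp_all only: lifts_def)
  have "(\<lambda>x\<in>tangent_space n X. restrict q (tangent_space n X) x * restrict q' (tangent_space n X) x)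
      = restrict (\<lambda>x. q x * q' x) (tangent_space n X)" by (rule restrict_ext) simp
  with sym_to_gr.mult[OF s]
  have "(restrict (\<lambda>x. q x * q' x) (tangent_space n X), gr_homog n X (r + s) (germ n X (\<lambda>M. h M * h' M)))
      \<in> sym_to_gr n X"
    by (simp only: gr_homog_mult[OF p] germ_mult[OF r])
  moreover have "germ n X (\<lambda>M. h M * h' M) \<in> mpow (r + s)" using mpow_mult[OF p] by (simp only: germ_mult[OF r])
  ultimately show ?thesis unfolding lifts_def using regular_mult[OF r] by (intro conjI)
qed

lemma lifts_add:
  assumes "lifts r q h" "lifts r q' h'"
  shows "lifts r (\<lambda>x. q x + q' x) (\<lambda>M. h M + h' M)"
proof -
  have r: "h \<in> carrier Rg" "h' \<in> carrier Rg" and p: "germ n X h \<in> mpow r" "germ n X h' \<in> mpow r"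
    using assms by (auto simp: lifts_def)
  have s: "(restrict q (tangent_space n X), gr_homog n X r (germ n X h)) \<in> sym_to_gr n X"
    "(restrict q' (tangent_space n X), gr_homog n X r (germ n X h')) \<in> sym_to_gr n X"
    using assms by (simp_all only: lifts_def)
  have "(\<lambda>x\<in>tangent_space n X. restrict q (tangent_space n X) x + restrict q' (tangent_space n X) x)
      = restrict (\<lambda>x. q x + q' x) (tangent_space n X)" by (rule restrict_ext) simp
  with sym_to_gr.add[OF s]
  have "(restrict (\<lambda>x. q x + q' x) (tangent_space n X), gr_homog n X r (germ n X (\<lambda>M. h M + h' M)))
      \<in> sym_to_gr n X"
    by (simp only: gr_homog_add[OF germ_closed[OF r(1)] germ_closed[OF r(2)]] germ_add[OF r])
  moreover have "germ n X (\<lambda>M. h M + h' M) \<in> mpow r" using add_mpow[OF p] by (simp only: germ_add[OF r])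
  ultimately show ?thesis unfolding lifts_def using regular_add[OF r] by (intro conjI)
qed

lemma lifts_coord:
  assumes i: "i \<le> n" and l: "l \<le> int i" and k: "k > int i"
  shows "lifts 1 (\<lambda>x. cf k (x *\<^sub>v E l)) (\<lambda>M. cf k (canv M i l))"
proof -
  define F where "F = (\<lambda>M. cf k (canv M i l))"
  have F: "F \<in> carrier Rg"
    unfolding F_def by (intro coord_algebra_regular coord_algebra_intros(2) i l)
  have "F (base_pt n) = 0" using k l by (simp add: F_def canv_base_pt[OF i l] cf_E)
  then have m: "germ n X F \<in> max_ideal n X" by (simp add: max_ideal_iff[OF F])
  have "differential n X (germ n X F) = restrict (\<lambda>x. cf k (x *\<^sub>v E l)) (tangent_space n X)"
  proof
    fix x
    show "differential n X (germ n X F) x = restrict (\<lambda>x. cf k (x *\<^sub>v E l)) (tangent_space n X) x"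
    proof (cases "x \<in> tangent_space n X")
      case True
      then show ?thesis
        using differential_eq[OF True] coord_has_differential[OF i l k tangent_space_carrier[OF True]]
        by (simp add: F_def)
    qed (simp add: differential_def)
  qed
  then show ?thesis
    using sym_to_gr.lin[OF m] F m unfolding lifts_def F_def[symmetric] mpow_1 by simp
qed

lemma lifts_prod:
  "(\<And>a. a < m \<Longrightarrow> lifts 1 (q a) (h a)) \<Longrightarrow> lifts m (\<lambda>x. \<Prod>a<m. q a x) (\<lambda>M. \<Prod>a<m. h a M)"
proof (induction m)
  case 0
  show ?case using lifts_const[of 1] by simp
next
  case (Suc m)
  then have "lifts (m + 1) (\<lambda>x. (\<Prod>a<m. q a x) * q m x) (\<lambda>M. (\<Prod>a<m. h a M) * h m M)"
    by (intro lifts_mult) auto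
  then show ?case by simp
qed

lemma lifts_sum:
  assumes "\<And>p. p \<in> S \<Longrightarrow> lifts m (q p) (h p)"
  shows "lifts m (\<lambda>x. \<Sum>p\<in>S. q p x) (\<lambda>M. \<Sum>p\<in>S. h p M)"
  using assms
proof (induction S rule: infinite_finite_induct)
  case (insert p S)
  then have "lifts m (\<lambda>x. q p x + (\<Sum>p\<in>S. q p x)) (\<lambda>M. h p M + (\<Sum>p\<in>S. h p M))"
    by (intro lifts_add) auto
  with insert show ?case by simp
qed (simp_all add: lifts_zero)

lemma lifts_det:
  assumes "\<And>a b. a < m \<Longrightarrow> b < m \<Longrightarrow> lifts 1 (\<lambda>x. A x a b) (\<lambda>M. B M a b)"
  shows "lifts m (\<lambda>x. det (sqmat m (A x))) (\<lambda>M. det (sqmat m (B M)))"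
  unfolding det_sqmat
proof (rule lifts_sum)
  fix p assume "p \<in> {p. p permutes {..<m}}"
  then have "p a < m" if "a < m" for a using that permutes_in_image[of p "{..<m}" a] by simp
  then have "lifts m (\<lambda>x. \<Prod>a<m. A x a (p a)) (\<lambda>M. \<Prod>a<m. B M a (p a))"
    by (intro lifts_prod assms)
  from lifts_mult[OF lifts_const[of "signof p"] this]
  show "lifts m (\<lambda>x. signof p * (\<Prod>a<m. A x a (p a))) (\<lambda>M. signof p * (\<Prod>a<m. B M a (p a)))"
    by simp
qed

text \<open>
  As a polynomial in the coordinates the minor is homogeneous of degree \<open>m\<close>, so its class in degree
  \<open>m\<close> is the image of the same minor of \<open>x\<close>; and it vanishes near the base point.
\<close>

lemma det_in_tangent_cone:
  assumes E': "is_tangent_subspace n E'" "tangent_space n X \<subseteq> E'" and j: "j \<le> n"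
    and l: "\<And>b. b < m \<Longrightarrow> l b \<le> int j" and k: "\<And>a. a < m \<Longrightarrow> k a > int j"
    and vanish: "\<And>M. M \<in> X \<Longrightarrow> M \<in> big_cell \<Longrightarrow> det (sqmat m (\<lambda>a b. cf (k a) (canv M j (l b)))) = 0"
  shows "(\<lambda>x\<in>E'. det (sqmat m (\<lambda>a b. cf (k a) (x *\<^sub>v E (l b))))) \<in> tangent_cone n X E'"
proof -
  define q where "q = (\<lambda>x. det (sqmat m (\<lambda>a b. cf (k a) (x *\<^sub>v E (l b)))))"
  define h where "h = (\<lambda>M. det (sqmat m (\<lambda>a b. cf (k a) (canv M j (l b)))))"
  have "lifts m q h"
    unfolding q_def h_def using l k by (intro lifts_det lifts_coord j) auto
  then have h: "h \<in> carrier Rg"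
    and s: "(restrict q (tangent_space n X), gr_homog n X m (germ n X h)) \<in> sym_to_gr n X"
    by (auto simp: lifts_def)
  have "germ n X h = germ n X (\<lambda>_. 0)"
    unfolding germ_eq_iff[OF h regular_const] using vanish by (intro near_always) (simp add: h_def)
  then have "gr_homog n X m (germ n X h) = \<zero>\<^bsub>gr_ring n X\<^esub>"
    by (simp add: germ_zero gr_homog_zero zero_mpow del: max_ideal_pow.simps)
  moreover have "restrict (restrict q E') (tangent_space n X) = restrict q (tangent_space n X)"
    using E'(2) by (intro restrict_ext) auto
  moreover have "q \<in> fun_algebra (linear_forms n E')"
    unfolding q_def
  proof (rule fun_algebra_det)
    fix a b assume "a < m" "b < m"
    then have "k a > l b" using l[of b] k[of a] by simp
    then show "(\<lambda>x. cf (k a) (x *\<^sub>v E (l b))) \<in> fun_algebra (linear_forms n E')"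
      by (intro fun_algebra.gen linear_form_coord E'(1))
  qed
  ultimately show ?thesis
    using s unfolding tangent_cone_def poly_funs_def q_def[symmetric] by auto
qed

end

section \<open>Orders of vanishing along the curve\<close>

context affine_involution
begin

abbreviation "XS \<equiv> schubert n w"

lemma curve_schubert: "curve t \<in> XS"
  using curve_cell[of t] cell_subset_schubert base_in_schubert curve_0 by (cases "t = 0") auto

lemma poly_eventually_nonzero:
  fixes P :: "complex poly"
  assumes "poly P 0 \<noteq> 0"
  shows "\<forall>\<^sub>F t in nhds 0. poly P t \<noteq> 0"
proof -
  have "open {t. poly P t \<noteq> 0}" by (intro open_Collect_neq continuous_intros)
  then show ?thesis using eventually_nhds_in_open[of "{t. poly P t \<noteq> 0}" 0] assms by simp
qed

lemma near_curve:
  assumes "near P"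
  shows "\<forall>\<^sub>F t in nhds 0. P (curve t)"
proof -
  obtain G where G: "G \<in> coord_algebra" "G (base_pt n) \<noteq> 0" "\<forall>M\<in>XS. M \<in> big_cell \<longrightarrow> G M \<noteq> 0 \<longrightarrow> P M"
    using nearE[OF assms] .
  obtain Q where Q: "\<And>t. G (curve t) = poly Q t" using coord_algebra_curve[OF G(1)] by blast
  have "poly Q 0 \<noteq> 0" using G(2) Q[of 0] by (simp add: curve_0)
  from poly_eventually_nonzero[OF this] show ?thesis
    by (rule eventually_mono) (use G(3) curve_schubert curve_big_cell Q in metis)
qed

lemma regular_curve:
  assumes "h \<in> carrier Rg"
  obtains P Q where "poly Q 0 \<noteq> 0" "\<forall>\<^sub>F t in nhds 0. h (curve t) = poly P t / poly Q t"
proof -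
  obtain F G where FG: "F \<in> coord_algebra" "G \<in> coord_algebra" "G (base_pt n) \<noteq> 0" "near (\<lambda>M. h M = F M / G M)"
    using regularE[OF assms] .
  obtain P where P: "\<And>t. F (curve t) = poly P t" using coord_algebra_curve[OF FG(1)] by blast
  obtain Q where Q: "\<And>t. G (curve t) = poly Q t" using coord_algebra_curve[OF FG(2)] by blast
  show ?thesis
    using that[of Q P] near_curve[OF FG(4)] FG(3) Q[of 0] by (simp add: curve_0 P Q)
qed

lemma regular_curve_deriv:
  assumes "h \<in> carrier Rg"
  shows "\<exists>c. ((\<lambda>t. h (curve t)) has_field_derivative c) (at 0)"
proof -
  obtain P Q where PQ: "poly Q 0 \<noteq> 0" "\<forall>\<^sub>F t in nhds 0. h (curve t) = poly P t / poly Q t"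
    using regular_curve[OF assms] .
  have "((\<lambda>t. poly P t / poly Q t) has_field_derivative
      (poly (pderiv P) 0 * poly Q 0 - poly P 0 * poly (pderiv Q) 0) / (poly Q 0 * poly Q 0)) (at 0)"
    using PQ(1) by (intro DERIV_divide poly_DERIV)
  then show ?thesis using DERIV_cong_ev[OF refl PQ(2) refl] by blast
qed

text \<open>
  For small \<open>t\<close> the moved frame \<open>fr + t x fr\<close> is a frame of \<open>curve t\<close>, because its vectors lie in the
  lattices of that flag and the relevant determinants do not vanish.
\<close>

lemma has_differential_low_mat:
  assumes "has_differential n XS h low_mat c"
  shows "((\<lambda>t. h (curve t)) has_field_derivative c) (at 0)"
proof -
  obtain N d Z f g fr where lq: "local_quotient n XS N d Z f g h" and fr: "is_frame n N d (base_pt n) fr"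
    and der: "((\<lambda>t. f (move_frame low_mat fr t) / g (move_frame low_mat fr t)) has_field_derivative c) (at 0)"
    using assms unfolding has_differential_def by blast
  note N = local_quotient_level[OF lq]
  have frL: "fr i k \<in> Lam (int i)" if "i \<le> n" "k < d + i" for i k
    using frame_in[OF fr that] base_pt_Lam[OF that(1)] by simp
  have in_curve: "move_frame low_mat fr t i k \<in> curve t i" if "i \<le> n" "k < d + i" for i k t
    unfolding curve_Lam[OF that(1)] move_frame_def using frL[OF that] by blast
  obtain P where P: "\<And>t. udet N (move_frame low_mat fr t) = poly P t"
    using frame_poly_move[OF udet_frame_poly[OF N(1)] mats_carrier(2), of fr] frL Lam_carrier N(2) by metis
  have "move_frame low_mat fr 0 i k = fr i k" if "i \<le> n" "k < d + i" for i k
    using Lam_carrier[OF frL[OF that]]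
    by (intro cf_eqI) (simp_all add: move_frame_def cf_add cf_smult del: const_0)
  then have "umat (move_frame low_mat fr 0) i a b = umat fr i a b" if "i \<le> n" "b < d + i" for i a b
    using that by (simp add: umat_def)
  then have "sqmat (dim0 N + i) (umat (move_frame low_mat fr 0) i) = sqmat (dim0 N + i) (umat fr i)"
    if "i \<le> n" for i
    using that N(2) by (intro eq_matI) auto
  then have "udet N (move_frame low_mat fr 0) = udet N fr" by (simp add: udet_def)
  also have "udet N fr \<noteq> 0"
    using udet_nonzero_iff[OF base_pt_flags incl_base_pt[OF N(1)] N(1)] fr N(2) base_pt_big_cell by simp
  finally have "poly P 0 \<noteq> 0" by (simp add: P)
  have ev: "\<forall>\<^sub>F t in nhds 0. h (curve t) = f (move_frame low_mat fr t) / g (move_frame low_mat fr t)"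
    using near_curve[OF local_quotient_near[OF lq]] poly_eventually_nonzero[OF \<open>poly P 0 \<noteq> 0\<close>]
  proof eventually_elim
    case (elim t)
    have inc: "incl N (curve t)" using elim flags_lvl_incl by blast
    have "udet N (move_frame low_mat fr t) \<noteq> 0" using elim P by simp
    then have "det (sqmat (dim0 N + i) (umat (move_frame low_mat fr t) i)) \<noteq> 0" if "i \<le> n" for i
      using that by (auto simp: udet_def)
    then have "is_frame n N (dim0 N) (curve t) (move_frame low_mat fr t)"
      using in_curve N(2) by (intro frame_if_det[OF curve_big_cell inc N(1)]) auto
    then show ?case using elim N(2) by blast
  qed
  show ?thesis using der DERIV_cong_ev[OF refl ev refl] by blast
qed

text \<open>
  The coefficient of \<open>t^k\<close> along the curve, for germs that vanish there to order \<open>k\<close>.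
\<close>

definition ordlim :: "nat \<Rightarrow> (flag \<Rightarrow> complex) set \<Rightarrow> complex \<Rightarrow> bool" where
  "ordlim k a c \<longleftrightarrow> a \<in> carrier LR \<and> (\<forall>h\<in>a. ((\<lambda>t. h (curve t) / t ^ k) \<longlongrightarrow> c) (at 0))"

lemma ordlim_germ:
  assumes h: "h \<in> carrier Rg" and lim: "((\<lambda>t. h (curve t) / t ^ k) \<longlongrightarrow> c) (at 0)"
  shows "ordlim k (germ n XS h) c"
proof -
  have "((\<lambda>t. h' (curve t) / t ^ k) \<longlongrightarrow> c) (at 0)" if "h' \<in> germ n XS h" for h'
  proof -
    have "near (\<lambda>M. h' M = h M)" using that germ_eq[OF h] by simp
    from near_curve[OF this] have "\<forall>\<^sub>F t in at 0. h' (curve t) = h (curve t)"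
      unfolding eventually_nhds_conv_at by simp
    then have "\<forall>\<^sub>F t in at 0. h' (curve t) / t ^ k = h (curve t) / t ^ k"
      by (rule eventually_mono) simp
    from tendsto_cong[OF this] show ?thesis using lim by blast
  qed
  then show ?thesis using germ_closed[OF h] by (simp add: ordlim_def)
qed

lemma ordlimE:
  assumes "ordlim k a c"
  obtains h where "h \<in> carrier Rg" "a = germ n XS h" "((\<lambda>t. h (curve t) / t ^ k) \<longlongrightarrow> c) (at 0)"
proof -
  have "a \<in> carrier LR" using assms by (simp add: ordlim_def)
  then obtain h where h: "h \<in> carrier Rg" "a = germ n XS h" using germ_surj by blast
  then have "h \<in> a" using germ_self by simp
  then show ?thesis using that h assms by (simp add: ordlim_def)
qed

lemma ordlim_unique:
  assumes "ordlim k a c" "ordlim k a c'"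
  shows "c = c'"
proof -
  obtain h where h: "h \<in> carrier Rg" "a = germ n XS h" "((\<lambda>t. h (curve t) / t ^ k) \<longlongrightarrow> c) (at 0)"
    using ordlimE[OF assms(1)] .
  have "((\<lambda>t. h (curve t) / t ^ k) \<longlongrightarrow> c') (at 0)"
    using assms(2) germ_self[OF h(1)] h(2) by (simp add: ordlim_def)
  then show ?thesis using h(3) tendsto_unique[OF at_neq_bot] by blast
qed

lemma ordlim_add:
  assumes "ordlim k a c" "ordlim k b c'"
  shows "ordlim k (a \<oplus>\<^bsub>LR\<^esub> b) (c + c')"
proof -
  obtain h where h: "h \<in> carrier Rg" "a = germ n XS h" "((\<lambda>t. h (curve t) / t ^ k) \<longlongrightarrow> c) (at 0)"
    using ordlimE[OF assms(1)] .
  obtain h' where h': "h' \<in> carrier Rg" "b = germ n XS h'" "((\<lambda>t. h' (curve t) / t ^ k) \<longlongrightarrow> c') (at 0)"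
    using ordlimE[OF assms(2)] .
  have "((\<lambda>t. (h (curve t) + h' (curve t)) / t ^ k) \<longlongrightarrow> c + c') (at 0)"
    using tendsto_add[OF h(3) h'(3)] by (simp add: add_divide_distrib)
  then show ?thesis
    unfolding h(2) h'(2) germ_add[OF h(1) h'(1)] by (intro ordlim_germ regular_add h(1) h'(1))
qed

lemma ordlim_mult:
  assumes "ordlim k a c" "ordlim l b c'"
  shows "ordlim (k + l) (a \<otimes>\<^bsub>LR\<^esub> b) (c * c')"
proof -
  obtain h where h: "h \<in> carrier Rg" "a = germ n XS h" "((\<lambda>t. h (curve t) / t ^ k) \<longlongrightarrow> c) (at 0)"
    using ordlimE[OF assms(1)] .
  obtain h' where h': "h' \<in> carrier Rg" "b = germ n XS h'" "((\<lambda>t. h' (curve t) / t ^ l) \<longlongrightarrow> c') (at 0)"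
    using ordlimE[OF assms(2)] .
  have "((\<lambda>t. (h (curve t) * h' (curve t)) / t ^ (k + l)) \<longlongrightarrow> c * c') (at 0)"
    using tendsto_mult[OF h(3) h'(3)] by (simp add: power_add)
  then show ?thesis
    unfolding h(2) h'(2) germ_mult[OF h(1) h'(1)] by (intro ordlim_germ regular_mult h(1) h'(1))
qed

lemma ordlim_Suc:
  assumes "ordlim (Suc k) a c"
  shows "ordlim k a 0"
proof -
  obtain h where h: "h \<in> carrier Rg" "a = germ n XS h" "((\<lambda>t. h (curve t) / t ^ Suc k) \<longlongrightarrow> c) (at 0)"
    using ordlimE[OF assms] .
  have "((\<lambda>t. t * (h (curve t) / t ^ Suc k)) \<longlongrightarrow> 0 * c) (at 0)"
    by (intro tendsto_mult h(3) tendsto_ident_at)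
  moreover have "\<forall>\<^sub>F t in at 0. t * (h (curve t) / t ^ Suc k) = h (curve t) / t ^ k"
    by (auto simp: eventually_at_filter)
  ultimately have "((\<lambda>t. h (curve t) / t ^ k) \<longlongrightarrow> 0) (at 0)" by (simp add: tendsto_cong)
  then show ?thesis unfolding h(2) by (intro ordlim_germ h(1))
qed

lemma ordlim_zero: "ordlim k \<zero>\<^bsub>LR\<^esub> 0"
  unfolding germ_zero[symmetric] by (intro ordlim_germ regular_const) simp

lemma ordlim_const: "ordlim 0 (germ n XS (\<lambda>_. c)) c"
  by (intro ordlim_germ regular_const) simp

lemma ordlim_deriv:
  assumes "h \<in> carrier Rg" "h (base_pt n) = 0" "((\<lambda>t. h (curve t)) has_field_derivative c) (at 0)"
  shows "ordlim 1 (germ n XS h) c"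
  using assms(3) assms(2) unfolding DERIV_def by (intro ordlim_germ assms(1)) (simp add: curve_0)

lemma mpow_ordlim: "a \<in> mpow k \<Longrightarrow> \<exists>c. ordlim k a c"
proof (induction k arbitrary: a)
  case 0
  then obtain h where h: "h \<in> carrier Rg" "a = germ n XS h" using germ_surj by auto
  obtain c where "((\<lambda>t. h (curve t)) has_field_derivative c) (at 0)" using regular_curve_deriv[OF h(1)] by blast
  then have "((\<lambda>t. h (curve t)) \<longlongrightarrow> h (curve 0)) (at 0)"
    using DERIV_isCont isCont_def by blast
  then show ?case using ordlim_germ[OF h(1), of 0 "h (curve 0)"] h(2) by auto
next
  case (Suc k)
  from Suc.prems have "a \<in> ideal_prod LR (max_ideal n XS) (mpow k)" by simp
  then show ?case
  proof (induction a rule: ideal_prod.induct)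
    case (prod x y)
    then obtain h where h: "h \<in> carrier Rg" "h (base_pt n) = 0" "x = germ n XS h" by (auto simp: max_ideal_def)
    obtain c where "((\<lambda>t. h (curve t)) has_field_derivative c) (at 0)" using regular_curve_deriv[OF h(1)] by blast
    then have "ordlim 1 x c" using ordlim_deriv h by simp
    moreover obtain c' where "ordlim k y c'" using Suc.IH[OF prod(2)] by blast
    ultimately show ?case using ordlim_mult[of 1 x c k y c'] by auto
  next
    case (sum s1 s2)
    then show ?case using ordlim_add by blast
  qed
qed

lemma low_mat_tangent: "low_mat \<in> tangent_space n XS"
proof -
  define \<delta> where "\<delta> a = (THE c. \<forall>h\<in>a. ((\<lambda>t. h (curve t)) has_field_derivative c) (at 0))" for a
  have "c = \<delta> (germ n XS h)" if hd: "has_differential n XS h low_mat c" for h c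
  proof -
    have h: "h \<in> carrier Rg" using has_differential_regular[OF hd] .
    have c: "((\<lambda>t. h (curve t)) has_field_derivative c) (at 0)" using has_differential_low_mat[OF hd] .
    have "\<delta> (germ n XS h) = c"
      unfolding \<delta>_def
    proof (rule the_equality)
      show "\<forall>h'\<in>germ n XS h. ((\<lambda>t. h' (curve t)) has_field_derivative c) (at 0)"
      proof
        fix h' assume "h' \<in> germ n XS h"
        then have "near (\<lambda>M. h' M = h M)" using germ_eq[OF h] by simp
        then have "\<forall>\<^sub>F t in nhds 0. h' (curve t) = h (curve t)" by (rule near_curve)
        then show "((\<lambda>t. h' (curve t)) has_field_derivative c) (at 0)"
          using c DERIV_cong_ev[OF refl \<open>\<forall>\<^sub>F t in nhds 0. h' (curve t) = h (curve t)\<close> refl] by blast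
      qed
      fix c' assume "\<forall>h'\<in>germ n XS h. ((\<lambda>t. h' (curve t)) has_field_derivative c') (at 0)"
      then show "c' = c" using germ_self[OF h] c DERIV_unique by blast
    qed
    then show ?thesis by simp
  qed
  then show ?thesis unfolding tangent_space_def by auto
qed

lemma differential_low_mat:
  assumes a: "a \<in> max_ideal n XS"
  shows "ordlim 1 a (differential n XS a low_mat)"
proof -
  obtain h where h: "h \<in> carrier Rg" "h (base_pt n) = 0" "a = germ n XS h" using a by (auto simp: max_ideal_def)
  obtain c where hd: "has_differential n XS h low_mat c"
    using has_differential_exists[OF h(1) mats_carrier(2)] by blast
  have "differential n XS a low_mat = c"
    unfolding h(3) by (rule differential_eq[OF low_mat_tangent hd])
  then show ?thesis
    unfolding h(3) using ordlim_deriv[OF h(1,2) has_differential_low_mat[OF hd]] by simp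
qed

text \<open>
  The coefficients of \<open>C\<close> are the values on the homogeneous components of \<open>s\<close> of the leading
  coefficients along the curve. As a polynomial, \<open>C\<close> turns the convolution product of the graded ring
  into multiplication, and its value at 1 is the value of the element of the cone's coordinate ring
  at the velocity of the curve.
\<close>

definition graded_values :: "(nat \<Rightarrow> (flag \<Rightarrow> complex) set set) \<Rightarrow> complex poly \<Rightarrow> bool" where
  "graded_values s C \<longleftrightarrow> (\<forall>k. \<exists>a\<in>mpow k. s k = gr_coset n XS k a \<and> ordlim k a (coeff C k))"

lemma ordlim_gr_coset:
  assumes a: "a \<in> mpow k" "ordlim k a c" and b: "b \<in> gr_coset n XS k a"
  shows "b \<in> mpow k \<and> ordlim k b c"
proof -
  obtain r where r: "r \<in> mpow (Suc k)" "b = r \<oplus>\<^bsub>LR\<^esub> a"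
    using b gr_coset_mem[OF mpow_carrier[OF a(1)]] by blast
  obtain c' where "ordlim (Suc k) r c'" using mpow_ordlim[OF r(1)] by blast
  then have "ordlim k r 0" by (rule ordlim_Suc)
  then have "ordlim k b (0 + c)" unfolding r(2) using a(2) by (rule ordlim_add)
  moreover have "b \<in> mpow k" unfolding r(2) using r(1) mpow_Suc a(1) by (intro add_mpow) blast+
  ultimately show ?thesis by simp
qed

lemma graded_values_mem:
  assumes "graded_values s C" "b \<in> s k"
  shows "b \<in> mpow k \<and> ordlim k b (coeff C k)"
  using assms ordlim_gr_coset unfolding graded_values_def by metis

lemma graded_values_some:
  assumes "graded_values s C"
  shows "(SOME b. b \<in> s k) \<in> mpow k \<and> ordlim k (SOME b. b \<in> s k) (coeff C k)"
proof -
  obtain a where a: "a \<in> mpow k" "s k = gr_coset n XS k a" using assms unfolding graded_values_def by blast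
  have "(SOME b. b \<in> s k) \<in> s k" using gr_coset_self[OF mpow_carrier[OF a(1)]] unfolding a(2) by (rule someI)
  then show ?thesis using graded_values_mem[OF assms] by blast
qed

lemma graded_values_homog:
  assumes "a \<in> mpow k" "ordlim k a c"
  shows "graded_values (gr_homog n XS k a) (monom c k)"
  unfolding graded_values_def
proof
  fix i
  show "\<exists>b\<in>mpow i. gr_homog n XS k a i = gr_coset n XS i b \<and> ordlim i b (coeff (monom c k) i)"
  proof (cases "i = k")
    case True
    then show ?thesis using assms by (intro bexI[of _ a]) (simp_all add: gr_homog_def)
  next
    case False
    then show ?thesis
      using ordlim_zero[of i] zero_mpow
      by (intro bexI[of _ "\<zero>\<^bsub>LR\<^esub>"])
         (simp_all add: gr_homog_def gr_coset_zero[OF zero_mpow] del: max_ideal_pow.simps)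
  qed
qed

lemma graded_values_add:
  assumes "graded_values s C" "graded_values t D"
  shows "graded_values (s \<oplus>\<^bsub>gr_ring n XS\<^esub> t) (C + D)"
  unfolding graded_values_def
proof
  fix k
  obtain a where a: "a \<in> mpow k" "s k = gr_coset n XS k a" "ordlim k a (coeff C k)"
    using assms(1) unfolding graded_values_def by blast
  obtain b where b: "b \<in> mpow k" "t k = gr_coset n XS k b" "ordlim k b (coeff D k)"
    using assms(2) unfolding graded_values_def by blast
  show "\<exists>c\<in>mpow k. (s \<oplus>\<^bsub>gr_ring n XS\<^esub> t) k = gr_coset n XS k c \<and> ordlim k c (coeff (C + D) k)"
    using a b ordlim_add[OF a(3) b(3)]
    by (intro bexI[of _ "a \<oplus>\<^bsub>LR\<^esub> b"]) (simp_all add: gr_simps gr_coset_add mpow_carrier add_mpow)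
qed

lemma ordlim_finsum:
  assumes "finite S" "\<And>i. i \<in> S \<Longrightarrow> ordlim k (f i) (c i)"
  shows "ordlim k (finsum LR f S) (\<Sum>i\<in>S. c i)"
proof -
  interpret LR: cring LR by (rule cring_LR)
  show ?thesis
    using assms
  proof (induction S)
    case empty
    then show ?case by (simp add: ordlim_zero)
  next
    case (insert x S)
    then have "f \<in> S \<rightarrow> carrier LR" "f x \<in> carrier LR" by (auto simp: ordlim_def)
    with insert show ?case by (simp add: ordlim_add)
  qed
qed

lemma graded_values_mult:
  assumes "graded_values s C" "graded_values t D"
  shows "graded_values (s \<otimes>\<^bsub>gr_ring n XS\<^esub> t) (C * D)"
  unfolding graded_values_def
proof
  fix k
  define P where "P i = (SOME a. a \<in> s i)" for i
  define Q where "Q i = (SOME a. a \<in> t i)" for i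
  have P: "P i \<in> mpow i" "ordlim i (P i) (coeff C i)" for i
    using graded_values_some[OF assms(1)] by (auto simp: P_def)
  have Q: "Q i \<in> mpow i" "ordlim i (Q i) (coeff D i)" for i
    using graded_values_some[OF assms(2)] by (auto simp: Q_def)
  define S where "S = (\<Oplus>\<^bsub>LR\<^esub>i\<in>{..k}. P i \<otimes>\<^bsub>LR\<^esub> Q (k - i))"
  have "S \<in> mpow k" unfolding S_def
  proof (rule finsum_mpow)
    fix i assume "i \<in> {..k}"
    then show "P i \<otimes>\<^bsub>LR\<^esub> Q (k - i) \<in> mpow k" using mpow_mult[OF P(1)[of i] Q(1)[of "k - i"]] by simp
  qed
  moreover have "ordlim k S (coeff (C * D) k)"
    unfolding S_def coeff_mult
  proof (rule ordlim_finsum)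
    fix i assume "i \<in> {..k}"
    then show "ordlim k (P i \<otimes>\<^bsub>LR\<^esub> Q (k - i)) (coeff C i * coeff D (k - i))"
      using ordlim_mult[OF P(2)[of i] Q(2)[of "k - i"]] by simp
  qed simp
  moreover have "(s \<otimes>\<^bsub>gr_ring n XS\<^esub> t) k = gr_coset n XS k S" by (simp add: gr_simps S_def P_def Q_def)
  ultimately show "\<exists>a\<in>mpow k. (s \<otimes>\<^bsub>gr_ring n XS\<^esub> t) k = gr_coset n XS k a \<and> ordlim k a (coeff (C * D) k)"
    by blast
qed

lemma sym_to_gr_values:
  "(q, s) \<in> sym_to_gr n XS \<Longrightarrow> \<exists>C. graded_values s C \<and> q low_mat = poly C 1"
proof (induction q s rule: sym_to_gr.induct)
  case (const c)
  have "graded_values (gr_homog n XS 0 (germ n XS (\<lambda>_. c))) (monom c 0)"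
    by (intro graded_values_homog ordlim_const) (simp add: germ_closed regular_const)
  then show ?case using low_mat_tangent by (intro exI[of _ "monom c 0"]) (simp add: poly_monom)
next
  case (lin a)
  then show ?case
    using graded_values_homog[of a 1] differential_low_mat[OF lin] mpow_1
    by (intro exI[of _ "monom (differential n XS a low_mat) 1"]) (simp add: poly_monom)
next
  case (add q s q' s')
  then obtain C D where "graded_values s C" "q low_mat = poly C 1" "graded_values s' D" "q' low_mat = poly D 1"
    by blast
  then show ?case using graded_values_add low_mat_tangent by (intro exI[of _ "C + D"]) simp
next
  case (mult q s q' s')
  then obtain C D where "graded_values s C" "q low_mat = poly C 1" "graded_values s' D" "q' low_mat = poly D 1"
    by blast
  then show ?case using graded_values_mult low_mat_tangent by (intro exI[of _ "C * D"]) simp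
qed

lemma tangent_cone_low_mat:
  assumes "q \<in> tangent_cone n XS E'"
  shows "q low_mat = 0"
proof -
  obtain C where C: "graded_values \<zero>\<^bsub>gr_ring n XS\<^esub> C" "restrict q (tangent_space n XS) low_mat = poly C 1"
    using assms sym_to_gr_values unfolding tangent_cone_def by blast
  have "coeff C k = 0" for k
  proof -
    have "\<zero>\<^bsub>LR\<^esub> \<in> \<zero>\<^bsub>gr_ring n XS\<^esub> k" using zero_mpow by (simp add: gr_simps del: max_ideal_pow.simps)
    then have "ordlim k \<zero>\<^bsub>LR\<^esub> (coeff C k)" using graded_values_mem[OF C(1)] by blast
    then show ?thesis using ordlim_unique ordlim_zero by blast
  qed
  then have "C = 0" by (intro poly_eqI) simp
  then show ?thesis using C(2) low_mat_tangent by simp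
qed

end

section \<open>Involutions are determined by their rank functions\<close>

lemma (in affine_involution) rk_step: "rk i j = rk i (j - 1) + (if w j \<ge> i then 1 else 0)"
proof -
  have "{k. k \<le> j \<and> w k \<ge> i} = (if w j \<ge> i then insert j {k. k \<le> j - 1 \<and> w k \<ge> i} else {k. k \<le> j - 1 \<and> w k \<ge> i})"
  proof -
    have "k \<le> j \<longleftrightarrow> k = j \<or> k \<le> j - 1" for k by auto
    then show ?thesis by auto
  qed
  then show ?thesis using finite_rk[of "j - 1" i] by (simp add: rk_def)
qed

text \<open>
  The differences of the rank function in \<open>j\<close> determine \<open>w j\<close> whenever \<open>w j > j\<close>, and an involution
  is determined by its pairs \<open>j < w j\<close>. The range of \<open>j\<close> suffices by periodicity.
\<close>

lemma rk_determines_involution: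
  assumes v: "affine_involution n v" and w: "affine_involution n w"
    and eq: "\<And>i j. 0 \<le> j \<Longrightarrow> j \<le> int n \<Longrightarrow> j < i \<Longrightarrow>
      affine_involution.rk v i j = affine_involution.rk w i j"
  shows "v = w"
proof -
  interpret v: affine_involution n v by fact
  interpret w: affine_involution n w by fact
  have ge: "v j \<ge> i \<longleftrightarrow> w j \<ge> i" if "1 \<le> j" "j \<le> int n" "j < i" for i j
    using v.rk_step[of i j] w.rk_step[of i j] eq[of j i] eq[of "j - 1" i] that by (auto split: if_splits)
  have small: "v j = w j" if "1 \<le> j" "j \<le> int n" "v j > j \<or> w j > j" for j
    using ge[OF that(1,2), of "v j"] ge[OF that(1,2), of "w j"] that(3) by linarith
  have up: "v j = w j" if "v j > j \<or> w j > j" for j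
  proof -
    define q where "q = int (v.idx j) + 1"
    have j: "j = q + int n * (- v.zord j)" using v.idx_zord[of j] by (simp add: q_def)
    have shift: "v j = v q + int n * (- v.zord j)" "w j = w q + int n * (- v.zord j)"
      using v.w_shift[of q "- v.zord j"] w.w_shift[of q "- v.zord j"] j by simp_all
    have "1 \<le> q" "q \<le> int n" using v.idx_less[of j] unfolding q_def by linarith+
    moreover have "v q > q \<or> w q > q" using that shift j by linarith
    ultimately show ?thesis using small shift by simp
  qed
  show ?thesis
  proof
    fix j
    consider "v j > j \<or> w j > j" | "v j < j" | "w j < j" | "v j = j" "w j = j" by linarith
    then show "v j = w j"
    proof cases
      case 1
      then show ?thesis by (rule up)
    next
      case 2
      then have "w (v j) = j" using up[of "v j"] by simp
      then show ?thesis using w.w_w by metis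
    next
      case 3
      then have "v (w j) = j" using up[of "w j"] by simp
      then show ?thesis using v.w_w by metis
    qed simp
  qed
qed

section \<open>Distinct involutions have distinct tangent cones\<close>

text \<open>
  In the rows \<open>v k\<close> and columns \<open>k\<close> with \<open>k \<le> j < i \<le> v k\<close> the matrix \<open>low_mat\<close> of \<open>v\<close> has the minor 1.
  This minor is too large not to vanish on the cone of \<open>w\<close>.
\<close>

lemma tangent_cone_neq_if_rk_less:
  assumes v: "affine_involution n v" and w: "affine_involution n w"
    and j: "j \<le> n" "int j < i"
    and less: "affine_involution.rk w i (int j) < affine_involution.rk v i (int j)"
    and E': "is_tangent_subspace n E'" "tangent_space n (schubert n v) \<subseteq> E'" "tangent_space n (schubert n w) \<subseteq> E'"
  shows "tangent_cone n (schubert n v) E' \<noteq> tangent_cone n (schubert n w) E'"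
proof
  interpret v: affine_involution n v by fact
  interpret w: affine_involution n w by fact
  assume eq: "tangent_cone n (schubert n v) E' = tangent_cone n (schubert n w) E'"
  define S where "S = {k. k \<le> int j \<and> v k \<ge> i}"
  define m where "m = v.rk i (int j)"
  have "finite S" "card S = m" unfolding S_def m_def v.rk_def using v.finite_rk by simp_all
  then obtain l where l: "bij_betw l {..<m} S" using ex_bij_betw_nat_finite by (auto simp: atLeast0LessThan)
  have lS: "l b \<le> int j" "v (l b) \<ge> i" if "b < m" for b
    using l that by (auto simp: bij_betw_def S_def)
  define q where "q = (\<lambda>x\<in>E'. det (sqmat m (\<lambda>a b. v.cf (v (l a)) (x *\<^sub>v v.E (l b)))))"
  have "q \<in> tangent_cone n (schubert n w) E'"
    unfolding q_def
  proof (rule w.det_in_tangent_cone[OF E'(1,3) j(1)])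
    show "l b \<le> int j" if "b < m" for b using lS(1)[OF that] .
    show "v (l a) > int j" if "a < m" for a using lS(2)[OF that] j(2) by simp
    fix M assume M: "M \<in> schubert n w" "M \<in> v.big_cell"
    show "det (sqmat m (\<lambda>a b. v.cf (v (l a)) (v.canv M j (l b)))) = 0"
      using lS less by (intro w.schubert_minor[OF M j(1), where i = i]) (auto simp: m_def)
  qed
  then have "q v.low_mat = 0" using eq v.tangent_cone_low_mat by blast
  moreover have "q v.low_mat = 1"
  proof -
    have "v.cf (v (l a)) (v.low_mat *\<^sub>v v.E (l b)) = (if a = b then 1 else 0)" if "a < m" "b < m" for a b
    proof -
      have "v (l a) = v (l b) \<longleftrightarrow> a = b"
        using l that v.w_w by (metis bij_betw_def inj_on_def lessThan_iff)
      moreover have "v (l b) > l b" using lS[OF that(2)] j(2) by simp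
      ultimately show ?thesis by (simp add: v.low_mat_E v.cf_E)
    qed
    then have "sqmat m (\<lambda>a b. v.cf (v (l a)) (v.low_mat *\<^sub>v v.E (l b))) = 1\<^sub>m m"
      by (intro eq_matI) auto
    then show ?thesis using E'(2) v.low_mat_tangent by (auto simp: q_def)
  qed
  ultimately show False by simp
qed

theorem theorem1p2:
  fixes n :: nat and w1 w2 :: "int \<Rightarrow> int" and E :: "ratfun mat set"
  assumes "n \<ge> 2"
    and "w1 \<in> affine_sym n" and "w2 \<in> affine_sym n"
    and "w1 \<circ> w1 = id" and "w2 \<circ> w2 = id" and "w1 \<noteq> w2"
    and "is_tangent_subspace n E"
    and "tangent_space n (schubert n w1) \<subseteq> E" and "tangent_space n (schubert n w2) \<subseteq> E"
  shows "tangent_cone n (schubert n w1) E \<noteq> tangent_cone n (schubert n w2) E"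
proof -
  have w1: "affine_involution n w1" and w2: "affine_involution n w2"
    using assms by unfold_locales auto
  obtain i j where j: "0 \<le> j" "j \<le> int n" "j < i"
    and neq: "affine_involution.rk w1 i j \<noteq> affine_involution.rk w2 i j"
    using rk_determines_involution[OF w1 w2] \<open>w1 \<noteq> w2\<close> by blast
  obtain j' where j': "j = int j'" using j(1) nonneg_int_cases by blast
  then have "j' \<le> n" "int j' < i" using j by auto
  then show ?thesis
    using tangent_cone_neq_if_rk_less[OF w1 w2, of j' i E] tangent_cone_neq_if_rk_less[OF w2 w1, of j' i E]
      neq assms(7,8,9) by (fastforce simp: j' neq_iff)
qed

end
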